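(* Let $(\mathcal L,\Delta,S)$ be a proper locality on $\mathcal F$, let $\Delta^+$ be an $\mathcal F$-closed collection of subgroups of $S$ with $\Delta\subseteq\Delta^+\subseteq\mathcal F^s$, and let $(\mathcal L^+,\Delta^+,S)$ be the proper locality on $\mathcal F$ whose restriction to $\Delta$ is $\mathcal L$. Let $\mathcal N$ be a partial normal subgroup of $\mathcal L$, and set $T=S\cap\mathcal N$. Then there exists a unique partial normal subgroup $\mathcal N^+$ of $\mathcal L^+$ such that $\mathcal N=\mathcal N^+\cap\mathcal L$. Moreover, the mapping $\mathcal N\mapsto\mathcal N^+$ is an inclusion-preserving bijection from the set of partial normal subgroups of $\mathcal L$ to the set of partial normal subgroups of $\mathcal L^+$.
   Context: The locality $(\mathcal L^+,\Delta^+,S)$ exists and is unique up to a unique isomorphism restricting to the identity on $\mathcal L$. Fix a prime $p$. All groups and partial groups are finite; maps are written on the right; $x^g=g^{-1}xg$. **Partial groups.** For a set $\mathcal L$ let $\mathbf W(\mathcal L)$ be the free monoid of words in $\mathcal L$, with concatenation $\circ$ and empty word $\emptyset$; elements of $\mathcal L$ are identified with words of length 1. A partial group is a non-empty set $\mathcal L$ with a subset $\mathbf D=\mathbf D(\mathcal L)\subseteq\mathbf W(\mathcal L)$, a map $\Pi:\mathbf D\to\mathcal L$ and an involutory bijection $g\mapsto g^{-1}$ of $\mathcal L$, extended to words by $(g_1,\dots,g_n)^{-1}=(g_n^{-1},\dots,g_1^{-1})$, such that: (1) $\mathcal L\subseteq\mathbf D$, and $u\circ v\in\mathbf D$ implies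 $u,v\in\mathbf D$; (2) $\Pi$ is the identity on $\mathcal L$; (3) $u\circ v\circ w\in\mathbf D$ implies $u\circ(\Pi(v))\circ w\in\mathbf D$ and $\Pi(u\circ v\circ w)=\Pi(u\circ(\Pi(v))\circ w)$; (4) $w\in\mathbf D$ implies $w^{-1}\circ w\in\mathbf D$ and $\Pi(w^{-1}\circ w)=\mathbf 1:=\Pi(\emptyset)$. A partial subgroup is a non-empty subset $\mathcal H$ closed under inversion with $\Pi(w)\in\mathcal H$ for all $w\in\mathbf W(\mathcal H)\cap\mathbf D$; it is a subgroup if $\mathbf W(\mathcal H)\subseteq\mathbf D$. Write $\mathbf D(g)=\{x:(g^{-1},x,g)\in\mathbf D\}$ and $x^g=\Pi(g^{-1},x,g)$ for $x\in\mathbf D(g)$; $X^g$ is defined if $X\subseteq\mathbf D(g)$. A partial subgroup $\mathcal N$ is a partial normal subgroup ($\mathcal N\trianglelefteq\mathcal L$) if $x^g\in\mathcal N$ for all $g\in\mathcal L$ and $x\in\mathcal N\cap\mathbf D(g)$. $N_{\mathcal L}(X)=\{g: X\subseteq\mathbf D(g),X^g=X\}$. **Localities.** $(\mathcal L,\Delta,S)$ is a locality if $\mathcal L$ is a finite partial group, $S$ is a $p$-subgroup of $\mathcal L$ maximal among the $p$-subgroups of $\mathcal L$, $\Delta$ is a set of subgroups of $S$ with $S\in\Delta$, and: (O1) $w=(g_1,\dots,g_n)\in\mathbf D$ iff there are $X_0,\dots,X_n\in\Delta$ with $X_{i-1}^{g_i}$ defined and equal to $X_i$ for all $i$; (O2)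 if $X,Z\in\Delta$, $g\in\mathcal L$, $X^g$ is defined and $X^g\le Y\le Z$, then $Y\in\Delta$. For $w=(g_1,\dots,g_n)\in\mathbf W(\mathcal L)$, $S_w$ is the set (a subgroup) of $x\in S$ for which there are $x=x_0,\dots,x_n\in S$ with $x_{i-1}^{g_i}$ defined and equal to $x_i$; $S_g=S_{(g)}$. For $P\in\Delta$, $N_{\mathcal L}(P)$ is a subgroup. **Fusion systems.** A fusion system $\mathcal F$ on $S$ is a category whose objects are the subgroups of $S$, whose morphisms are injective group homomorphisms, containing all maps $c_g:P\to Q$ ($g\in S$, $P^g\le Q$), and such that for each morphism $\phi:P\to Q$ the bijection $P\to P\phi$ is an $\mathcal F$-isomorphism. $P^{\mathcal F}$ is the set of $\mathcal F$-conjugates $P\phi$ of $P$. $P$ is fully normalized if $|N_S(P)|\ge|N_S(P')|$ for all $P'\in P^{\mathcal F}$. $N_{\mathcal F}(U)$ is the fusion system on $N_S(U)$ whose morphisms $P\to Q$ are restrictions of $\mathcal F$-homomorphisms $\phi:PU\to QU$ with $U\phi=U$; $U$ is normal in $\mathcal F$ if $\mathcal F=N_{\mathcal F}(U)$; $O_p(\mathcal F)$ is the largest such $U$. $P$ is centric ($P\in\mathcal F^c$) if $C_S(Q)\le Q$ for all $Q\in P^{\mathcal F}$; radical if some fully normalized $Q\in P^{\mathcal F}$ has $Q=O_p(N_{\mathcal F}(Q))$; subcentric ($P\in\mathcal F^s$) if some fully normalized $Q\in P^{\mathcal F}$ has $O_p(N_{\mathcal F}(Q))\in\mathcal F^c$.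 $\mathcal F^{cr}$ is the set of centric radical subgroups. A non-empty set of subgroups of $S$ is $\mathcal F$-closed if it is closed under $\mathcal F$-conjugation and under overgroups in $S$. **Proper localities.** $(\mathcal L,\Delta,S)$ is a locality on $\mathcal F$ if $\mathcal F=\mathcal F_S(\mathcal L)$, the fusion system on $S$ generated by the conjugation maps $c_g:S_g\to S$, $g\in\mathcal L$ (its isomorphisms are composites of restrictions of the maps $c_g:S_g\to S_{g^{-1}}$). It is proper if $\mathcal F^{cr}\subseteq\Delta$ and $G=N_{\mathcal L}(P)$ satisfies $C_G(O_p(G))\le O_p(G)$ for each $P\in\Delta$. **Restriction.** For an $\mathcal F$-closed $\Gamma\subseteq\Delta$, the restriction $\mathcal L\mid_\Gamma$ is $\{g\in\mathcal L: S_g\in\Gamma\}$ with $\mathbf D(\mathcal L\mid_\Gamma)=\{w\in\mathbf W(\mathcal L):S_w\in\Gamma\}$ and product and inversion inherited from $\mathcal L$. *)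

theory Defs
  imports "HOL-Algebra.Group_Action" "HOL-Computational_Algebra.Primes"
begin

section \<open>Partial groups\<close>

record 'a pgroup =
  pcarrier :: "'a set"
  pdom :: "'a list set"
  pprod :: "'a list \<Rightarrow> 'a"
  pinv :: "'a \<Rightarrow> 'a"

definition word_inv :: "'a pgroup \<Rightarrow> 'a list \<Rightarrow> 'a list" where
  "word_inv L w = rev (map (pinv L) w)"

text \<open>The fields \<^const>\<open>pprod\<close> and \<^const>\<open>pinv\<close> are total functions; only their values on
  \<^const>\<open>pdom\<close> and \<^const>\<open>pcarrier\<close>, respectively, are meaningful.\<close>

locale partial_group =
  fixes L :: "'a pgroup"
  assumes nonempty: "pcarrier L \<noteq> {}"
    and dom_words: "pdom L \<subseteq> lists (pcarrier L)"
    and prod_closed: "w \<in> pdom L \<Longrightarrow> pprod L w \<in> pcarrier L"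
    and inv_closed: "g \<in> pcarrier L \<Longrightarrow> pinv L g \<in> pcarrier L"
    and inv_inv: "g \<in> pcarrier L \<Longrightarrow> pinv L (pinv L g) = g"
    and singleton_dom: "g \<in> pcarrier L \<Longrightarrow> [g] \<in> pdom L"
    and append_dom: "u @ v \<in> pdom L \<Longrightarrow> u \<in> pdom L \<and> v \<in> pdom L"
    and prod_singleton: "g \<in> pcarrier L \<Longrightarrow> pprod L [g] = g"
    and contract_dom: "u @ v @ w \<in> pdom L \<Longrightarrow> u @ [pprod L v] @ w \<in> pdom L"
    and contract_prod:
      "u @ v @ w \<in> pdom L \<Longrightarrow> pprod L (u @ v @ w) = pprod L (u @ [pprod L v] @ w)"
    and inv_dom: "w \<in> pdom L \<Longrightarrow> word_inv L w @ w \<in> pdom L"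
    and inv_prod: "w \<in> pdom L \<Longrightarrow> pprod L (word_inv L w @ w) = pprod L []"

definition partial_subgroup :: "'a pgroup \<Rightarrow> 'a set \<Rightarrow> bool" where
  "partial_subgroup L H \<longleftrightarrow>
     H \<noteq> {} \<and> H \<subseteq> pcarrier L \<and> (\<forall>h\<in>H. pinv L h \<in> H) \<and>
     (\<forall>w \<in> lists H \<inter> pdom L. pprod L w \<in> H)"

definition pg_subgroup :: "'a pgroup \<Rightarrow> 'a set \<Rightarrow> bool" where
  "pg_subgroup L H \<longleftrightarrow> partial_subgroup L H \<and> lists H \<subseteq> pdom L"

definition p_subgroup :: "nat \<Rightarrow> 'a pgroup \<Rightarrow> 'a set \<Rightarrow> bool" where
  "p_subgroup p L H \<longleftrightarrow> pg_subgroup L H \<and> (\<exists>n. card H = p ^ n)"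

definition conj_dom :: "'a pgroup \<Rightarrow> 'a \<Rightarrow> 'a set" where
  "conj_dom L g = {x \<in> pcarrier L. [pinv L g, x, g] \<in> pdom L}"

definition pconj :: "'a pgroup \<Rightarrow> 'a \<Rightarrow> 'a \<Rightarrow> 'a" where
  "pconj L g x = pprod L [pinv L g, x, g]"

definition partial_normal :: "'a pgroup \<Rightarrow> 'a set \<Rightarrow> bool" where
  "partial_normal L N \<longleftrightarrow>
     partial_subgroup L N \<and> (\<forall>g \<in> pcarrier L. \<forall>x \<in> N \<inter> conj_dom L g. pconj L g x \<in> N)"

definition pnormalizer :: "'a pgroup \<Rightarrow> 'a set \<Rightarrow> 'a set" where
  "pnormalizer L X = {g \<in> pcarrier L. X \<subseteq> conj_dom L g \<and> pconj L g ` X = X}"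

text \<open>A subgroup of a partial group as a group. The multiplication is made undefined outside
  the carrier, so that the group depends only on the product of elements of \<open>H\<close>.\<close>

definition pg_group :: "'a pgroup \<Rightarrow> 'a set \<Rightarrow> 'a monoid" where
  "pg_group L H =
     \<lparr>carrier = H,
      monoid.mult = (\<lambda>x y. if x \<in> H \<and> y \<in> H then pprod L [x, y] else undefined),
      one = pprod L []\<rparr>"

text \<open>Partial groups coincide if they agree wherever the record fields are meaningful.\<close>

definition pgroup_eq :: "'a pgroup \<Rightarrow> 'a pgroup \<Rightarrow> bool" where
  "pgroup_eq L M \<longleftrightarrow>
     pcarrier L = pcarrier M \<and> pdom L = pdom M \<and>
     (\<forall>w \<in> pdom L. pprod L w = pprod M w) \<and>
     (\<forall>g \<in> pcarrier L. pinv L g = pinv M g)"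


section \<open>Localities\<close>

text \<open>\<open>X \<le> Y\<close> between subgroups is rendered as inclusion together with both sets being subgroups;
  in the last clause this includes the assertion that the conjugate of \<open>X\<close> is a subgroup.\<close>

definition locality :: "nat \<Rightarrow> 'a pgroup \<Rightarrow> 'a set set \<Rightarrow> 'a set \<Rightarrow> bool" where
  "locality p L \<Delta> S \<longleftrightarrow>
     partial_group L \<and> finite (pcarrier L) \<and>
     p_subgroup p L S \<and> (\<forall>R. p_subgroup p L R \<and> S \<subseteq> R \<longrightarrow> R = S) \<and>
     (\<forall>P\<in>\<Delta>. pg_subgroup L P \<and> P \<subseteq> S) \<and> S \<in> \<Delta> \<and>
     (\<forall>w \<in> lists (pcarrier L).
        w \<in> pdom L \<longleftrightarrow>
        (\<exists>Xs. length Xs = Suc (length w) \<and> set Xs \<subseteq> \<Delta> \<and>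
              (\<forall>i < length w. Xs ! i \<subseteq> conj_dom L (w ! i) \<and>
                 pconj L (w ! i) ` (Xs ! i) = Xs ! Suc i))) \<and>
     (\<forall>X\<in>\<Delta>. \<forall>Z\<in>\<Delta>. \<forall>g \<in> pcarrier L. \<forall>Y.
        X \<subseteq> conj_dom L g \<and> pg_subgroup L (pconj L g ` X) \<and> pg_subgroup L Y \<and>
        pconj L g ` X \<subseteq> Y \<and> Y \<subseteq> Z \<longrightarrow> Y \<in> \<Delta>)"

definition word_stab :: "'a pgroup \<Rightarrow> 'a set \<Rightarrow> 'a list \<Rightarrow> 'a set" where
  "word_stab L S w =
     {x \<in> S. \<exists>xs. length xs = Suc (length w) \<and> xs ! 0 = x \<and> set xs \<subseteq> S \<and>
        (\<forall>i < length w. xs ! i \<in> conj_dom L (w ! i) \<and> pconj L (w ! i) (xs ! i) = xs ! Suc i)}"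

definition pg_restriction :: "'a pgroup \<Rightarrow> 'a set \<Rightarrow> 'a set set \<Rightarrow> 'a pgroup" where
  "pg_restriction L S \<Gamma> =
     \<lparr>pcarrier = {g \<in> pcarrier L. word_stab L S [g] \<in> \<Gamma>},
      pdom = {w \<in> lists (pcarrier L). word_stab L S w \<in> \<Gamma>},
      pprod = pprod L,
      pinv = pinv L\<rparr>"


section \<open>Fusion systems\<close>

text \<open>A fusion system is stored as the group it lives on together with its morphism sets.
  A morphism with domain \<open>P\<close> is a function that is undefined outside \<open>P\<close>; there are no
  morphisms between sets that are not subgroups. Hence equality of records is equality of
  fusion systems.\<close>

record 'a fusion =
  fgroup :: "'a monoid"
  fhom :: "'a set \<Rightarrow> 'a set \<Rightarrow> ('a \<Rightarrow> 'a) set"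

locale fusion_system =
  fixes F :: "'a fusion"
  assumes group: "group (fgroup F)"
    and morphism: "\<phi> \<in> fhom F P Q \<Longrightarrow>
      subgroup P (fgroup F) \<and> subgroup Q (fgroup F) \<and>
      \<phi> \<in> hom ((fgroup F)\<lparr>carrier := P\<rparr>) ((fgroup F)\<lparr>carrier := Q\<rparr>) \<and>
      inj_on \<phi> P \<and> \<phi> \<in> extensional P"
    and composition: "\<phi> \<in> fhom F P Q \<Longrightarrow> \<psi> \<in> fhom F Q R \<Longrightarrow> compose P \<psi> \<phi> \<in> fhom F P R"
    and conjugation: "subgroup P (fgroup F) \<Longrightarrow> subgroup Q (fgroup F) \<Longrightarrow> g \<in> carrier (fgroup F) \<Longrightarrow>
      (\<lambda>x. inv\<^bsub>fgroup F\<^esub> g \<otimes>\<^bsub>fgroup F\<^esub> x \<otimes>\<^bsub>fgroup F\<^esub> g) ` P \<subseteq> Q \<Longrightarrow>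
      (\<lambda>x\<in>P. inv\<^bsub>fgroup F\<^esub> g \<otimes>\<^bsub>fgroup F\<^esub> x \<otimes>\<^bsub>fgroup F\<^esub> g) \<in> fhom F P Q"
    and isomorphism: "\<phi> \<in> fhom F P Q \<Longrightarrow>
      \<phi> \<in> fhom F P (\<phi> ` P) \<and> restrict (inv_into P \<phi>) (\<phi> ` P) \<in> fhom F (\<phi> ` P) P"

text \<open>The smallest fusion system on \<open>G\<close> containing the morphisms in \<open>X\<close>, given as triples
  (source, target, map).\<close>

definition generated_fusion ::
  "'a monoid \<Rightarrow> ('a set \<times> 'a set \<times> ('a \<Rightarrow> 'a)) set \<Rightarrow> 'a fusion" where
  "generated_fusion G X =
     \<lparr>fgroup = G,
      fhom = (\<lambda>P Q. {\<phi>. \<forall>E. fusion_system E \<and> fgroup E = G \<and>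
                          (\<forall>(A, B, \<chi>) \<in> X. \<chi> \<in> fhom E A B) \<longrightarrow> \<phi> \<in> fhom E P Q})\<rparr>"

definition fconjugates :: "'a fusion \<Rightarrow> 'a set \<Rightarrow> 'a set set" where
  "fconjugates F P = {\<phi> ` P | \<phi> Q. \<phi> \<in> fhom F P Q}"

definition fully_normalized :: "'a fusion \<Rightarrow> 'a set \<Rightarrow> bool" where
  "fully_normalized F P \<longleftrightarrow>
     subgroup P (fgroup F) \<and>
     (\<forall>P' \<in> fconjugates F P. card (normalizer (fgroup F) P') \<le> card (normalizer (fgroup F) P))"

definition fnormalizer :: "'a fusion \<Rightarrow> 'a set \<Rightarrow> 'a fusion" where
  "fnormalizer F U =
     (let N = (fgroup F)\<lparr>carrier := normalizer (fgroup F) U\<rparr>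
      in \<lparr>fgroup = N,
          fhom = (\<lambda>P Q. {restrict \<phi> P | \<phi>. subgroup P N \<and> subgroup Q N \<and>
                    \<phi> \<in> fhom F (P <#>\<^bsub>fgroup F\<^esub> U) (Q <#>\<^bsub>fgroup F\<^esub> U) \<and>
                    \<phi> ` U = U \<and> \<phi> ` P \<subseteq> Q})\<rparr>)"

definition fnormal :: "'a fusion \<Rightarrow> 'a set \<Rightarrow> bool" where
  "fnormal F U \<longleftrightarrow> subgroup U (fgroup F) \<and> F = fnormalizer F U"

definition fusion_core :: "'a fusion \<Rightarrow> 'a set" where
  "fusion_core F = (GREATEST U. fnormal F U)"

definition centralizer :: "'a monoid \<Rightarrow> 'a set \<Rightarrow> 'a set" where
  "centralizer G X = {g \<in> carrier G. \<forall>x\<in>X. g \<otimes>\<^bsub>G\<^esub> x = x \<otimes>\<^bsub>G\<^esub> g}"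

definition centrics :: "'a fusion \<Rightarrow> 'a set set" where
  "centrics F =
     {P. subgroup P (fgroup F) \<and> (\<forall>Q \<in> fconjugates F P. centralizer (fgroup F) Q \<subseteq> Q)}"

definition radicals :: "'a fusion \<Rightarrow> 'a set set" where
  "radicals F =
     {P. subgroup P (fgroup F) \<and>
         (\<exists>Q \<in> fconjugates F P. fully_normalized F Q \<and> Q = fusion_core (fnormalizer F Q))}"

definition subcentrics :: "'a fusion \<Rightarrow> 'a set set" where
  "subcentrics F =
     {P. subgroup P (fgroup F) \<and>
         (\<exists>Q \<in> fconjugates F P. fully_normalized F Q \<and>
            fusion_core (fnormalizer F Q) \<in> centrics F)}"

definition fusion_closed :: "'a fusion \<Rightarrow> 'a set set \<Rightarrow> bool" where
  "fusion_closed F \<Gamma> \<longleftrightarrow>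
     \<Gamma> \<noteq> {} \<and> (\<forall>P\<in>\<Gamma>. subgroup P (fgroup F)) \<and>
     (\<forall>P\<in>\<Gamma>. fconjugates F P \<subseteq> \<Gamma>) \<and>
     (\<forall>P\<in>\<Gamma>. \<forall>Q. subgroup Q (fgroup F) \<and> P \<subseteq> Q \<longrightarrow> Q \<in> \<Gamma>)"


section \<open>Proper localities\<close>

definition locality_fusion :: "'a pgroup \<Rightarrow> 'a set \<Rightarrow> 'a fusion" where
  "locality_fusion L S =
     generated_fusion (pg_group L S)
       {(word_stab L S [g], S, restrict (pconj L g) (word_stab L S [g])) | g. g \<in> pcarrier L}"

definition p_core :: "nat \<Rightarrow> 'a monoid \<Rightarrow> 'a set" where
  "p_core p G = (GREATEST P. P \<lhd> G \<and> (\<exists>n. card P = p ^ n))"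

definition proper_locality :: "nat \<Rightarrow> 'a pgroup \<Rightarrow> 'a set set \<Rightarrow> 'a set \<Rightarrow> bool" where
  "proper_locality p L \<Delta> S \<longleftrightarrow>
     locality p L \<Delta> S \<and>
     centrics (locality_fusion L S) \<inter> radicals (locality_fusion L S) \<subseteq> \<Delta> \<and>
     (\<forall>P\<in>\<Delta>. let G = pg_group L (pnormalizer L P)
             in centralizer G (p_core p G) \<subseteq> p_core p G)"

definition normal_extension :: "'a pgroup \<Rightarrow> 'a pgroup \<Rightarrow> 'a set \<Rightarrow> 'a set" where
  "normal_extension L Lp N = (THE M. partial_normal Lp M \<and> N = M \<inter> pcarrier L)"

end

theory Submission
  imports Defs "HOL-Algebra.Sylow" "HOL-Algebra.SndIsomorphismGrp"
begin

text \<open>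
  Write \<open>\<F>\<close> for the common fusion system. The object sets between \<open>\<Delta>\<close> and \<open>\<Delta>\<^sup>+\<close> are climbed one
  \<open>\<F>\<close>-class at a time. Let \<open>\<Gamma>\<close> be such a set, \<open>N\<close> a partial normal subgroup of the restriction to
  \<open>\<Gamma>\<close>, \<open>T = S \<inter> N\<close>, and let \<open>R\<close> be a fully normalized object of largest order outside \<open>\<Gamma>\<close>. It has
  to be shown that \<open>N\<close> extends in exactly one way to the restriction to \<open>\<Gamma> \<union> R\<^sup>\<F>\<close>.

  The group \<open>M = N\<^sub>L(R)\<close>, computed in the large locality, has characteristic \<open>p\<close>. If \<open>O\<^sub>p(M) = R\<close> held, \<open>R\<close>
  would be centric and radical and therefore in \<open>\<Delta>\<close>. So \<open>O\<^sub>p(M)\<close> properly contains \<open>R\<close>, is an element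
  of \<open>\<Gamma>\<close>, and \<open>M\<close> is already contained in the smaller locality (\<open>bigger_core\<close>). For \<open>P\<close> in the class
  of \<open>R\<close> there is an element \<open>a\<^sub>P\<close> of the smaller locality, defined on \<open>N\<^sub>S(P)\<close>, that conjugates \<open>P\<close>
  to \<open>R\<close>. Hence every \<open>g\<close> that conjugates \<open>P\<close> to \<open>Q\<close> is a product \<open>a\<^sub>P m a\<^sub>Q\<^sup>-\<^sup>1\<close> with \<open>m \<in> M\<close> of three
  elements of the smaller locality, and one only has to say when such a product is trivial modulo
  \<open>N\<close>.

  If \<open>T \<le> R\<close>, then elements of \<open>N\<close> normalize every \<open>P\<close> in the class, and the condition is \<open>P = Q\<close> and
  \<open>m \<in> N\<close>. If not, then \<open>PT\<close> is an element of \<open>\<Gamma>\<close> although \<open>P\<close> is not, and every element of the smaller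
  locality that is defined on \<open>P\<close> factors as \<open>n f\<close> with \<open>n \<in> N\<close> and \<open>f\<close> normalizing \<open>T\<close>; then \<open>f\<close> is
  defined on \<open>PT\<close> and is determined modulo \<open>N\<close> (\<open>rep_exists\<close>, \<open>rep_unique\<close>). So the three factors
  can be multiplied modulo \<open>N\<close> over \<open>PT\<close>. The result \<open>transport P g Q\<close> is multiplicative in \<open>g\<close>
  (\<open>transport_mul\<close>) and gives back the class of \<open>g\<close> modulo \<open>N\<close> if \<open>g\<close> belongs to the smaller
  locality (\<open>transport_rep\<close>). In both cases the new elements with trivial image, together with
  \<open>N\<close>, form the extension (\<open>kernel_extension\<close>). It is the only one, because in any extension an
  element and its representative are equal modulo the extension, and the representative lies in the
  smaller locality (\<open>extension_kernel\<close>).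

  Uniqueness makes the extension map inverse to intersection with the smaller locality, and
  inclusions are preserved because the intersection of two extensions extends the intersection.
\<close>

section \<open>Sylow theory of finite groups\<close>

text \<open>An orbit of a \<open>p\<close>-group has \<open>p\<close>-power length, so \<open>p\<close> divides the length of every orbit that is
  not a fixed point.\<close>

lemma (in group_action) p_group_fixed_points:
  assumes p: "Factorial_Ring.prime (p::nat)" and ord: "order G = p ^ n" and fin: "finite E"
  shows "p dvd card (E - {x \<in> E. \<forall>g \<in> carrier G. \<phi> g x = x})"
proof -
  let ?F = "{x \<in> E. \<forall>g \<in> carrier G. \<phi> g x = x}"
  let ?C = "{orbit G \<phi> x | x. x \<in> E - ?F}"
  have sub: "orbit G \<phi> x \<subseteq> E" if "x \<in> E" for x
    using that element_image by (auto simp: orbit_def)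
  have notF: "orbit G \<phi> x \<inter> ?F = {}" if "x \<in> E - ?F" for x
  proof (rule ccontr)
    assume "orbit G \<phi> x \<inter> ?F \<noteq> {}"
    then obtain y where y: "y \<in> orbit G \<phi> x" "y \<in> ?F" by blast
    then have "x \<in> orbit G \<phi> y" using orbit_sym that by blast
    then have "x = y" using y by (auto simp: orbit_def)
    then show False using y that by blast
  qed
  have un: "\<Union>?C = E - ?F"
  proof
    show "\<Union>?C \<subseteq> E - ?F" using sub notF by blast
    show "E - ?F \<subseteq> \<Union>?C" using orbit_refl by blast
  qed
  have "p dvd card (\<Union>?C)"
  proof (rule dvd_partition)
    show "finite (\<Union>?C)" unfolding un using fin by simp
    show "\<forall>c\<in>?C. p dvd card c"
    proof
      fix c assume "c \<in> ?C"
      then obtain x where x: "x \<in> E - ?F" and c: "c = orbit G \<phi> x" by blast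
      have "card c * card (stabilizer G \<phi> x) = p ^ n"
        using orbit_stabilizer_theorem[of x] x ord c by (simp add: mult.commute)
      then have "card c dvd p ^ n" by (metis dvd_triv_left)
      then obtain k where k: "card c = p ^ k" using divides_primepow_nat p by blast
      have "card c \<noteq> 1"
      proof
        assume "card c = 1"
        then obtain z where z: "c = {z}" using card_1_singletonE by blast
        have "x \<in> c" using orbit_refl x c by simp
        then have "orbit G \<phi> x = {x}" using z c by auto
        then have "\<forall>g \<in> carrier G. \<phi> g x = x" by (auto simp: orbit_def)
        then show False using x by blast
      qed
      then have "k \<noteq> 0" using k by auto
      then show "p dvd card c" unfolding k by (meson dvd_power not_gr_zero)
    qed
    show "\<forall>c1\<in>?C. \<forall>c2\<in>?C. c1 \<noteq> c2 \<longrightarrow> c1 \<inter> c2 = {}"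
      using disjoint_union unfolding orbits_def by blast
  qed
  then show ?thesis unfolding un .
qed

context group
begin

text \<open>The inverse turns right multiplication into an action from the left.\<close>

lemma right_coset_action:
  assumes H: "subgroup H G" and Q: "subgroup Q G"
  shows "group_action (G\<lparr>carrier := H\<rparr>) (rcosets Q) (\<lambda>h. \<lambda>C \<in> rcosets Q. C #> inv h)"
proof -
  let ?E = "rcosets Q" and ?H = "G\<lparr>carrier := H\<rparr>"
  let ?f = "\<lambda>h. \<lambda>C \<in> ?E. C #> inv h"
  have HG: "h \<in> carrier G" if "h \<in> H" for h using subgroup.mem_carrier[OF H that] .
  have Esub: "C \<subseteq> carrier G" if "C \<in> ?E" for C
    using subgroup.rcosets_carrier[OF Q is_group that] .
  have cl: "C #> g \<in> ?E" if C: "C \<in> ?E" and g: "g \<in> carrier G" for C g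
  proof -
    obtain x where "x \<in> carrier G" "C = Q #> x" using C by (auto simp: RCOSETS_def)
    then have "C #> g = Q #> (x \<otimes> g)" using coset_mult_assoc[of Q x g] subgroup.subset[OF Q] g by simp
    then show ?thesis using \<open>x \<in> carrier G\<close> g by (auto simp: RCOSETS_def)
  qed
  have canc: "C #> g #> inv g = C" "C #> inv g #> g = C" if "C \<in> ?E" "g \<in> carrier G" for C g
    using coset_mult_assoc[OF Esub[OF that(1)]] that coset_mult_one[OF Esub[OF that(1)]] by auto
  have bij: "?f h \<in> Bij ?E" if "h \<in> H" for h
  proof -
    have "bij_betw (?f h) ?E ?E"
      by (rule bij_betw_byWitness[where f' = "\<lambda>C. C #> h"]) (use canc cl HG[OF that] in auto)
    then show ?thesis by (simp add: Bij_def)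
  qed
  have hom: "?f \<in> hom ?H (BijGroup ?E)"
  proof (rule homI)
    fix x assume "x \<in> carrier ?H" then show "?f x \<in> carrier (BijGroup ?E)"
      using bij by (simp add: BijGroup_def)
  next
    fix x y assume "x \<in> carrier ?H" "y \<in> carrier ?H"
    then have x: "x \<in> H" and y: "y \<in> H" by auto
    have "?f (x \<otimes> y) = compose ?E (?f x) (?f y)"
    proof
      fix C show "?f (x \<otimes> y) C = compose ?E (?f x) (?f y) C"
        using coset_mult_assoc[OF Esub, of C "inv y" "inv x"] HG[OF x] HG[OF y] cl[of C "inv y"]
        by (auto simp: compose_def inv_mult_group)
    qed
    then show "?f (x \<otimes>\<^bsub>?H\<^esub> y) = ?f x \<otimes>\<^bsub>BijGroup ?E\<^esub> ?f y"
      using bij[OF x] bij[OF y] by (simp add: BijGroup_def)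
  qed
  have "group_hom ?H (BijGroup ?E) ?f"
    using hom subgroup_imp_group[OF H] group_BijGroup by (simp add: group_hom_def group_hom_axioms_def)
  then show ?thesis by (simp add: group_action_def)
qed

text \<open>Fixed cosets are conjugates of \<open>H\<close> inside \<open>Q\<close>; this makes counting fixed points useful.\<close>

lemma coset_fixed_imp:
  assumes H: "subgroup H G" and Q: "subgroup Q G" and x: "x \<in> carrier G"
    and fx: "\<forall>h\<in>H. (Q #> x) #> inv h = Q #> x"
  shows "\<forall>h\<in>H. x \<otimes> h \<otimes> inv x \<in> Q"
proof
  fix h assume h: "h \<in> H"
  have hG: "h \<in> carrier G" using subgroup.mem_carrier[OF H h] .
  have "inv h \<in> H" using subgroup.m_inv_closed[OF H h] .
  then have "(Q #> x) #> h = Q #> x" using fx hG by (metis inv_inv)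
  then have "Q #> (x \<otimes> h) = Q #> x"
    using coset_mult_assoc[OF subgroup.subset[OF Q] x hG] by simp
  then have "x \<otimes> h \<in> Q #> x" using rcos_self[OF _ Q, of "x \<otimes> h"] x hG by simp
  then obtain q where "q \<in> Q" "x \<otimes> h = q \<otimes> x" by (auto simp: r_coset_def)
  then show "x \<otimes> h \<otimes> inv x \<in> Q"
    using subgroup.mem_carrier[OF Q] x by (simp add: inv_solve_right' m_assoc)
qed

text \<open>Since \<open>p\<close> does not divide the number of cosets of \<open>Q\<close>, the \<open>p\<close>-group \<open>H\<close> fixes one of them.\<close>

lemma sylow_conjugate:
  assumes p: "Factorial_Ring.prime (p::nat)" and fin: "finite (carrier G)"
    and H: "subgroup H G" "card H = p ^ n" and Q: "subgroup Q G"
    and idx: "\<not> p dvd card (rcosets Q)"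
  shows "\<exists>x \<in> carrier G. \<forall>h\<in>H. inv x \<otimes> h \<otimes> x \<in> Q"
proof -
  let ?f = "\<lambda>h. \<lambda>C \<in> rcosets Q. C #> inv h"
  let ?E = "rcosets Q"
  let ?F = "{C \<in> ?E. \<forall>h\<in>carrier (G\<lparr>carrier := H\<rparr>). ?f h C = C}"
  have fE: "finite ?E" using fin rcosets_finite[OF _ subgroup.subset[OF Q]] 
    by (metis Q finite_UnionD rcosets_part_G)
  interpret A: group_action "G\<lparr>carrier := H\<rparr>" ?E ?f by (rule right_coset_action[OF H(1) Q])
  have "p dvd card (?E - ?F)"
    by (rule A.p_group_fixed_points[OF p, of n]) (use H fE in \<open>simp_all add: order_def\<close>)
  then have "?F \<noteq> {}" using idx by (metis Diff_empty)
  then obtain C where C: "C \<in> ?E" "\<forall>h\<in>H. C #> inv h = C" by auto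
  then obtain x where x: "x \<in> carrier G" "C = Q #> x" by (auto simp: RCOSETS_def)
  have "\<forall>h\<in>H. x \<otimes> h \<otimes> inv x \<in> Q" using coset_fixed_imp[OF H(1) Q x(1)] C x by simp
  then show ?thesis using x(1) by (intro bexI[of _ "inv x"]) auto
qed

text \<open>The group \<open>Q\<close> fixes itself as a coset. As \<open>p\<close> divides the number of cosets, \<open>p\<close> divides the number
  of fixed ones, and there is a second one.\<close>

lemma normalizer_grows_if_index_dvd:
  assumes p: "Factorial_Ring.prime (p::nat)" and fin: "finite (carrier G)"
    and Q: "subgroup Q G" "card Q = p ^ n" and idx: "p dvd card (rcosets Q)"
  shows "\<exists>x \<in> carrier G - Q. \<forall>h\<in>Q. inv x \<otimes> h \<otimes> x \<in> Q"
proof -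
  let ?f = "\<lambda>h. \<lambda>C \<in> rcosets Q. C #> inv h"
  let ?E = "rcosets Q"
  let ?F = "{C \<in> ?E. \<forall>h\<in>carrier (G\<lparr>carrier := Q\<rparr>). ?f h C = C}"
  have fE: "finite ?E" using fin by (metis Q(1) finite_UnionD rcosets_part_G)
  interpret A: group_action "G\<lparr>carrier := Q\<rparr>" ?E ?f by (rule right_coset_action[OF Q(1) Q(1)])
  have "p dvd card (?E - ?F)"
    by (rule A.p_group_fixed_points[OF p, of n]) (use Q fE in \<open>simp_all add: order_def\<close>)
  moreover have "card (?E - ?F) = card ?E - card ?F" using fE by (intro card_Diff_subset) auto
  moreover have "card ?F \<le> card ?E" using fE by (intro card_mono) auto
  ultimately have dv: "p dvd card ?F" using idx dvd_diffD1[of p "card ?E" "card ?F"] by simp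
  have QE: "Q \<in> ?E" using subgroup.subgroup_in_rcosets[OF Q(1) is_group] .
  have "Q \<in> ?F" using QE subgroup.rcos_const[OF Q(1) is_group] subgroup.m_inv_closed[OF Q(1)] by auto
  \<comment> \<open>the coset \<open>Q\<close> is fixed, but \<open>p\<close> divides the number of fixed cosets\<close>
  have "?F \<noteq> {Q}" 
  proof
    assume "?F = {Q}"
    then have "card ?F = 1" by simp
    then show False using dv p by (simp add: prime_nat_iff)
  qed
  then obtain C where "C \<in> ?F" "C \<noteq> Q" using \<open>Q \<in> ?F\<close> by blast
  then have C: "C \<in> ?E" "\<forall>h\<in>Q. C #> inv h = C" "C \<noteq> Q" by auto
  then obtain x where x: "x \<in> carrier G" "C = Q #> x" by (auto simp: RCOSETS_def)
  have "\<forall>h\<in>Q. x \<otimes> h \<otimes> inv x \<in> Q" using coset_fixed_imp[OF Q(1) Q(1) x(1)] C x by simp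
  moreover have "inv x \<notin> Q" using C(3) x subgroup.rcos_const[OF Q(1) is_group] 
    by (metis Q(1) inv_inv subgroup.m_inv_closed)
  ultimately show ?thesis using x(1) by (intro bexI[of _ "inv x"]) auto
qed

end

definition p_sylow :: "nat \<Rightarrow> ('a, 'b) monoid_scheme \<Rightarrow> 'a set \<Rightarrow> bool" where
  "p_sylow p G Q \<longleftrightarrow> subgroup Q G \<and> (\<exists>n. card Q = p ^ n) \<and> \<not> p dvd card (rcosets\<^bsub>G\<^esub> Q)"

context group
begin

lemma card_conj:
  assumes "finite A" "A \<subseteq> carrier G" "x \<in> carrier G"
  shows "card ((\<lambda>h. inv x \<otimes> h \<otimes> x) ` A) = card A"
proof (rule card_image, rule inj_onI)
  fix a b assume ab: "a \<in> A" "b \<in> A" "inv x \<otimes> a \<otimes> x = inv x \<otimes> b \<otimes> x"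
  then have "a \<in> carrier G" "b \<in> carrier G" using assms by auto
  with ab(3) assms(3) show "a = b" by (simp add: m_assoc)
qed

lemma conj_mult:
  assumes "a \<in> carrier G" "b \<in> carrier G" "x \<in> carrier G"
  shows "inv x \<otimes> (a \<otimes> b) \<otimes> x = (inv x \<otimes> a \<otimes> x) \<otimes> (inv x \<otimes> b \<otimes> x)"
proof -
  have "(inv x \<otimes> a \<otimes> x) \<otimes> (inv x \<otimes> b \<otimes> x) = inv x \<otimes> a \<otimes> (x \<otimes> inv x) \<otimes> (b \<otimes> x)"
    using assms by (simp only: m_assoc m_closed inv_closed)
  also have "\<dots> = inv x \<otimes> (a \<otimes> b) \<otimes> x" using assms by (simp add: m_assoc)
  finally show ?thesis by simp
qed

lemma conj_subgroup:
  assumes H: "subgroup H G" and x: "x \<in> carrier G"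
  shows "subgroup ((\<lambda>h. inv x \<otimes> h \<otimes> x) ` H) G"
proof (rule subgroupI)
  have HG: "h \<in> carrier G" if "h \<in> H" for h using subgroup.mem_carrier[OF H that] .
  show "(\<lambda>h. inv x \<otimes> h \<otimes> x) ` H \<subseteq> carrier G" using HG x by auto
  show "(\<lambda>h. inv x \<otimes> h \<otimes> x) ` H \<noteq> {}" using subgroup.one_closed[OF H] by auto
  show "inv a \<in> (\<lambda>h. inv x \<otimes> h \<otimes> x) ` H" if "a \<in> (\<lambda>h. inv x \<otimes> h \<otimes> x) ` H" for a
  proof -
    obtain h where h: "h \<in> H" "a = inv x \<otimes> h \<otimes> x" using \<open>a \<in> _\<close> by blast
    have "inv a = inv x \<otimes> inv h \<otimes> x" using h HG x by (simp add: inv_mult_group m_assoc)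
    then show ?thesis using subgroup.m_inv_closed[OF H h(1)] by blast
  qed
  show "a \<otimes> b \<in> (\<lambda>h. inv x \<otimes> h \<otimes> x) ` H"
    if ab: "a \<in> (\<lambda>h. inv x \<otimes> h \<otimes> x) ` H" "b \<in> (\<lambda>h. inv x \<otimes> h \<otimes> x) ` H" for a b
  proof -
    obtain h k where h: "h \<in> H" "a = inv x \<otimes> h \<otimes> x" and k: "k \<in> H" "b = inv x \<otimes> k \<otimes> x"
      using ab by blast
    have "a \<otimes> b = inv x \<otimes> (h \<otimes> k) \<otimes> x" using conj_mult[OF HG[OF h(1)] HG[OF k(1)] x] h k by simp
    then show ?thesis using subgroup.m_closed[OF H h(1) k(1)] by blast
  qed
qed

lemma card_rcosets_eq:
  assumes "finite (carrier G)" "subgroup Q G"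
  shows "card (rcosets Q) * card Q = order G"
  using lagrange_finite assms by blast

lemma p_sylow_ex:
  assumes p: "Factorial_Ring.prime (p::nat)" and fin: "finite (carrier G)"
  shows "\<exists>Q. p_sylow p G Q"
proof -
  have "order G > 0" using fin by (simp add: order_gt_0_iff_finite)
  then have nz: "order G \<noteq> 0" by simp
  define a where "a = multiplicity p (order G)"
  have "\<not> is_unit p" using p by (simp add: prime_nat_iff)
  obtain m where m: "order G = p ^ a * m" "\<not> p dvd m"
    using multiplicity_decompose'[OF nz \<open>\<not> is_unit p\<close>] a_def by metis
  obtain Q where Q: "subgroup Q G" "card Q = p ^ a"
    using sylow_thm[OF p is_group m(1) fin] by blast
  have "card (rcosets Q) = m" using card_rcosets_eq[OF fin Q(1)] Q m p by (simp add: prime_gt_0_nat)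
  then show ?thesis using Q m by (auto simp: p_sylow_def)
qed

lemma sylow_contains:
  assumes p: "Factorial_Ring.prime (p::nat)" and fin: "finite (carrier G)"
    and H: "subgroup H G" "card H = p ^ n" and Q: "p_sylow p G Q"
  shows "\<exists>x \<in> carrier G. \<forall>h\<in>H. inv x \<otimes> h \<otimes> x \<in> Q"
  using sylow_conjugate[OF p fin H] Q by (auto simp: p_sylow_def)

lemma card_sub_prime_power:
  assumes p: "Factorial_Ring.prime (p::nat)" and fin: "finite (carrier G)"
    and H: "subgroup H G" "H \<subseteq> Q" and Q: "subgroup Q G" "card Q = p ^ n"
  shows "\<exists>k. card H = p ^ k"
proof -
  interpret Q: group "G\<lparr>carrier := Q\<rparr>" by (rule subgroup_imp_group[OF Q(1)])
  have "subgroup H (G\<lparr>carrier := Q\<rparr>)" using subgroup_incl H Q by blast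
  then have "card (rcosets\<^bsub>G\<lparr>carrier := Q\<rparr>\<^esub> H) * card H = p ^ n"
    using Q.card_rcosets_eq[of H] fin Q finite_subset[OF subgroup.subset[OF Q(1)] fin]
    by (simp add: order_def)
  then have "card H dvd p ^ n" by (metis dvd_triv_right)
  then show ?thesis using divides_primepow_nat p by blast
qed

lemma normalizer_grows:
  assumes p: "Factorial_Ring.prime (p::nat)" and fin: "finite (carrier G)"
    and X: "subgroup X G" "card X = p ^ n" and Q: "subgroup Q G" "Q \<subset> X"
  shows "\<exists>x \<in> X - Q. \<forall>h\<in>Q. inv x \<otimes> h \<otimes> x \<in> Q"
proof -
  let ?X = "G\<lparr>carrier := X\<rparr>"
  interpret X: group ?X by (rule subgroup_imp_group[OF X(1)])
  have QX: "subgroup Q ?X" using subgroup_incl Q X by blast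
  have fX: "finite X" using finite_subset[OF subgroup.subset[OF X(1)] fin] .
  obtain k where k: "card Q = p ^ k" using card_sub_prime_power[OF p fin Q(1) _ X] Q(2) by blast
  have eq: "card (rcosets\<^bsub>?X\<^esub> Q) * p ^ k = p ^ n"
    using X.card_rcosets_eq[OF _ QX] fX k X(2) by (simp add: order_def)
  have "p ^ k < p ^ n" using psubset_card_mono[OF fX Q(2)] k X(2) by simp
  then have "k < n" using p prime_gt_1_nat by (metis power_less_imp_less_exp)
  then have "card (rcosets\<^bsub>?X\<^esub> Q) * p ^ k = p ^ (n - k) * p ^ k" using eq by (simp add: power_add[symmetric])
  then have "card (rcosets\<^bsub>?X\<^esub> Q) = p ^ (n - k)" using p by (simp add: prime_gt_0_nat)
  then have "p dvd card (rcosets\<^bsub>?X\<^esub> Q)" using \<open>k < n\<close> by simp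
  then obtain x where x: "x \<in> carrier ?X - Q" "\<forall>h\<in>Q. inv\<^bsub>?X\<^esub> x \<otimes>\<^bsub>?X\<^esub> h \<otimes>\<^bsub>?X\<^esub> x \<in> Q"
    using X.normalizer_grows_if_index_dvd[OF p _ QX k] fX by auto
  then show ?thesis using m_inv_consistent[OF X(1)] by (intro bexI[of _ x]) auto
qed

lemma normalizing_subgroup:
  assumes fin: "finite (carrier G)" and X: "subgroup X G" and Q: "subgroup Q G" "Q \<subseteq> X"
  shows "subgroup {x \<in> X. \<forall>h\<in>Q. inv x \<otimes> h \<otimes> x \<in> Q} G"
proof (rule subgroupI)
  have XG: "h \<in> carrier G" if "h \<in> X" for h using subgroup.mem_carrier[OF X that] .
  let ?N = "{x \<in> X. \<forall>h\<in>Q. inv x \<otimes> h \<otimes> x \<in> Q}"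
  show "?N \<subseteq> carrier G" using XG by auto
  have "\<one> \<in> ?N" using subgroup.one_closed[OF X] subgroup.mem_carrier[OF Q(1)] by auto
  then show "?N \<noteq> {}" by blast
  show "inv a \<in> ?N" if a: "a \<in> ?N" for a
  proof -
    have fQ: "finite Q" using finite_subset[OF subgroup.subset[OF Q(1)] fin] .
    have aG: "a \<in> carrier G" using a XG by simp
    have "(\<lambda>h. inv a \<otimes> h \<otimes> a) ` Q = Q"
      using a card_conj[OF fQ subgroup.subset[OF Q(1)] aG] by (intro card_subset_eq fQ) auto
    then have "\<forall>h\<in>Q. \<exists>k\<in>Q. h = inv a \<otimes> k \<otimes> a" by blast
    then have "\<forall>h\<in>Q. a \<otimes> h \<otimes> inv a \<in> Q"
    proof (intro ballI)
      fix h assume "h \<in> Q"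
      then obtain k where k: "k \<in> Q" "h = inv a \<otimes> k \<otimes> a" using \<open>\<forall>h\<in>Q. \<exists>k\<in>Q. _\<close> by blast
      have "k \<in> carrier G" using k(1) subgroup.mem_carrier[OF Q(1)] by blast
      have "a \<otimes> h \<otimes> inv a = (a \<otimes> inv a) \<otimes> k \<otimes> (a \<otimes> inv a)"
        unfolding k(2) using aG \<open>k \<in> carrier G\<close> by (simp only: m_assoc m_closed inv_closed)
      then show "a \<otimes> h \<otimes> inv a \<in> Q" using aG \<open>k \<in> carrier G\<close> k(1) by simp
    qed
    then show ?thesis using a aG subgroup.m_inv_closed[OF X] by simp
  qed
  show "a \<otimes> b \<in> ?N" if a: "a \<in> ?N" and b: "b \<in> ?N" for a b
  proof -
    have aG: "a \<in> carrier G" "b \<in> carrier G" using a b XG by simp_all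
    have "inv (a \<otimes> b) \<otimes> h \<otimes> (a \<otimes> b) = inv b \<otimes> (inv a \<otimes> h \<otimes> a) \<otimes> b" if "h \<in> Q" for h
      using aG subgroup.mem_carrier[OF Q(1) that] by (simp add: inv_mult_group m_assoc)
    then show ?thesis using a b subgroup.m_closed[OF X] by simp
  qed
qed

text \<open>A conjugate of a Sylow subgroup contains \<open>Q\<close> properly, and normalizers grow in \<open>p\<close>-groups.\<close>

lemma nonsylow_extends:
  assumes p: "Factorial_Ring.prime (p::nat)" and fin: "finite (carrier G)"
    and Q: "subgroup Q G" "card Q = p ^ n" and ns: "\<not> p_sylow p G Q"
  shows "\<exists>R k. subgroup R G \<and> card R = p ^ k \<and> Q \<subset> R \<and> (\<forall>r\<in>R. \<forall>h\<in>Q. inv r \<otimes> h \<otimes> r \<in> Q)"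
proof -
  obtain P where P: "p_sylow p G P" using p_sylow_ex[OF p fin] by blast
  then obtain m where P1: "subgroup P G" "card P = p ^ m" "\<not> p dvd card (rcosets P)"
    by (auto simp: p_sylow_def)
  have QG: "Q \<subseteq> carrier G" using subgroup.subset[OF Q(1)] .
  have fP: "finite P" using finite_subset[OF subgroup.subset[OF P1(1)] fin] .
  obtain x where x: "x \<in> carrier G" "\<forall>h\<in>Q. inv x \<otimes> h \<otimes> x \<in> P"
    using sylow_contains[OF p fin Q P] by blast
  define Y where "Y = (\<lambda>h. inv (inv x) \<otimes> h \<otimes> inv x) ` P"
  have Ys: "subgroup Y G" unfolding Y_def by (rule conj_subgroup[OF P1(1)]) (use x in simp)
  have Yc: "card Y = p ^ m" unfolding Y_def
    using card_conj[OF fP subgroup.subset[OF P1(1)], of "inv x"] x P1(2) by simp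
  have "Q \<subseteq> Y"
  proof
    fix h assume h: "h \<in> Q"
    have "h = inv (inv x) \<otimes> (inv x \<otimes> h \<otimes> x) \<otimes> inv x"
    proof -
      have "inv (inv x) \<otimes> (inv x \<otimes> h \<otimes> x) \<otimes> inv x = (x \<otimes> inv x) \<otimes> h \<otimes> (x \<otimes> inv x)"
        using x(1) h QG by (simp add: m_assoc subset_iff del: r_inv Units_r_inv)
      then show ?thesis using x(1) h QG by auto
    qed
    then show "h \<in> Y" unfolding Y_def using x(2) h by blast
  qed
  moreover have "Q \<noteq> Y"
  proof
    assume "Q = Y"
    then have "card Q = card P" using Yc P1(2) by simp
    moreover have "card (rcosets Q) * card Q = card (rcosets P) * card P"
      using card_rcosets_eq[OF fin] Q(1) P1(1) by simp
    ultimately have "card (rcosets Q) = card (rcosets P)" using P1(2) p by (simp add: prime_gt_0_nat)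
    then show False using ns Q P1(3) by (auto simp: p_sylow_def)
  qed
  ultimately have QY: "Q \<subset> Y" by blast
  obtain y where y: "y \<in> Y - Q" "\<forall>h\<in>Q. inv y \<otimes> h \<otimes> y \<in> Q"
    using normalizer_grows[OF p fin Ys Yc Q(1) QY] by blast
  let ?R = "{x \<in> Y. \<forall>h\<in>Q. inv x \<otimes> h \<otimes> x \<in> Q}"
  have Rs: "subgroup ?R G" using normalizing_subgroup[OF fin Ys Q(1)] QY by blast
  obtain k where "card ?R = p ^ k" using card_sub_prime_power[OF p fin Rs _ Ys Yc] by blast
  moreover have "Q \<subset> ?R"
  proof -
    have "Q \<subseteq> ?R" using QY subgroup.m_closed[OF Q(1)] subgroup.m_inv_closed[OF Q(1)] by auto
    then show ?thesis using y by blast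
  qed
  ultimately show ?thesis using Rs by blast
qed

text \<open>A \<open>p\<close>-subgroup of \<open>K\<close> larger than \<open>P \<inter> K\<close> would be conjugate into \<open>P\<close>, and hence into \<open>P \<inter> K\<close>.\<close>

lemma sylow_inter_normal:
  assumes p: "Factorial_Ring.prime (p::nat)" and fin: "finite (carrier G)"
    and P: "p_sylow p G P" and K: "K \<lhd> G"
  shows "p_sylow p (G\<lparr>carrier := K\<rparr>) (P \<inter> K)"
proof (rule ccontr)
  let ?K = "G\<lparr>carrier := K\<rparr>"
  assume ns: "\<not> p_sylow p ?K (P \<inter> K)"
  have Ks: "subgroup K G" by (rule normal_imp_subgroup[OF K(1)])
  interpret K: group ?K by (rule subgroup_imp_group[OF Ks])
  obtain m where P1: "subgroup P G" "card P = p ^ m" using P by (auto simp: p_sylow_def)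
  have fP: "finite P" using finite_subset[OF subgroup.subset[OF P1(1)] fin] .
  have fK: "finite K" using finite_subset[OF subgroup.subset[OF Ks] fin] .
  have Is: "subgroup (P \<inter> K) G" using subgroups_Inter_pair[OF P1(1) Ks] .
  have I1: "subgroup (P \<inter> K) ?K" by (rule subgroup_incl[OF Is Ks]) simp
  obtain j where j: "card (P \<inter> K) = p ^ j" using card_sub_prime_power[OF p fin Is _ P1] by blast
  obtain R k where R: "subgroup R ?K" "card R = p ^ k" "P \<inter> K \<subset> R"
    using K.nonsylow_extends[OF p _ I1 j ns] fK by auto
  have RK: "R \<subseteq> K" using subgroup.subset[OF R(1)] by simp
  have RG: "subgroup R G" using incl_subgroup[OF Ks R(1)] .
  obtain x where x: "x \<in> carrier G" "\<forall>h\<in>R. inv x \<otimes> h \<otimes> x \<in> P"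
    using sylow_contains[OF p fin RG R(2) P] by blast
  have "(\<lambda>h. inv x \<otimes> h \<otimes> x) ` R \<subseteq> P \<inter> K"
    using x normal.inv_op_closed1[OF K(1) x(1)] RK by auto
  then have "card ((\<lambda>h. inv x \<otimes> h \<otimes> x) ` R) \<le> card (P \<inter> K)" using fP by (intro card_mono) auto
  then have "card R \<le> card (P \<inter> K)"
    using card_conj[OF finite_subset[OF RK fK] subgroup.subset[OF RG] x(1)] by simp
  with psubset_card_mono[OF finite_subset[OF RK fK] R(3)] show False by linarith
qed

text \<open>Both \<open>T = P \<inter> K\<close> and \<open>g T g\<^sup>-\<^sup>1\<close> are Sylow subgroups of \<open>K\<close>. If \<open>k \<in> K\<close> conjugates the second to the
  first, then \<open>f = k\<^sup>-\<^sup>1 g\<close> normalizes \<open>T\<close>.\<close>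

lemma frattini_argument:
  assumes p: "Factorial_Ring.prime (p::nat)" and fin: "finite (carrier G)"
    and P: "p_sylow p G P" and K: "K \<lhd> G" and g: "g \<in> carrier G"
  shows "\<exists>k\<in>K. \<exists>f\<in>carrier G. g = k \<otimes> f \<and> (\<forall>t \<in> P \<inter> K. inv f \<otimes> t \<otimes> f \<in> P \<inter> K)"
proof -
  let ?K = "G\<lparr>carrier := K\<rparr>" and ?T = "P \<inter> K"
  have Ks: "subgroup K G" by (rule normal_imp_subgroup[OF K(1)])
  have KG: "K \<subseteq> carrier G" using subgroup.subset[OF Ks] .
  interpret K: group ?K by (rule subgroup_imp_group[OF Ks])
  have T: "p_sylow p ?K ?T" by (rule sylow_inter_normal[OF p fin P K])
  obtain n where Tc: "card ?T = p ^ n" using T by (auto simp: p_sylow_def)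
  have "subgroup P G" using P by (simp add: p_sylow_def)
  then have TG: "subgroup ?T G" using subgroups_Inter_pair Ks by blast
  have fK: "finite K" using finite_subset[OF KG fin] .
  have fT: "finite ?T" using fK by simp
  let ?H = "(\<lambda>h. inv (inv g) \<otimes> h \<otimes> inv g) ` ?T"
  have HG: "subgroup ?H G" by (rule conj_subgroup[OF TG]) (use g in simp)
  have HK: "?H \<subseteq> K" using normal.inv_op_closed2[OF K g] g by auto
  have Hs: "subgroup ?H ?K" by (rule subgroup_incl[OF HG Ks HK])
  have Hc: "card ?H = p ^ n" using card_conj[OF fT, of "inv g"] subgroup.subset[OF TG] g Tc by simp
  obtain k where k: "k \<in> K" "\<forall>h\<in>?H. inv\<^bsub>?K\<^esub> k \<otimes> h \<otimes> k \<in> ?T"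
    using K.sylow_contains[OF p _ Hs Hc T] fK by auto
  have kG: "k \<in> carrier G" using k(1) KG by blast
  define f where "f = inv k \<otimes> g"
  have fG: "f \<in> carrier G" using kG g by (simp add: f_def)
  have ifG: "inv f = inv g \<otimes> k" using kG g by (simp add: f_def inv_mult_group)
  have g_eq: "g = k \<otimes> f" using kG g by (simp add: f_def m_assoc[symmetric])
  have 1: "inv (inv f) \<otimes> t \<otimes> inv f \<in> ?T" if "t \<in> ?T" for t
  proof -
    have tG: "t \<in> carrier G" using that KG by blast
    have "inv k \<otimes> (inv (inv g) \<otimes> t \<otimes> inv g) \<otimes> k \<in> ?T"
      using k that m_inv_consistent[OF Ks k(1)] by auto
    moreover have "inv k \<otimes> (inv (inv g) \<otimes> t \<otimes> inv g) \<otimes> k = f \<otimes> t \<otimes> inv f"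
      unfolding ifG using tG kG g by (simp add: f_def m_assoc)
    ultimately show ?thesis using fG by simp
  qed
  have "inv f \<in> {x \<in> carrier G. \<forall>h\<in>?T. inv x \<otimes> h \<otimes> x \<in> ?T}" using 1 fG by simp
  then have "inv (inv f) \<in> {x \<in> carrier G. \<forall>h\<in>?T. inv x \<otimes> h \<otimes> x \<in> ?T}"
    using subgroup.m_inv_closed[OF normalizing_subgroup[OF fin subgroup_self TG]]
      subgroup.subset[OF TG] by blast
  then have "\<forall>t\<in>?T. inv f \<otimes> t \<otimes> f \<in> ?T" using fG by simp
  then show ?thesis using k(1) fG g_eq by blast
qed

lemma normal_p_subgroup_in_sylow:
  assumes p: "Factorial_Ring.prime (p::nat)" and fin: "finite (carrier G)"
    and P: "p_sylow p G P" and K: "K \<lhd> G" "card K = p ^ n"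
  shows "K \<subseteq> P"
proof
  fix k assume k: "k \<in> K"
  have Ks: "subgroup K G" by (rule normal_imp_subgroup[OF K(1)])
  have KG: "K \<subseteq> carrier G" using subgroup.subset[OF Ks] .
  obtain x where x: "x \<in> carrier G" "\<forall>h\<in>K. inv x \<otimes> h \<otimes> x \<in> P"
    using sylow_contains[OF p fin Ks K(2) P] by blast
  have "x \<otimes> k \<otimes> inv x \<in> K" using normal.inv_op_closed2[OF K(1) x(1) k] .
  then have "inv x \<otimes> (x \<otimes> k \<otimes> inv x) \<otimes> x \<in> P" using x by blast
  moreover have "inv x \<otimes> (x \<otimes> k \<otimes> inv x) \<otimes> x = (inv x \<otimes> x) \<otimes> k \<otimes> (inv x \<otimes> x)"
    using x(1) k KG by (simp add: m_assoc subset_iff del: l_inv Units_l_inv)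
  ultimately show "k \<in> P" using x(1) k KG by auto
qed

end

text \<open>Normal \<open>p\<close>-subgroups lie in every Sylow subgroup, and so does the product of two of them. Hence
  a normal \<open>p\<close>-subgroup of largest order contains all others.\<close>

lemma p_core_greatest:
  fixes G :: "'a monoid" (structure)
  assumes "Group.group G" and p: "Factorial_Ring.prime (p::nat)" and fin: "finite (carrier G)"
  shows "p_core p G \<lhd> G \<and> (\<exists>n. card (p_core p G) = p ^ n) \<and>
    (\<forall>K. K \<lhd> G \<and> (\<exists>n. card K = p ^ n) \<longrightarrow> K \<subseteq> p_core p G)"
proof -
  interpret Group.group G by fact
  let ?N = "\<lambda>K. K \<lhd> G \<and> (\<exists>n. card K = p ^ n)"
  have 1: "?N {\<one>}" using one_is_normal by (auto intro: exI[of _ 0])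
  have fin': "K \<subseteq> carrier G" if "?N K" for K using that normal_imp_subgroup[of K] subgroup.subset by auto
  have bd: "card K < Suc (card (carrier G))" if "?N K" for K
    using card_mono[OF fin fin'[OF that]] by simp
  obtain A where A: "?N A" "\<And>K. ?N K \<Longrightarrow> card K \<le> card A"
    using ex_has_greatest_nat[of ?N "{\<one>}" card "Suc (card (carrier G))"] 1 bd by blast
  have fA: "finite A" using finite_subset[OF fin'[OF A(1)] fin] .
  obtain P where P: "p_sylow p G P" using p_sylow_ex[OF p fin] by blast
  then obtain m where P1: "subgroup P G" "card P = p ^ m" by (auto simp: p_sylow_def)
  have max: "K \<subseteq> A" if K: "?N K" for K
  proof -
    have AK: "A <#> K \<lhd> G" using A(1) K
      by (metis normal_subgroup_set_mult_closed)
    have AP: "A \<subseteq> P" "K \<subseteq> P" using normal_p_subgroup_in_sylow[OF p fin P] A(1) K by auto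
    have "A <#> K \<subseteq> P" using AP subgroup.m_closed[OF P1(1)] by (auto simp: set_mult_def)
    then have "?N (A <#> K)" using AK card_sub_prime_power[OF p fin normal_imp_subgroup[OF AK] _ P1] by simp
    then have "card (A <#> K) \<le> card A" "finite (A <#> K)" using A(2) finite_subset[OF fin' fin] by blast+
    moreover have sub: "A \<subseteq> A <#> K" "K \<subseteq> A <#> K"
    proof -
      have "\<one> \<in> A" "\<one> \<in> K" using A(1) K normal_imp_subgroup subgroup.one_closed by auto
      then show "A \<subseteq> A <#> K" "K \<subseteq> A <#> K" using fin'[OF A(1)] fin'[OF K]
        by (auto simp: set_mult_def subset_iff) (metis r_one, metis l_one)
    qed
    ultimately have "A = A <#> K" by (metis card_seteq)
    then show ?thesis using sub by blast
  qed
  have "p_core p G = A" unfolding p_core_def by (rule Greatest_equality) (use A(1) max in auto)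
  then show ?thesis using A(1) max by auto
qed

section \<open>Partial groups\<close>

context partial_group
begin

abbreviation pone :: 'a where "pone \<equiv> pprod L []"
abbreviation pmul :: "'a \<Rightarrow> 'a \<Rightarrow> 'a" where "pmul g h \<equiv> pprod L [g, h]"

lemma nil_dom: "[] \<in> pdom L"
  using nonempty singleton_dom append_dom[of "[]"] by fastforce

lemma dom_carrier: "w \<in> pdom L \<Longrightarrow> x \<in> set w \<Longrightarrow> x \<in> pcarrier L"
  using dom_words by (auto simp: lists_eq_set)

lemma one_closed: "pone \<in> pcarrier L" using prod_closed nil_dom by blast

lemma insert_one:
  assumes "u @ w \<in> pdom L"
  shows "u @ [pone] @ w \<in> pdom L" "pprod L (u @ [pone] @ w) = pprod L (u @ w)"
  using contract_dom[of u "[]" w] contract_prod[of u "[]" w] assms by auto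

lemma prod_append:
  assumes "u @ v \<in> pdom L"
  shows "[pprod L u, pprod L v] \<in> pdom L" "pmul (pprod L u) (pprod L v) = pprod L (u @ v)"
proof -
  have 1: "[pprod L u] @ v \<in> pdom L" "pprod L ([pprod L u] @ v) = pprod L (u @ v)"
    using contract_dom[of "[]" u v] contract_prod[of "[]" u v] assms by auto
  then show "[pprod L u, pprod L v] \<in> pdom L" "pmul (pprod L u) (pprod L v) = pprod L (u @ v)"
    using contract_dom[of "[pprod L u]" v "[]"] contract_prod[of "[pprod L u]" v "[]"] by auto
qed

lemma prod_Cons:
  assumes "g # w \<in> pdom L"
  shows "[g, pprod L w] \<in> pdom L" "pprod L (g # w) = pmul g (pprod L w)"
  using prod_append[of "[g]" w] assms prod_singleton[of g] dom_carrier[of "g # w" g] by auto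

lemma one_mul: assumes "g \<in> pcarrier L" shows "[pone, g] \<in> pdom L" "pmul pone g = g" "[g, pone] \<in> pdom L" "pmul g pone = g"
  using insert_one[of "[]" "[g]"] insert_one[of "[g]" "[]"] singleton_dom[OF assms] prod_singleton[OF assms]
  by auto

lemma word_inv_dom:
  assumes "w \<in> pdom L" shows "word_inv L w \<in> pdom L" "word_inv L (word_inv L w) = w" "w @ word_inv L w \<in> pdom L"
    "pprod L (w @ word_inv L w) = pone"
proof -
  show 1: "word_inv L w \<in> pdom L" using inv_dom[OF assms] append_dom by blast
  show 2: "word_inv L (word_inv L w) = w" using dom_carrier[OF assms] inv_inv
    by (simp add: word_inv_def rev_map map_idI)
  show "w @ word_inv L w \<in> pdom L" "pprod L (w @ word_inv L w) = pone"
    using inv_dom[OF 1] inv_prod[OF 1] 2 by auto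
qed

lemma inv_mul:
  assumes "g \<in> pcarrier L"
  shows "[pinv L g, g] \<in> pdom L" "pmul (pinv L g) g = pone" "[g, pinv L g] \<in> pdom L" "pmul g (pinv L g) = pone"
  using inv_dom[OF singleton_dom[OF assms]] inv_prod[OF singleton_dom[OF assms]]
    word_inv_dom[OF singleton_dom[OF assms]] by (auto simp: word_inv_def)

lemma inv_unique:
  assumes "[a, b] \<in> pdom L" "pmul a b = pone" shows "a = pinv L b"
proof -
  have a: "a \<in> pcarrier L" "b \<in> pcarrier L" using dom_carrier[OF assms(1)] by auto
  have "[a, b] @ word_inv L [a, b] \<in> pdom L" using word_inv_dom[OF assms(1)] by blast
  then have d: "[a, b, pinv L b] \<in> pdom L"
    using append_dom[of "[a, b, pinv L b]" "[pinv L a]"] by (simp add: word_inv_def)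
  have "pprod L [a, b, pinv L b] = pmul a pone"
    using contract_prod[of "[a]" "[b, pinv L b]" "[]"] d inv_mul(4)[OF a(2)] by simp
  moreover have "pprod L [a, b, pinv L b] = pmul pone (pinv L b)"
    using contract_prod[of "[]" "[a, b]" "[pinv L b]"] d assms(2) by simp
  ultimately show ?thesis using one_mul a inv_closed by metis
qed

lemma inv_one: "pinv L pone = pone"
  using inv_unique[of pone pone] one_mul[OF one_closed] by simp

lemma prod_word_inv:
  assumes "w \<in> pdom L" shows "pprod L (word_inv L w) = pinv L (pprod L w)"
  using inv_unique prod_append[OF inv_dom[OF assms]] inv_prod[OF assms] by simp

text \<open>The word \<open>(g, g\<^sup>-\<^sup>1, x, g, g\<^sup>-\<^sup>1)\<close> is in the domain, being a prefix of \<open>u \<circ> u\<^sup>-\<^sup>1\<close> for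
  \<open>u = (g, g\<^sup>-\<^sup>1, x, g)\<close>. All claims follow by contracting it in two ways.\<close>

lemma conj_undo:
  assumes x: "x \<in> conj_dom L g" and g: "g \<in> pcarrier L"
  shows "pconj L g x \<in> conj_dom L (pinv L g)" "pconj L (pinv L g) (pconj L g x) = x"
    "[g, pconj L g x] \<in> pdom L" "[x, g] \<in> pdom L" "pmul g (pconj L g x) = pmul x g"
proof -
  have d: "[pinv L g, x, g] \<in> pdom L" and xc: "x \<in> pcarrier L" using x by (auto simp: conj_dom_def)
  show xg: "[x, g] \<in> pdom L" using append_dom[of "[pinv L g]" "[x, g]"] d by simp
  have "word_inv L [pinv L g, x, g] @ [pinv L g, x, g] \<in> pdom L" by (rule inv_dom[OF d])
  then have "[pinv L g, pinv L x, g, pinv L g, x, g] \<in> pdom L" using g inv_inv by (simp add: word_inv_def)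
  then have d2: "[g, pinv L g, x, g] \<in> pdom L"
    using append_dom[of "[pinv L g, pinv L x]" "[g, pinv L g, x, g]"] by simp
  have "[g, pinv L g, x, g] @ word_inv L [g, pinv L g, x, g] \<in> pdom L" by (rule word_inv_dom(3)[OF d2])
  then have d3: "[g, pinv L g, x, g, pinv L g] \<in> pdom L"
    using append_dom[of "[g, pinv L g, x, g, pinv L g]" "[pinv L x, g, pinv L g]"] g inv_inv by (simp add: word_inv_def)
  have c: "pconj L g x = pprod L [pinv L g, x, g]" by (simp add: pconj_def)
  show "[g, pconj L g x] \<in> pdom L" using contract_dom[of "[g]" "[pinv L g, x, g]" "[]"] d2 c by simp
  have "pmul g (pconj L g x) = pprod L [g, pinv L g, x, g]"
    using contract_prod[of "[g]" "[pinv L g, x, g]" "[]"] d2 c by simp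
  also have "\<dots> = pprod L [pone, x, g]"
    using contract_prod[of "[]" "[g, pinv L g]" "[x, g]"] d2 inv_mul(4)[OF g] by simp
  also have "\<dots> = pmul x g" using insert_one(2)[of "[]" "[x, g]"] xg by simp
  finally show "pmul g (pconj L g x) = pmul x g" .
  have "[g, pconj L g x, pinv L g] \<in> pdom L"
    using contract_dom[of "[g]" "[pinv L g, x, g]" "[pinv L g]"] d3 c by simp
  moreover have "pconj L g x \<in> pcarrier L" using c d prod_closed by simp
  ultimately show "pconj L g x \<in> conj_dom L (pinv L g)" using inv_inv[OF g] by (simp add: conj_dom_def)
  have "pconj L (pinv L g) (pconj L g x) = pprod L [g, pinv L g, x, g, pinv L g]"
    using contract_prod[of "[g]" "[pinv L g, x, g]" "[pinv L g]"] d3 c inv_inv[OF g] by (simp add: pconj_def)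
  also have "\<dots> = pprod L [pone, x, g, pinv L g]"
    using contract_prod[of "[]" "[g, pinv L g]" "[x, g, pinv L g]"] d3 inv_mul(4)[OF g] by simp
  also have "\<dots> = pprod L [x, g, pinv L g]"
    using insert_one(2)[of "[]" "[x, g, pinv L g]"] append_dom[of "[g, pinv L g]" "[x, g, pinv L g]"] d3 by simp
  also have "\<dots> = pprod L [x, pone]"
    using contract_prod[of "[x]" "[g, pinv L g]" "[]"] append_dom[of "[g, pinv L g]" "[x, g, pinv L g]"] d3 inv_mul(4)[OF g] by simp
  finally show "pconj L (pinv L g) (pconj L g x) = x" using one_mul[OF xc] by simp
qed

lemma conj_one: assumes "x \<in> pcarrier L" shows "x \<in> conj_dom L pone" "pconj L pone x = x"
proof -
  have "[pone, x] \<in> pdom L" "pmul pone x = x" using one_mul[OF assms] by auto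
  then show "x \<in> conj_dom L pone" "pconj L pone x = x"
    using insert_one[of "[pone, x]" "[]"] assms inv_one by (auto simp: conj_dom_def pconj_def)
qed

lemma subgroup_carrier: "pg_subgroup L H \<Longrightarrow> H \<subseteq> pcarrier L"
  by (simp add: pg_subgroup_def partial_subgroup_def)

lemma subgroup_dom: "pg_subgroup L H \<Longrightarrow> set w \<subseteq> H \<Longrightarrow> w \<in> pdom L"
  by (auto simp: pg_subgroup_def in_lists_conv_set)

lemma subgroup_prod: "pg_subgroup L H \<Longrightarrow> set w \<subseteq> H \<Longrightarrow> pprod L w \<in> H"
  using subgroup_dom[of H w] by (auto simp: pg_subgroup_def partial_subgroup_def)

lemma subgroup_inv: "pg_subgroup L H \<Longrightarrow> x \<in> H \<Longrightarrow> pinv L x \<in> H"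
  by (auto simp: pg_subgroup_def partial_subgroup_def)

lemma subgroup_one: "pg_subgroup L H \<Longrightarrow> pone \<in> H"
  using subgroup_prod[of H "[]"] by simp

lemma subgroup_mul: "pg_subgroup L H \<Longrightarrow> x \<in> H \<Longrightarrow> y \<in> H \<Longrightarrow> pmul x y \<in> H"
  using subgroup_prod[of H "[x, y]"] by simp

lemma pg_subgroup_in:
  assumes H: "pg_subgroup L H" and K: "K \<subseteq> H"
  shows "pg_subgroup L K \<longleftrightarrow> pone \<in> K \<and> (\<forall>x\<in>K. pinv L x \<in> K) \<and> (\<forall>x\<in>K. \<forall>y\<in>K. pmul x y \<in> K)"
proof
  assume "pg_subgroup L K" then show "pone \<in> K \<and> (\<forall>x\<in>K. pinv L x \<in> K) \<and> (\<forall>x\<in>K. \<forall>y\<in>K. pmul x y \<in> K)"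
    using subgroup_one subgroup_inv subgroup_mul by blast
next
  assume a: "pone \<in> K \<and> (\<forall>x\<in>K. pinv L x \<in> K) \<and> (\<forall>x\<in>K. \<forall>y\<in>K. pmul x y \<in> K)"
  have d: "w \<in> pdom L" if "set w \<subseteq> K" for w using subgroup_dom[OF H] that K by blast
  have "pprod L w \<in> K" if "set w \<subseteq> K" for w
    using that
  proof (induction w)
    case (Cons g w)
    then show ?case using prod_Cons(2)[OF d[of "g # w"]] a by auto
  qed (use a in simp)
  then show "pg_subgroup L K" using a d K subgroup_carrier[OF H]
    by (auto simp: pg_subgroup_def partial_subgroup_def in_lists_conv_set subset_iff)
qed

lemma pg_group_group:
  assumes H: "pg_subgroup L H" shows "Group.group (pg_group L H)"
proof (rule groupI)
  show "\<one>\<^bsub>pg_group L H\<^esub> \<in> carrier (pg_group L H)" using subgroup_one[OF H] by (simp add: pg_group_def)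
  show "x \<otimes>\<^bsub>pg_group L H\<^esub> y \<in> carrier (pg_group L H)"
    if "x \<in> carrier (pg_group L H)" "y \<in> carrier (pg_group L H)" for x y
    using that subgroup_mul[OF H] by (simp add: pg_group_def)
  show "\<one>\<^bsub>pg_group L H\<^esub> \<otimes>\<^bsub>pg_group L H\<^esub> x = x" if "x \<in> carrier (pg_group L H)" for x
    using that subgroup_one[OF H] one_mul subgroup_carrier[OF H] by (auto simp: pg_group_def)
  show "\<exists>y\<in>carrier (pg_group L H). y \<otimes>\<^bsub>pg_group L H\<^esub> x = \<one>\<^bsub>pg_group L H\<^esub>"
    if "x \<in> carrier (pg_group L H)" for x
    using that subgroup_inv[OF H] inv_mul subgroup_carrier[OF H]
    by (intro bexI[of _ "pinv L x"]) (auto simp: pg_group_def)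
  show "x \<otimes>\<^bsub>pg_group L H\<^esub> y \<otimes>\<^bsub>pg_group L H\<^esub> z = x \<otimes>\<^bsub>pg_group L H\<^esub> (y \<otimes>\<^bsub>pg_group L H\<^esub> z)"
    if "x \<in> carrier (pg_group L H)" "y \<in> carrier (pg_group L H)" "z \<in> carrier (pg_group L H)" for x y z
  proof -
    have m: "x \<in> H" "y \<in> H" "z \<in> H" using that by (auto simp: pg_group_def)
    then have d: "[x, y, z] \<in> pdom L" using subgroup_dom[OF H, of "[x, y, z]"] by simp
    have "pmul (pmul x y) z = pmul x (pmul y z)"
      using contract_prod[of "[]" "[x, y]" "[z]"] contract_prod[of "[x]" "[y, z]" "[]"] d by simp
    then show ?thesis using m subgroup_mul[OF H] by (simp add: pg_group_def)
  qed
qed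

lemma pg_group_simps:
  shows "carrier (pg_group L H) = H" "\<one>\<^bsub>pg_group L H\<^esub> = pone"
    "x \<in> H \<Longrightarrow> y \<in> H \<Longrightarrow> x \<otimes>\<^bsub>pg_group L H\<^esub> y = pmul x y"
  by (auto simp: pg_group_def)

lemma pg_group_inv:
  assumes H: "pg_subgroup L H" and x: "x \<in> H" shows "inv\<^bsub>pg_group L H\<^esub> x = pinv L x"
proof -
  interpret Group.group "pg_group L H" by (rule pg_group_group[OF H])
  show ?thesis
    by (rule inv_equality) (use subgroup_inv[OF H x] x inv_mul subgroup_carrier[OF H] in \<open>auto simp: pg_group_simps\<close>)
qed

lemma subgroup_pg_group_iff:
  assumes H: "pg_subgroup L H"
  shows "subgroup K (pg_group L H) \<longleftrightarrow> pg_subgroup L K \<and> K \<subseteq> H"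
proof (cases "K \<subseteq> H")
  case True
  show ?thesis unfolding pg_subgroup_in[OF H True] subgroup_def
    using True by (auto simp: pg_group_simps pg_group_inv[OF H] subset_iff) 
qed (auto simp: subgroup_def pg_group_simps)

lemma subgroup_conj:
  assumes H: "pg_subgroup L H" and s: "s \<in> H" "x \<in> H"
  shows "x \<in> conj_dom L s" "pconj L s x \<in> H"
    "pconj L s x = inv\<^bsub>pg_group L H\<^esub> s \<otimes>\<^bsub>pg_group L H\<^esub> x \<otimes>\<^bsub>pg_group L H\<^esub> s"
proof -
  have i: "pinv L s \<in> H" using subgroup_inv[OF H s(1)] .
  have d: "[pinv L s, x, s] \<in> pdom L" using subgroup_dom[OF H, of "[pinv L s, x, s]"] s i by simp
  show "x \<in> conj_dom L s" using d s(2) subgroup_carrier[OF H] by (auto simp: conj_dom_def)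
  show "pconj L s x \<in> H" using subgroup_prod[OF H, of "[pinv L s, x, s]"] s i by (simp add: pconj_def)
  have "pconj L s x = pmul (pmul (pinv L s) x) s"
    using contract_prod[of "[]" "[pinv L s, x]" "[s]"] d by (simp add: pconj_def)
  then show "pconj L s x = inv\<^bsub>pg_group L H\<^esub> s \<otimes>\<^bsub>pg_group L H\<^esub> x \<otimes>\<^bsub>pg_group L H\<^esub> s"
    using pg_group_inv[OF H s(1)] i s subgroup_mul[OF H] by (simp add: pg_group_simps)
qed

end

section \<open>Localities\<close>

locale locality_context =
  fixes p :: nat and L :: "'a pgroup" and \<Delta> :: "'a set set" and S :: "'a set"
  assumes locality: "locality p L \<Delta> S" and prime_p: "Factorial_Ring.prime p"
begin

sublocale partial_group L using locality by (simp add: locality_def)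

lemma finite_L: "finite (pcarrier L)" using locality by (simp add: locality_def)
lemma S_subgroup: "pg_subgroup L S" using locality by (simp add: locality_def p_subgroup_def)
lemma S_carrier: "x \<in> S \<Longrightarrow> x \<in> pcarrier L" using subgroup_carrier[OF S_subgroup] by blast
lemma S_card: "\<exists>n. card S = p ^ n" using locality by (simp add: locality_def p_subgroup_def)
lemma finite_S: "finite S" using finite_L subgroup_carrier[OF S_subgroup] finite_subset by blast
lemma S_maximal: "p_subgroup p L R \<Longrightarrow> S \<subseteq> R \<Longrightarrow> R = S" using locality by (simp add: locality_def)
lemma Delta_subgroup: "P \<in> \<Delta> \<Longrightarrow> pg_subgroup L P" using locality by (simp add: locality_def)
lemma Delta_sub: "P \<in> \<Delta> \<Longrightarrow> P \<subseteq> S" using locality by (simp add: locality_def)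
lemma S_Delta: "S \<in> \<Delta>" using locality by (simp add: locality_def)
lemma obj_overgroup:
  "X \<in> \<Delta> \<Longrightarrow> g \<in> pcarrier L \<Longrightarrow> X \<subseteq> conj_dom L g \<Longrightarrow> pg_subgroup L (pconj L g ` X) \<Longrightarrow>
   pg_subgroup L Y \<Longrightarrow> pconj L g ` X \<subseteq> Y \<Longrightarrow> Y \<subseteq> S \<Longrightarrow> Y \<in> \<Delta>"
proof -
  assume a: "X \<in> \<Delta>" "g \<in> pcarrier L" "X \<subseteq> conj_dom L g" "pg_subgroup L (pconj L g ` X)"
    "pg_subgroup L Y" "pconj L g ` X \<subseteq> Y" "Y \<subseteq> S"
  have "\<forall>X\<in>\<Delta>. \<forall>Z\<in>\<Delta>. \<forall>g \<in> pcarrier L. \<forall>Y.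
        X \<subseteq> conj_dom L g \<and> pg_subgroup L (pconj L g ` X) \<and> pg_subgroup L Y \<and>
        pconj L g ` X \<subseteq> Y \<and> Y \<subseteq> Z \<longrightarrow> Y \<in> \<Delta>"
    using locality unfolding locality_def by (elim conjE) assumption
  from this[rule_format, OF a(1) S_Delta a(2)] show "Y \<in> \<Delta>" using a by simp
qed

text \<open>The groupoid of objects and conjugations. By (O1) a word is in the domain iff it is a path in
  this groupoid, so that domain questions become questions of composability.\<close>

definition arrow :: "'a set \<Rightarrow> 'a \<Rightarrow> 'a set \<Rightarrow> bool" where
  "arrow P g Q \<longleftrightarrow> P \<in> \<Delta> \<and> Q \<in> \<Delta> \<and> g \<in> pcarrier L \<and> P \<subseteq> conj_dom L g \<and> pconj L g ` P = Q"

fun path :: "'a set \<Rightarrow> 'a list \<Rightarrow> 'a set \<Rightarrow> bool" where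
  "path P [] Q \<longleftrightarrow> P \<in> \<Delta> \<and> P = Q"
| "path P (g # w) Q \<longleftrightarrow> (\<exists>R. arrow P g R \<and> path R w Q)"

lemma path_Delta: "path P w Q \<Longrightarrow> P \<in> \<Delta> \<and> Q \<in> \<Delta>"
  by (induction w arbitrary: P) (auto simp: arrow_def)

lemma arrow_Delta [simp]: "arrow P g Q \<and> Q \<in> \<Delta> \<longleftrightarrow> arrow P g Q"
  by (auto simp: arrow_def)

lemma path_Cons: "arrow P g R \<Longrightarrow> path R w Q \<Longrightarrow> path P (g # w) Q" by auto

lemma path_Nil: "P \<in> \<Delta> \<Longrightarrow> path P [] P" by simp

lemma path_imp_chain:
  "path P w Q \<Longrightarrow> w \<in> lists (pcarrier L) \<and> (\<exists>Xs. length Xs = Suc (length w) \<and> Xs ! 0 = P \<and> set Xs \<subseteq> \<Delta> \<and>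
     (\<forall>i < length w. Xs ! i \<subseteq> conj_dom L (w ! i) \<and> pconj L (w ! i) ` (Xs ! i) = Xs ! Suc i))"
proof (induction w arbitrary: P)
  case Nil
  then show ?case by (intro conjI exI[of _ "[P]"]) auto
next
  case (Cons g w)
  then obtain R where R: "arrow P g R" "path R w Q" by auto
  from Cons.IH[OF R(2)] obtain Xs where Xs: "length Xs = Suc (length w)" "Xs ! 0 = R" "set Xs \<subseteq> \<Delta>"
     "\<forall>i < length w. Xs ! i \<subseteq> conj_dom L (w ! i) \<and> pconj L (w ! i) ` (Xs ! i) = Xs ! Suc i"
     "w \<in> lists (pcarrier L)" by blast
  have "\<forall>i < length (g # w). (P # Xs) ! i \<subseteq> conj_dom L ((g # w) ! i) \<and>
      pconj L ((g # w) ! i) ` ((P # Xs) ! i) = (P # Xs) ! Suc i"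
    using R(1) Xs by (auto simp: arrow_def nth_Cons split: nat.split)
  then show ?case using R(1) Xs by (intro conjI exI[of _ "P # Xs"]) (auto simp: arrow_def)
qed

lemma chain_imp_path:
  "w \<in> lists (pcarrier L) \<Longrightarrow> length Xs = Suc (length w) \<Longrightarrow> set Xs \<subseteq> \<Delta> \<Longrightarrow>
     (\<forall>i < length w. Xs ! i \<subseteq> conj_dom L (w ! i) \<and> pconj L (w ! i) ` (Xs ! i) = Xs ! Suc i) \<Longrightarrow>
   path (Xs ! 0) w (last Xs)"
proof (induction w arbitrary: Xs)
  case Nil
  then show ?case by (cases Xs) auto
next
  case (Cons g w)
  then obtain P Ys where Xs: "Xs = P # Ys" "length Ys = Suc (length w)" by (cases Xs) auto
  have "path (Ys ! 0) w (last Ys)"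
  proof (rule Cons.IH)
    show "\<forall>i < length w. Ys ! i \<subseteq> conj_dom L (w ! i) \<and> pconj L (w ! i) ` (Ys ! i) = Ys ! Suc i"
    proof (intro allI impI)
      fix i assume "i < length w"
      then show "Ys ! i \<subseteq> conj_dom L (w ! i) \<and> pconj L (w ! i) ` (Ys ! i) = Ys ! Suc i"
        using Cons.prems(4)[rule_format, of "Suc i"] Xs by simp
    qed
  qed (use Cons.prems Xs in auto)
  moreover have "arrow P g (Ys ! 0)"
    using Cons.prems(4)[rule_format, of 0] Cons.prems(1,3) Xs nth_mem[of 0 Ys] by (auto simp: arrow_def)
  ultimately show ?case using Xs by (cases Ys) auto
qed

lemma dom_iff: "w \<in> pdom L \<longleftrightarrow> (\<exists>P Q. path P w Q)"
proof
  assume w: "w \<in> pdom L"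
  then have wl: "w \<in> lists (pcarrier L)" using dom_words by blast
  have "\<exists>Xs. length Xs = Suc (length w) \<and> set Xs \<subseteq> \<Delta> \<and>
       (\<forall>i < length w. Xs ! i \<subseteq> conj_dom L (w ! i) \<and> pconj L (w ! i) ` (Xs ! i) = Xs ! Suc i)"
    using locality wl w by (simp add: locality_def)
  then show "\<exists>P Q. path P w Q" using chain_imp_path[OF wl] by blast
next
  assume "\<exists>P Q. path P w Q"
  then obtain P Q where "path P w Q" by blast
  from path_imp_chain[OF this] show "w \<in> pdom L" using locality unfolding locality_def by blast
qed

lemma path_dom: "path P w Q \<Longrightarrow> w \<in> pdom L" using dom_iff by blast

lemma arrowD:
  assumes "arrow P g Q"
  shows "P \<in> \<Delta>" "Q \<in> \<Delta>" "g \<in> pcarrier L" "P \<subseteq> conj_dom L g" "Q = pconj L g ` P" "P \<subseteq> S" "Q \<subseteq> S"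
    "pg_subgroup L P" "pg_subgroup L Q"
  using assms Delta_sub Delta_subgroup by (auto simp: arrow_def)

lemma arrow_inv: assumes "arrow P g Q" shows "arrow Q (pinv L g) P"
proof -
  have "pconj L (pinv L g) ` Q = P"
  proof -
    have "pconj L (pinv L g) ` Q = (\<lambda>x. pconj L (pinv L g) (pconj L g x)) ` P"
      using arrowD(5)[OF assms] by (simp add: image_image)
    also have "\<dots> = (\<lambda>x. x) ` P" by (rule image_cong) (use conj_undo(2) arrowD[OF assms] in auto)
    finally show ?thesis by simp
  qed
  moreover have "Q \<subseteq> conj_dom L (pinv L g)" using conj_undo(1) arrowD[OF assms] by auto
  ultimately show ?thesis using assms inv_closed by (auto simp: arrow_def)
qed

text \<open>Conjugation of \<open>x \<in> P\<close> by \<open>g h\<close> is evaluated on the word \<open>(h\<^sup>-\<^sup>1, g\<^sup>-\<^sup>1, x, g, h)\<close>, which is a path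
  from \<open>Q\<close> to \<open>Q\<close> because \<open>x\<close> normalizes \<open>P\<close>.\<close>

lemma arrow_mul:
  assumes g: "arrow P g R" and h: "arrow R h Q"
  shows "[g, h] \<in> pdom L" "arrow P (pmul g h) Q"
    "x \<in> P \<Longrightarrow> pconj L (pmul g h) x = pconj L h (pconj L g x)"
proof -
  show d: "[g, h] \<in> pdom L" by (rule path_dom[of P _ Q]) (use g h in auto)
  have xx: "x \<in> conj_dom L (pmul g h) \<and> pconj L (pmul g h) x = pconj L h (pconj L g x)" if x: "x \<in> P" for x
  proof -
    have xP: "arrow P x P"
      using subgroup_conj[OF arrowD(8)[OF g]] x arrowD(1,8)[OF g] arrow_def
    proof -
      have c: "pconj L x ` P \<subseteq> P" using subgroup_conj(2)[OF arrowD(8)[OF g] x] by blast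
      have "P \<subseteq> pconj L x ` P"
      proof
        fix y assume y: "y \<in> P"
        have xi: "pinv L x \<in> P" using subgroup_inv[OF arrowD(8)[OF g] x] .
        have "x \<in> pcarrier L" using subgroup_carrier[OF arrowD(8)[OF g]] x by blast
        then have "pconj L x (pconj L (pinv L x) y) = y"
          using conj_undo(2)[OF subgroup_conj(1)[OF arrowD(8)[OF g] xi y] inv_closed] inv_inv by simp
        then show "y \<in> pconj L x ` P" using subgroup_conj(2)[OF arrowD(8)[OF g] xi y] by (metis imageI)
      qed
      then show ?thesis using c x arrowD(1)[OF g] subgroup_conj(1)[OF arrowD(8)[OF g] x]
          subgroup_carrier[OF arrowD(8)[OF g]] by (auto simp: arrow_def)
    qed
    have pth: "path Q ([pinv L h, pinv L g, x, g, h]) Q"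
      using arrow_inv[OF h] arrow_inv[OF g] xP g h by auto
    then have D: "[pinv L h, pinv L g, x, g, h] \<in> pdom L" by (rule path_dom)
    have inv: "pmul (pinv L h) (pinv L g) = pinv L (pmul g h)"
      using prod_word_inv[OF d] by (simp add: word_inv_def)
    have D1: "[pinv L (pmul g h), x, g, h] \<in> pdom L"
        "pprod L [pinv L (pmul g h), x, g, h] = pprod L [pinv L h, pinv L g, x, g, h]"
      using contract_dom[of "[]" "[pinv L h, pinv L g]" "[x, g, h]"]
        contract_prod[of "[]" "[pinv L h, pinv L g]" "[x, g, h]"] D inv by auto
    have D2: "[pinv L (pmul g h), x, pmul g h] \<in> pdom L"
        "pprod L [pinv L (pmul g h), x, pmul g h] = pprod L [pinv L (pmul g h), x, g, h]"
      using contract_dom[of "[pinv L (pmul g h), x]" "[g, h]" "[]"]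
        contract_prod[of "[pinv L (pmul g h), x]" "[g, h]" "[]"] D1 by auto
    have "pconj L h (pconj L g x) = pprod L [pinv L h, pinv L g, x, g, h]"
      using contract_prod[of "[pinv L h]" "[pinv L g, x, g]" "[h]"] D by (simp add: pconj_def)
    then show ?thesis using D1 D2 subgroup_carrier[OF arrowD(8)[OF g]] x
      by (auto simp: conj_dom_def pconj_def)
  qed
  then show "x \<in> P \<Longrightarrow> pconj L (pmul g h) x = pconj L h (pconj L g x)" by blast
  have "pconj L (pmul g h) ` P = Q"
    using xx arrowD(5)[OF g] arrowD(5)[OF h] by (auto simp: image_image)
  then show "arrow P (pmul g h) Q" using xx g h prod_closed[OF d] by (auto simp: arrow_def)
qed

lemma arrow_one: "P \<in> \<Delta> \<Longrightarrow> arrow P pone P"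
proof -
  assume P: "P \<in> \<Delta>"
  have c: "x \<in> conj_dom L pone \<and> pconj L pone x = x" if "x \<in> P" for x
    using conj_one subgroup_carrier[OF Delta_subgroup[OF P]] that by blast
  then have "pconj L pone ` P = P" by simp
  then show ?thesis using c P one_closed by (simp add: arrow_def subset_iff)
qed

lemma path_prod: "path P w Q \<Longrightarrow> arrow P (pprod L w) Q"
proof (induction w arbitrary: P)
  case Nil then show ?case using arrow_one by auto
next
  case (Cons g w)
  then obtain R where R: "arrow P g R" "path R w Q" by auto
  show ?case using arrow_mul(2)[OF R(1) Cons.IH[OF R(2)]] prod_Cons(2)[OF path_dom[OF Cons.prems]] by simp
qed

lemma mul_assoc:
  assumes "arrow P g Q" "arrow Q h R" "arrow R k U"
  shows "pmul (pmul g h) k = pmul g (pmul h k)" "pprod L [g, h, k] = pmul g (pmul h k)"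
proof -
  have d: "[g, h, k] \<in> pdom L" by (rule path_dom[of P _ U]) (use assms in auto)
  then show 1: "pprod L [g, h, k] = pmul g (pmul h k)" using contract_prod[of "[g]" "[h, k]" "[]"] by simp
  have "pprod L [g, h, k] = pmul (pmul g h) k" using contract_prod[of "[]" "[g, h]" "[k]"] d by simp
  then show "pmul (pmul g h) k = pmul g (pmul h k)" using 1 by simp
qed

lemma S_arrow:
  assumes s: "s \<in> S" and X: "X \<in> \<Delta>" shows "arrow X s (pconj L s ` X)"
proof -
  interpret SG: Group.group "pg_group L S" by (rule pg_group_group[OF S_subgroup])
  have XS: "X \<subseteq> S" using Delta_sub[OF X] .
  have "subgroup X (pg_group L S)" using subgroup_pg_group_iff[OF S_subgroup] XS Delta_subgroup[OF X] by blast
  then have "subgroup ((\<lambda>h. inv\<^bsub>pg_group L S\<^esub> s \<otimes>\<^bsub>pg_group L S\<^esub> h \<otimes>\<^bsub>pg_group L S\<^esub> s) ` X) (pg_group L S)"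
    using SG.conj_subgroup s by (simp add: pg_group_simps)
  moreover have "(\<lambda>h. inv\<^bsub>pg_group L S\<^esub> s \<otimes>\<^bsub>pg_group L S\<^esub> h \<otimes>\<^bsub>pg_group L S\<^esub> s) ` X = pconj L s ` X"
    using subgroup_conj(3)[OF S_subgroup s] XS by (intro image_cong) auto
  ultimately have sub: "pg_subgroup L (pconj L s ` X)" "pconj L s ` X \<subseteq> S"
    using subgroup_pg_group_iff[OF S_subgroup] by auto
  have d: "X \<subseteq> conj_dom L s" using subgroup_conj(1)[OF S_subgroup s] XS by blast
  have "pconj L s ` X \<in> \<Delta>" using obj_overgroup[OF X S_carrier[OF s] d sub(1) sub(1) _ sub(2)] by blast
  then show ?thesis using X d S_carrier[OF s] by (auto simp: arrow_def)
qed

definition S_of :: "'a \<Rightarrow> 'a set" where "S_of g = {x \<in> S. x \<in> conj_dom L g \<and> pconj L g x \<in> S}"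

lemma S_of_word_stab: "word_stab L S [g] = S_of g"
proof
  show "word_stab L S [g] \<subseteq> S_of g"
  proof
    fix x assume "x \<in> word_stab L S [g]"
    then obtain xs where x: "x \<in> S" and xs: "length xs = Suc (length [g])" "xs ! 0 = x" "set xs \<subseteq> S"
      and c: "\<forall>i < length [g]. xs ! i \<in> conj_dom L ([g] ! i) \<and> pconj L ([g] ! i) (xs ! i) = xs ! Suc i"
      unfolding word_stab_def by blast
    have "x \<in> conj_dom L g" "pconj L g x = xs ! Suc 0" using c[rule_format, of 0] xs(2) by auto
    moreover have "xs ! Suc 0 \<in> S" using xs(1,3) nth_mem[of "Suc 0" xs] by (metis subsetD lessI length_Cons list.size(3))
    ultimately show "x \<in> S_of g" using x by (simp add: S_of_def)
  qed
  show "S_of g \<subseteq> word_stab L S [g]"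
  proof
    fix x assume x: "x \<in> S_of g"
    let ?xs = "[x, pconj L g x]"
    have "length ?xs = Suc (length [g])" "?xs ! 0 = x" "set ?xs \<subseteq> S"
      "\<forall>i < length [g]. ?xs ! i \<in> conj_dom L ([g] ! i) \<and> pconj L ([g] ! i) (?xs ! i) = ?xs ! Suc i"
      using x by (simp_all add: S_of_def)
    then show "x \<in> word_stab L S [g]" using x unfolding word_stab_def S_of_def by blast
  qed
qed

lemma S_of_sub: "S_of g \<subseteq> S" by (auto simp: S_of_def)

lemma arrow_S_of: assumes "arrow P g Q" shows "P \<subseteq> S_of g"
proof
  fix x assume x: "x \<in> P"
  then have "pconj L g x \<in> Q" unfolding arrowD(5)[OF assms] by (rule imageI)
  then show "x \<in> S_of g" using x arrowD(4,6,7)[OF assms] by (auto simp: S_of_def)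
qed

text \<open>With \<open>b = a\<^sup>g\<close> the path \<open>(a\<^sup>-\<^sup>1, g, b)\<close> has product \<open>g\<close>. This provides enough objects on which \<open>g\<close> is
  defined to show that \<open>S\<^sub>g\<close> is a subgroup, before it is known to be an object.\<close>

lemma arrow_shift:
  assumes X: "arrow X g Y" and a: "a \<in> S_of g"
  shows "arrow (pconj L a ` X) g (pconj L (pconj L g a) ` Y)"
proof -
  let ?b = "pconj L g a"
  have aS: "a \<in> S" and bS: "?b \<in> S" and ad: "a \<in> conj_dom L g" using a by (auto simp: S_of_def)
  have g: "g \<in> pcarrier L" using arrowD(3)[OF X] .
  have A: "arrow (pconj L a ` X) (pinv L a) X" using arrow_inv[OF S_arrow[OF aS arrowD(1)[OF X]]] .
  have B: "arrow Y ?b (pconj L ?b ` Y)" using S_arrow[OF bS arrowD(2)[OF X]] .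
  have "arrow (pconj L a ` X) (pprod L [pinv L a, g, ?b]) (pconj L ?b ` Y)"
    by (rule path_prod) (use A X B in auto)
  moreover have "pprod L [pinv L a, g, ?b] = g"
  proof -
    have "pprod L [pinv L a, g, ?b] = pmul (pinv L a) (pmul g ?b)" using mul_assoc(2)[OF A X B] .
    also have "\<dots> = pmul (pinv L a) (pmul a g)" using conj_undo(5)[OF ad g] by simp
    also have "\<dots> = g"
    proof -
      have "word_inv L [a, g] @ [a, g] \<in> pdom L" using inv_dom conj_undo(4)[OF ad g] by blast
      then have d: "[pinv L a, a, g] \<in> pdom L"
        using append_dom[of "[pinv L g]" "[pinv L a, a, g]"] by (simp add: word_inv_def)
      have "pmul (pinv L a) (pmul a g) = pprod L [pinv L a, a, g]"
        using contract_prod[of "[pinv L a]" "[a, g]" "[]"] d by simp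
      also have "\<dots> = pmul pone g" using contract_prod[of "[]" "[pinv L a, a]" "[g]"] d inv_mul(2)[OF S_carrier[OF aS]] by simp
      finally show ?thesis using one_mul[OF g] by simp
    qed
    finally show ?thesis .
  qed
  ultimately show ?thesis by simp
qed

lemma S_of_mul:
  assumes g: "g \<in> pcarrier L" and x: "x \<in> S_of g" and y: "y \<in> S_of g"
  shows "pmul x y \<in> S_of g" "pconj L g (pmul x y) = pmul (pconj L g x) (pconj L g y)"
proof -
  obtain X Y where X: "arrow X g Y" using dom_iff[of "[g]"] singleton_dom[OF g] by auto
  have xS: "x \<in> S" "pconj L g x \<in> S" and yS: "y \<in> S" "pconj L g y \<in> S" using x y by (auto simp: S_of_def)
  let ?X1 = "pconj L x ` X" and ?Y1 = "pconj L (pconj L g x) ` Y"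
  have 1: "arrow X x ?X1" using S_arrow[OF xS(1) arrowD(1)[OF X]] .
  have 2: "arrow ?X1 g ?Y1" by (rule arrow_shift[OF X x])
  have 3: "arrow ?X1 y (pconj L y ` ?X1)" using S_arrow[OF yS(1) arrowD(1)[OF 2]] .
  have 4: "arrow (pconj L y ` ?X1) g (pconj L (pconj L g y) ` ?Y1)" by (rule arrow_shift[OF 2 y])
  have pth: "path Y [pinv L g, x, g, pinv L g, y, g] (pconj L (pconj L g y) ` ?Y1)"
    by (rule path_Cons[OF arrow_inv[OF X]] path_Cons[OF 1] path_Cons[OF 2] path_Cons[OF arrow_inv[OF 2]]
        path_Cons[OF 3] path_Cons[OF 4] path_Nil arrowD(2)[OF 4])+
  have pth2: "path Y [pinv L g, x, y, g] (pconj L (pconj L g y) ` ?Y1)"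
    using arrow_inv[OF X] 1 3 4 by auto
  note D = path_dom[OF pth] and D2 = path_dom[OF pth2]
  have c: "[pinv L g, pmul x y, g] \<in> pdom L" "pprod L [pinv L g, pmul x y, g] = pprod L [pinv L g, x, y, g]"
    using contract_dom[of "[pinv L g]" "[x, y]" "[g]"] contract_prod[of "[pinv L g]" "[x, y]" "[g]"] D2 by auto
  have xy: "pmul x y \<in> S" using subgroup_mul[OF S_subgroup xS(1) yS(1)] .
  have "pmul (pconj L g x) (pconj L g y) = pprod L [pinv L g, x, g, pinv L g, y, g]"
    using prod_append(2)[of "[pinv L g, x, g]" "[pinv L g, y, g]"] D by (simp add: pconj_def)
  also have "\<dots> = pprod L [pinv L g, x, pone, y, g]"
    using contract_prod[of "[pinv L g, x]" "[g, pinv L g]" "[y, g]"] D inv_mul(4)[OF g] by simp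
  also have "\<dots> = pprod L [pinv L g, x, y, g]" using insert_one(2)[of "[pinv L g, x]" "[y, g]"] D2 by simp
  finally show e: "pconj L g (pmul x y) = pmul (pconj L g x) (pconj L g y)" using c by (simp add: pconj_def)
  show "pmul x y \<in> S_of g" using e c xy S_carrier[OF xy] subgroup_mul[OF S_subgroup xS(2) yS(2)]
    by (auto simp: S_of_def conj_dom_def)
qed

lemma pconj_one_elt: assumes g: "g \<in> pcarrier L" shows "pone \<in> conj_dom L g" "pconj L g pone = pone"
proof -
  have "[pinv L g, pone, g] \<in> pdom L" "pprod L [pinv L g, pone, g] = pone"
    using insert_one[of "[pinv L g]" "[g]"] inv_mul[OF g] by auto
  then show "pone \<in> conj_dom L g" "pconj L g pone = pone" using one_closed by (auto simp: conj_dom_def pconj_def)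
qed

lemma S_one: "pone \<in> S" using subgroup_one[OF S_subgroup] .

lemma mul_inv_S: "x \<in> S \<Longrightarrow> pinv L x \<in> S" using subgroup_inv[OF S_subgroup] .

lemma S_of_inv:
  assumes g: "g \<in> pcarrier L" and x: "x \<in> S_of g"
  shows "pinv L x \<in> S_of g" "pconj L g (pinv L x) = pinv L (pconj L g x)"
proof -
  have xS: "x \<in> S" "pconj L g x \<in> S" and d: "[pinv L g, x, g] \<in> pdom L" using x by (auto simp: S_of_def conj_dom_def)
  have w: "word_inv L [pinv L g, x, g] = [pinv L g, pinv L x, g]" using inv_inv[OF g] by (simp add: word_inv_def)
  have "[pinv L g, pinv L x, g] \<in> pdom L" "pprod L [pinv L g, pinv L x, g] = pinv L (pconj L g x)"
    using word_inv_dom(1)[OF d] prod_word_inv[OF d] w by (auto simp: pconj_def)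
  then show "pconj L g (pinv L x) = pinv L (pconj L g x)" "pinv L x \<in> S_of g"
    using mul_inv_S xS S_carrier inv_closed by (auto simp: S_of_def conj_dom_def pconj_def)
qed

lemma sub_S_iff: "K \<subseteq> S \<Longrightarrow> pg_subgroup L K \<longleftrightarrow> pone \<in> K \<and> (\<forall>x\<in>K. pinv L x \<in> K) \<and> (\<forall>x\<in>K. \<forall>y\<in>K. pmul x y \<in> K)"
  by (rule pg_subgroup_in[OF S_subgroup])

lemma S_of_subgroup: assumes g: "g \<in> pcarrier L" shows "pg_subgroup L (S_of g)"
  unfolding sub_S_iff[OF S_of_sub]
  using S_of_mul(1)[OF g] S_of_inv(1)[OF g] pconj_one_elt[OF g] S_one by (auto simp: S_of_def)

lemma conj_image_subgroup:
  assumes g: "g \<in> pcarrier L" and P: "pg_subgroup L P" "P \<subseteq> S_of g"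
  shows "pg_subgroup L (pconj L g ` P)" "pconj L g ` P \<subseteq> S"
proof -
  show s: "pconj L g ` P \<subseteq> S" using P(2) by (auto simp: S_of_def)
  have 1: "pone \<in> pconj L g ` P" using subgroup_one[OF P(1)] pconj_one_elt(2)[OF g] by (metis imageI)
  have 2: "\<forall>x\<in>P. pinv L (pconj L g x) \<in> pconj L g ` P"
    using subgroup_inv[OF P(1)] S_of_inv(2)[OF g] P(2) by (metis imageI subsetD)
  have 3: "\<forall>x\<in>P. \<forall>y\<in>P. pmul (pconj L g x) (pconj L g y) \<in> pconj L g ` P"
    using subgroup_mul[OF P(1)] S_of_mul(2)[OF g] P(2) by (metis imageI subsetD)
  show "pg_subgroup L (pconj L g ` P)" unfolding sub_S_iff[OF s] using 1 2 3 by auto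
qed

lemma arrowI:
  assumes g: "g \<in> pcarrier L" and P: "P \<in> \<Delta>" "P \<subseteq> S_of g"
  shows "arrow P g (pconj L g ` P)"
proof -
  have s: "pg_subgroup L (pconj L g ` P)" "pconj L g ` P \<subseteq> S"
    using conj_image_subgroup[OF g Delta_subgroup[OF P(1)] P(2)] by auto
  have d: "P \<subseteq> conj_dom L g" using P(2) by (auto simp: S_of_def)
  show ?thesis using obj_overgroup[OF P(1) g d s(1) s(1) _ s(2)] g d P(1) by (auto simp: arrow_def)
qed

lemma Delta_over: "P \<in> \<Delta> \<Longrightarrow> P \<subseteq> Q \<Longrightarrow> Q \<subseteq> S \<Longrightarrow> pg_subgroup L Q \<Longrightarrow> Q \<in> \<Delta>"
  using obj_overgroup[of P pone Q] arrow_one[of P] one_closed by (simp add: arrow_def Delta_subgroup)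

lemma S_of_Delta: assumes g: "g \<in> pcarrier L" shows "S_of g \<in> \<Delta>"
proof -
  obtain X Y where X: "arrow X g Y" using dom_iff[of "[g]"] singleton_dom[OF g] by auto
  show ?thesis using Delta_over[OF arrowD(1)[OF X] arrow_S_of[OF X] S_of_sub S_of_subgroup[OF g]] .
qed

lemma S_of_arrow: "g \<in> pcarrier L \<Longrightarrow> arrow (S_of g) g (pconj L g ` S_of g)"
  using arrowI S_of_Delta by blast

lemma S_of_inv_image: assumes g: "g \<in> pcarrier L" shows "S_of (pinv L g) = pconj L g ` S_of g"
proof
  have 1: "pconj L g ` S_of g \<subseteq> S_of (pinv L g)" if "g \<in> pcarrier L" for g
    using arrow_S_of[OF arrow_inv[OF S_of_arrow[OF that]]] .
  show "pconj L g ` S_of g \<subseteq> S_of (pinv L g)" using 1[OF g] .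
  show "S_of (pinv L g) \<subseteq> pconj L g ` S_of g"
  proof
    fix y assume y: "y \<in> S_of (pinv L g)"
    have "pconj L (pinv L g) y \<in> S_of g" using 1[OF inv_closed[OF g]] y inv_inv[OF g] by auto
    moreover have "pconj L g (pconj L (pinv L g) y) = y"
      using conj_undo(2)[OF _ inv_closed[OF g], of y] y inv_inv[OF g] by (auto simp: S_of_def)
    ultimately show "y \<in> pconj L g ` S_of g" by (metis imageI)
  qed
qed

lemma S_of_S: "s \<in> S \<Longrightarrow> S_of s = S"
  using subgroup_conj(1,2)[OF S_subgroup] by (auto simp: S_of_def)

lemma conj_inj: assumes "arrow P g Q" shows "inj_on (pconj L g) P"
proof (rule inj_onI)
  fix x y assume "x \<in> P" "y \<in> P" "pconj L g x = pconj L g y"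
  then show "x = y" using conj_undo(2)[OF _ arrowD(3)[OF assms]] arrowD(4)[OF assms] by (metis subsetD)
qed

lemma arrow_card: "arrow P g Q \<Longrightarrow> card Q = card P"
  using card_image[OF conj_inj] arrowD(5) by simp

lemma arrow_restrict:
  assumes "arrow P g Q" "X \<in> \<Delta>" "X \<subseteq> P" shows "arrow X g (pconj L g ` X)"
  using arrowI[OF arrowD(3)[OF assms(1)] assms(2)] arrow_S_of[OF assms(1)] assms(3) by blast

lemma arrow_S: assumes "P \<in> \<Delta>" "x \<in> P" shows "arrow P x P"
proof -
  have xS: "x \<in> S" using assms Delta_sub by blast
  have 1: "arrow P x (pconj L x ` P)" using S_arrow[OF xS assms(1)] .
  have "pconj L x ` P \<subseteq> P" using subgroup_conj(2)[OF Delta_subgroup[OF assms(1)] assms(2)] by blast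
  moreover have "finite P" using finite_subset[OF Delta_sub[OF assms(1)] finite_S] .
  ultimately have "pconj L x ` P = P" using card_subset_eq arrow_card[OF 1] by blast
  then show ?thesis using 1 by simp
qed

section \<open>Normalizers of objects and their Sylow subgroups\<close>

lemma sub_S_card:
  assumes "pg_subgroup L K" "K \<subseteq> S" shows "\<exists>n. card K = p ^ n"
proof -
  interpret SG: Group.group "pg_group L S" by (rule pg_group_group[OF S_subgroup])
  obtain n where n: "card S = p ^ n" using S_card by blast
  have "subgroup K (pg_group L S)" "subgroup S (pg_group L S)"
    using subgroup_pg_group_iff[OF S_subgroup] assms S_subgroup by auto
  then show ?thesis using SG.card_sub_prime_power[OF prime_p _ _ assms(2) _ n] finite_S
    by (simp add: pg_group_simps)
qed

lemma inter_subgroup: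
  assumes "pg_subgroup L H" "pg_subgroup L K" shows "pg_subgroup L (H \<inter> K)"
  using pg_subgroup_in[OF assms(1), of "H \<inter> K"] subgroup_one subgroup_inv subgroup_mul assms by blast

lemma normalizer_iff: "P \<in> \<Delta> \<Longrightarrow> g \<in> pnormalizer L P \<longleftrightarrow> arrow P g P"
  by (auto simp: pnormalizer_def arrow_def)

lemma path_loop: "P \<in> \<Delta> \<Longrightarrow> \<forall>g \<in> set w. arrow P g P \<Longrightarrow> path P w P"
  by (induction w) auto

lemma normalizer_subgroup:
  assumes P: "P \<in> \<Delta>" shows "pg_subgroup L (pnormalizer L P)"
proof -
  have d: "w \<in> pdom L" "arrow P (pprod L w) P" if "set w \<subseteq> pnormalizer L P" for w
    using path_loop[OF P, of w] that normalizer_iff[OF P] path_dom path_prod by blast+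
  have "pnormalizer L P \<noteq> {}" using arrow_one[OF P] normalizer_iff[OF P] by blast
  moreover have "pnormalizer L P \<subseteq> pcarrier L" by (auto simp: pnormalizer_def)
  ultimately show ?thesis using d arrow_inv normalizer_iff[OF P]
    by (auto simp: pg_subgroup_def partial_subgroup_def in_lists_conv_set subset_iff)
qed

definition NS :: "'a set \<Rightarrow> 'a set" where "NS P = {s \<in> S. arrow P s P}"

lemma NS_eq: "P \<in> \<Delta> \<Longrightarrow> NS P = S \<inter> pnormalizer L P"
  using normalizer_iff by (auto simp: NS_def)

lemma NS_sub: "NS P \<subseteq> S" by (auto simp: NS_def)

lemma NS_subgroup: assumes "P \<in> \<Delta>" shows "pg_subgroup L (NS P)"
  unfolding NS_eq[OF assms] by (rule inter_subgroup[OF S_subgroup normalizer_subgroup[OF assms]])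

lemma NS_self: "P \<in> \<Delta> \<Longrightarrow> P \<subseteq> NS P"
  using arrow_S Delta_sub by (auto simp: NS_def)

lemma NS_Delta: "P \<in> \<Delta> \<Longrightarrow> NS P \<in> \<Delta>"
  using Delta_over[OF _ NS_self NS_sub NS_subgroup] by simp

lemma finite_NS: "finite (NS P)" using finite_subset[OF NS_sub finite_S] .

lemma NS_S: "NS S = S" using arrow_S[OF S_Delta] by (auto simp: NS_def)

lemma S_normalizer_grows:
  assumes P: "P \<in> \<Delta>" and Y: "pg_subgroup L Y" "Y \<subseteq> S" "P \<subset> Y"
  shows "\<exists>y \<in> Y - P. arrow P y P"
proof -
  interpret SG: Group.group "pg_group L S" by (rule pg_group_group[OF S_subgroup])
  obtain n where n: "card Y = p ^ n" using sub_S_card Y by blast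
  have s: "subgroup Y (pg_group L S)" "subgroup P (pg_group L S)"
    using subgroup_pg_group_iff[OF S_subgroup] Y Delta_subgroup[OF P] Delta_sub[OF P] by auto
  obtain y where y: "y \<in> Y - P"
    "\<forall>h\<in>P. inv\<^bsub>pg_group L S\<^esub> y \<otimes>\<^bsub>pg_group L S\<^esub> h \<otimes>\<^bsub>pg_group L S\<^esub> y \<in> P"
    using SG.normalizer_grows[OF prime_p _ s(1) n s(2) Y(3)] finite_S by (auto simp: pg_group_simps)
  have yS: "y \<in> S" using y Y by blast
  have 1: "arrow P y (pconj L y ` P)" by (rule S_arrow[OF yS P])
  have "pconj L y ` P \<subseteq> P" using y(2) subgroup_conj(3)[OF S_subgroup yS] Delta_sub[OF P] by auto
  then have "pconj L y ` P = P"
    using card_subset_eq[OF finite_subset[OF Delta_sub[OF P] finite_S]] arrow_card[OF 1] by blast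
  then show ?thesis using 1 y(1) by auto
qed

lemma NS_grows: assumes "P \<in> \<Delta>" "P \<noteq> S" shows "P \<subset> NS P"
proof -
  have "P \<subset> S" using Delta_sub assms by blast
  then obtain y where "y \<in> S - P" "arrow P y P" using S_normalizer_grows[OF assms(1) S_subgroup] by blast
  then show ?thesis using NS_self[OF assms(1)] by (auto simp: NS_def)
qed

lemma conj_elt:
  assumes "arrow P m P'" "arrow P g Q" "arrow P' g Q'"
  shows "m \<in> conj_dom L g" "arrow Q (pconj L g m) Q'" "pconj L g m = pmul (pinv L g) (pmul m g)"
proof -
  have pth: "path Q [pinv L g, m, g] Q'" using arrow_inv[OF assms(2)] assms by auto
  show "m \<in> conj_dom L g" using path_dom[OF pth] arrowD(3)[OF assms(1)] by (simp add: conj_dom_def)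
  show "arrow Q (pconj L g m) Q'" using path_prod[OF pth] by (simp add: pconj_def)
  show "pconj L g m = pmul (pinv L g) (pmul m g)"
    using mul_assoc(2)[OF arrow_inv[OF assms(2)] assms(1,3)] by (simp add: pconj_def)
qed

lemma inv_mul_arrow:
  assumes "arrow P g R" "arrow R h Q" shows "pinv L (pmul g h) = pmul (pinv L h) (pinv L g)"
  using prod_word_inv[OF arrow_mul(1)[OF assms]] by (simp add: word_inv_def)

lemma conj_elt_mul:
  assumes m: "arrow P m P'" and g: "arrow P g R" "arrow P' g R'" and h: "arrow R h Q" "arrow R' h Q'"
  shows "pconj L (pmul g h) m = pconj L h (pconj L g m)"
proof -
  have pth: "path Q [pinv L h, pinv L g, m, g, h] Q'"
    by (rule path_Cons[OF arrow_inv[OF h(1)]] path_Cons[OF arrow_inv[OF g(1)]] path_Cons[OF m]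
        path_Cons[OF g(2)] path_Cons[OF h(2)] path_Nil arrowD(2)[OF h(2)])+
  note D = path_dom[OF pth]
  have pth2: "path Q [pinv L (pmul g h), m, g, h] Q'"
    by (rule path_Cons[OF arrow_inv[OF arrow_mul(2)[OF g(1) h(1)]]] path_Cons[OF m]
        path_Cons[OF g(2)] path_Cons[OF h(2)] path_Nil arrowD(2)[OF h(2)])+
  have "pconj L (pmul g h) m = pprod L [pinv L (pmul g h), m, g, h]"
    using contract_prod[of "[pinv L (pmul g h), m]" "[g, h]" "[]"] path_dom[OF pth2] by (simp add: pconj_def)
  also have "\<dots> = pprod L [pinv L h, pinv L g, m, g, h]"
    using contract_prod[of "[]" "[pinv L h, pinv L g]" "[m, g, h]"] D inv_mul_arrow[OF g(1) h(1)] by simp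
  also have "\<dots> = pconj L h (pconj L g m)"
    using contract_prod[of "[pinv L h]" "[pinv L g, m, g]" "[h]"] D by (simp add: pconj_def)
  finally show ?thesis .
qed

lemma mul_inv_cancel:
  assumes "arrow P g Q" "arrow P h R" shows "pmul g (pmul (pinv L g) h) = h"
  using mul_assoc(1)[OF assms(1) arrow_inv[OF assms(1)] assms(2)] inv_mul[OF arrowD(3)[OF assms(1)]]
    one_mul[OF arrowD(3)[OF assms(2)]] by simp

lemma inv_mul_cancel:
  assumes "arrow Q g P" "arrow P h R" shows "pmul (pinv L g) (pmul g h) = h"
  using mul_assoc(1)[OF arrow_inv[OF assms(1)] assms] inv_mul[OF arrowD(3)[OF assms(1)]]
    one_mul[OF arrowD(3)[OF assms(2)]] by simp

lemma mul_cancel_right: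
  assumes "arrow P h Q" "arrow Q g R" shows "pmul (pmul h g) (pinv L g) = h"
  using mul_assoc(1)[OF assms arrow_inv[OF assms(2)]] inv_mul[OF arrowD(3)[OF assms(2)]]
    one_mul[OF arrowD(3)[OF assms(1)]] by simp

lemma mul_inv_cancel_right:
  assumes "arrow P h Q" "arrow R g Q" shows "pmul (pmul h (pinv L g)) g = h"
  using mul_assoc(1)[OF assms(1) arrow_inv[OF assms(2)] assms(2)] inv_mul[OF arrowD(3)[OF assms(2)]]
    one_mul[OF arrowD(3)[OF assms(1)]] by simp

lemma conj_elt_hom:
  assumes m: "arrow P m P'" "arrow P' n P''" and g: "arrow P g R" "arrow P' g R'" "arrow P'' g R''"
  shows "pconj L g (pmul m n) = pmul (pconj L g m) (pconj L g n)"
proof -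
  note gi = arrow_inv[OF g(1)] arrow_inv[OF g(2)]
  have "pmul (pconj L g m) (pconj L g n) = pmul (pmul (pinv L g) (pmul m g)) (pmul (pinv L g) (pmul n g))"
    using conj_elt(3)[OF m(1) g(1,2)] conj_elt(3)[OF m(2) g(2,3)] by simp
  also have "\<dots> = pmul (pinv L g) (pmul (pmul m g) (pmul (pinv L g) (pmul n g)))"
    by (rule mul_assoc(1)[OF gi(1) arrow_mul(2)[OF m(1) g(2)] arrow_mul(2)[OF gi(2) arrow_mul(2)[OF m(2) g(3)]]])
  also have "pmul (pmul m g) (pmul (pinv L g) (pmul n g)) = pmul m (pmul g (pmul (pinv L g) (pmul n g)))"
    by (rule mul_assoc(1)[OF m(1) g(2) arrow_mul(2)[OF gi(2) arrow_mul(2)[OF m(2) g(3)]]])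
  also have "pmul g (pmul (pinv L g) (pmul n g)) = pmul n g"
    by (rule mul_inv_cancel[OF g(2) arrow_mul(2)[OF m(2) g(3)]])
  also have "pmul m (pmul n g) = pmul (pmul m n) g" using mul_assoc(1)[OF m g(3)] by simp
  finally show ?thesis using conj_elt(3)[OF arrow_mul(2)[OF m] g(1,3)] by simp
qed

lemma conj_loops_subgroup:
  assumes g: "arrow P g Q" and H: "pg_subgroup L H" "\<forall>m\<in>H. arrow P m P"
  shows "pg_subgroup L (pconj L g ` H)" "\<forall>m\<in>pconj L g ` H. arrow Q m Q" "card (pconj L g ` H) = card H"
proof -
  note P = arrowD(1,2)[OF g]
  have c: "m \<in> conj_dom L g" "arrow Q (pconj L g m) Q" if "m \<in> H" for m
    using conj_elt[OF H(2)[rule_format, OF that] g g] by auto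
  then show 1: "\<forall>m\<in>pconj L g ` H. arrow Q m Q" by blast
  then have sub: "pconj L g ` H \<subseteq> pnormalizer L Q" using normalizer_iff[OF P(2)] by blast
  have gc: "g \<in> pcarrier L" using arrowD(3)[OF g] .
  have hom: "pmul (pconj L g m) (pconj L g n) = pconj L g (pmul m n)" if "m \<in> H" "n \<in> H" for m n
    using conj_elt_hom[OF _ _ g g g] H(2) that by simp
  have inv: "pinv L (pconj L g m) = pconj L g (pinv L m)" if m: "m \<in> H" for m
  proof -
    have i: "pinv L m \<in> H" using subgroup_inv[OF H(1) m] .
    have mc: "m \<in> pcarrier L" using subgroup_carrier[OF H(1)] m by blast
    have "pmul (pconj L g (pinv L m)) (pconj L g m) = pone"
      using hom[OF i m] inv_mul(2)[OF mc] pconj_one_elt(2)[OF gc] by simp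
    then have "pconj L g (pinv L m) = pinv L (pconj L g m)"
      using inv_unique arrow_mul(1)[OF c(2)[OF i] c(2)[OF m]] by blast
    then show ?thesis by simp
  qed
  show "pg_subgroup L (pconj L g ` H)"
    unfolding pg_subgroup_in[OF normalizer_subgroup[OF P(2)] sub]
  proof (intro conjI ballI)
    show "pone \<in> pconj L g ` H" using pconj_one_elt(2)[OF gc] subgroup_one[OF H(1)] by (metis imageI)
    show "pinv L x \<in> pconj L g ` H" if "x \<in> pconj L g ` H" for x
      using that inv subgroup_inv[OF H(1)] by auto
    show "pmul x y \<in> pconj L g ` H" if "x \<in> pconj L g ` H" "y \<in> pconj L g ` H" for x y
      using that hom subgroup_mul[OF H(1)] by auto
  qed
  have "inj_on (pconj L g) H" using conj_undo(2)[OF c(1) gc] by (metis inj_onI)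
  then show "card (pconj L g ` H) = card H" by (rule card_image)
qed

text \<open>Conjugacy of objects under elements of \<open>L\<close> is conjugacy in the fusion system, see
  \<open>fconjugates_iff\<close> below.\<close>

definition fully_norm :: "'a set \<Rightarrow> bool" where
  "fully_norm Z \<longleftrightarrow> Z \<in> \<Delta> \<and> (\<forall>g Q. arrow Z g Q \<longrightarrow> card (NS Q) \<le> card (NS Z))"

lemma fully_norm_ex:
  assumes X: "X \<in> \<Delta>" shows "\<exists>h Z. arrow X h Z \<and> fully_norm Z"
proof -
  let ?P = "\<lambda>Z. \<exists>h. arrow X h Z"
  have "?P X" using arrow_one[OF X] by blast
  moreover have "\<forall>Z. ?P Z \<longrightarrow> card (NS Z) < Suc (card S)"
    using card_mono[OF finite_S NS_sub] by (simp add: less_Suc_eq_le)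
  ultimately obtain Z where Z: "?P Z" "\<And>Y. ?P Y \<Longrightarrow> card (NS Y) \<le> card (NS Z)"
    using ex_has_greatest_nat[of ?P X "\<lambda>Z. card (NS Z)" "Suc (card S)"] by blast
  obtain h where h: "arrow X h Z" using Z(1) by blast
  have "fully_norm Z" unfolding fully_norm_def using Z(2) arrow_mul(2)[OF h] arrowD(2)[OF h] by blast
  then show ?thesis using h by blast
qed

abbreviation NG :: "'a set \<Rightarrow> 'a monoid" where "NG P \<equiv> pg_group L (pnormalizer L P)"

lemma NG_group: "P \<in> \<Delta> \<Longrightarrow> Group.group (NG P)" using pg_group_group normalizer_subgroup by blast

lemma NG_finite: "P \<in> \<Delta> \<Longrightarrow> finite (carrier (NG P))"
  using finite_subset[OF subgroup_carrier[OF normalizer_subgroup] finite_L] by (simp add: pg_group_simps)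

lemma NG_subgroup_iff:
  "P \<in> \<Delta> \<Longrightarrow> subgroup H (NG P) \<longleftrightarrow> pg_subgroup L H \<and> (\<forall>m\<in>H. arrow P m P)"
  using subgroup_pg_group_iff[OF normalizer_subgroup, of P H] normalizer_iff[of P] by blast

lemma NG_conj:
  assumes "P \<in> \<Delta>" "arrow P g P" "arrow P x P"
  shows "inv\<^bsub>NG P\<^esub> g \<otimes>\<^bsub>NG P\<^esub> x \<otimes>\<^bsub>NG P\<^esub> g = pconj L g x"
  using subgroup_conj(3)[OF normalizer_subgroup[OF assms(1)]] normalizer_iff[OF assms(1)] assms(2,3) by simp

lemma sylow_conj_into_S:
  assumes Z: "Z \<in> \<Delta>" "p_sylow p (NG Z) (NS Z)"
    and H: "pg_subgroup L H" "\<forall>m\<in>H. arrow Z m Z" "card H = p ^ n"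
  shows "\<exists>k. arrow Z k Z \<and> pconj L k ` H \<subseteq> NS Z"
proof -
  have "subgroup H (NG Z)" using NG_subgroup_iff[OF Z(1)] H by blast
  then obtain k where k: "k \<in> carrier (NG Z)"
    "\<forall>h\<in>H. inv\<^bsub>NG Z\<^esub> k \<otimes>\<^bsub>NG Z\<^esub> h \<otimes>\<^bsub>NG Z\<^esub> k \<in> NS Z"
    using group.sylow_contains[OF NG_group[OF Z(1)] prime_p NG_finite[OF Z(1)] _ H(3) Z(2)] by blast
  have "arrow Z k Z" using k(1) normalizer_iff[OF Z(1)] by (simp add: pg_group_simps)
  then show ?thesis using k(2) NG_conj[OF Z(1) _ H(2)[rule_format]] by (intro exI[of _ k]) auto
qed

text \<open>The element \<open>h\<close> is corrected by an element of \<open>N\<^sub>L(Z)\<close> that moves the image of \<open>H\<close> into the Sylow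
  subgroup \<open>N\<^sub>S(Z)\<close>.\<close>

lemma sylow_extend:
  assumes Z: "p_sylow p (NG Z) (NS Z)" and h: "arrow X h Z"
    and H: "pg_subgroup L H" "\<forall>m\<in>H. arrow X m X" "card H = p ^ n"
  shows "\<exists>g. arrow X g Z \<and> pconj L g ` H \<subseteq> NS Z \<and> H \<inter> S \<subseteq> S_of g"
proof -
  note I = conj_loops_subgroup[OF h H(1,2)]
  have ZD: "Z \<in> \<Delta>" using arrowD(2)[OF h] .
  obtain k where k: "arrow Z k Z" "pconj L k ` pconj L h ` H \<subseteq> NS Z"
    using sylow_conj_into_S[OF ZD Z I(1,2), of n] I(3) H(3) by auto
  have g: "arrow X (pmul h k) Z" using arrow_mul(2)[OF h k(1)] .
  have e: "pconj L (pmul h k) m = pconj L k (pconj L h m)" if "m \<in> H" for m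
    using conj_elt_mul[OF H(2)[rule_format, OF that] h h k(1) k(1)] .
  have "pconj L (pmul h k) ` H \<subseteq> NS Z" using k(2) e by auto
  moreover have "H \<inter> S \<subseteq> S_of (pmul h k)"
    using conj_elt(1)[OF H(2)[rule_format] g g] calculation NS_sub by (auto simp: S_of_def)
  ultimately show ?thesis using g by blast
qed

text \<open>Otherwise \<open>Q = N\<^sub>S(Z)\<close> is normal in a strictly larger \<open>p\<close>-subgroup \<open>R\<close> of \<open>N\<^sub>L(Z)\<close>. If \<open>Z = S\<close>, this
  contradicts the maximality of \<open>S\<close>. If not, \<open>Q\<close> is larger than \<open>Z\<close>, and by induction \<open>N\<^sub>L(Q')\<close> has
  Sylow subgroup \<open>N\<^sub>S(Q')\<close> for some conjugate \<open>Q'\<close> of \<open>Q\<close>. Then \<open>R\<close>, which normalizes \<open>Q\<close>, is conjugate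
  into \<open>S\<close>, and the corresponding conjugate of \<open>Z\<close> has a larger normalizer in \<open>S\<close>.\<close>

lemma fully_norm_sylow: "fully_norm Z \<Longrightarrow> p_sylow p (NG Z) (NS Z)"
proof (induction "card S - card Z" arbitrary: Z rule: less_induct)
  case less
  have Z: "Z \<in> \<Delta>" and mx: "\<And>g Q. arrow Z g Q \<Longrightarrow> card (NS Q) \<le> card (NS Z)"
    using less.prems by (auto simp: fully_norm_def)
  have ZS: "Z \<subseteq> S" using Delta_sub[OF Z] .
  interpret G: Group.group "NG Z" by (rule NG_group[OF Z])
  show ?case
  proof (rule ccontr)
    assume ns: "\<not> p_sylow p (NG Z) (NS Z)"
    have sub: "subgroup (NS Z) (NG Z)" using NG_subgroup_iff[OF Z] NS_subgroup[OF Z] by (auto simp: NS_def)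
    obtain n where n: "card (NS Z) = p ^ n" using sub_S_card[OF NS_subgroup[OF Z] NS_sub] by blast
    obtain R k where R: "subgroup R (NG Z)" "card R = p ^ k" "NS Z \<subset> R"
      "\<forall>r\<in>R. \<forall>h\<in>NS Z. inv\<^bsub>NG Z\<^esub> r \<otimes>\<^bsub>NG Z\<^esub> h \<otimes>\<^bsub>NG Z\<^esub> r \<in> NS Z"
      using G.nonsylow_extends[OF prime_p NG_finite[OF Z] sub n ns] by blast
    have R1: "pg_subgroup L R" "\<forall>m\<in>R. arrow Z m Z" using NG_subgroup_iff[OF Z] R(1) by auto
    have fR: "finite R" using finite_subset[OF subgroup_carrier[OF R1(1)] finite_L] .
    show False
    proof (cases "Z = S")
      case True
      then have "S \<subset> R" using NS_S R(3) by simp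
      moreover have "p_subgroup p L R" using R1 R(2) by (auto simp: p_subgroup_def)
      ultimately show False using S_maximal by blast
    next
      case False
      let ?Q = "NS Z"
      have Q: "?Q \<in> \<Delta>" "Z \<subset> ?Q" using NS_Delta[OF Z] NS_grows[OF Z False] by auto
      have RQ: "arrow ?Q r ?Q" if r: "r \<in> R" for r
      proof -
        have rZ: "arrow Z r Z" using R1(2) r by blast
        have c: "x \<in> conj_dom L r \<and> pconj L r x \<in> ?Q" if x: "x \<in> ?Q" for x
        proof -
          have xZ: "arrow Z x Z" using x by (simp add: NS_def)
          show ?thesis using conj_elt(1)[OF xZ rZ rZ] NG_conj[OF Z rZ xZ] R(4)[rule_format, OF r x] by simp
        qed
        then have "?Q \<subseteq> S_of r" using NS_sub by (auto simp: S_of_def)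
        then have a: "arrow ?Q r (pconj L r ` ?Q)" using arrowI[OF arrowD(3)[OF rZ] Q(1)] by blast
        have "pconj L r ` ?Q = ?Q"
          by (rule card_subset_eq[OF finite_NS]) (use c arrow_card[OF a] in auto)
        then show ?thesis using a by simp
      qed
      obtain h Q' where h: "arrow ?Q h Q'" "fully_norm Q'" using fully_norm_ex[OF Q(1)] by blast
      have "card Z < card Q'" using arrow_card[OF h(1)] psubset_card_mono[OF finite_NS Q(2)] by simp
      moreover have "card Q' \<le> card S" using card_mono[OF finite_S arrowD(7)[OF h(1)]] .
      ultimately have "p_sylow p (NG Q') (NS Q')" using less.hyps[OF _ h(2)] by simp
      then obtain g where g: "arrow ?Q g Q'" "pconj L g ` R \<subseteq> NS Q'"
        using sylow_extend[OF _ h(1) R1(1) _ R(2)] RQ by blast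
      let ?Z = "pconj L g ` Z"
      have gZ: "arrow Z g ?Z" using arrow_restrict[OF g(1) Z] Q(2) by blast
      note I = conj_loops_subgroup[OF gZ R1]
      have "pconj L g ` R \<subseteq> NS ?Z" using I(2) g(2) NS_sub by (auto simp: NS_def)
      then have "card R \<le> card (NS ?Z)" using I(3) card_mono[OF finite_NS] by metis
      also have "\<dots> \<le> card (NS Z)" using mx[OF gZ] .
      finally show False using psubset_card_mono[OF fR R(3)] by simp
    qed
  qed
qed

lemma fully_norm_extend:
  assumes Z: "fully_norm Z" and h: "arrow X h Z"
  shows "\<exists>g. arrow X g Z \<and> NS X \<subseteq> S_of g \<and> pconj L g ` NS X \<subseteq> NS Z"
proof -
  have X: "X \<in> \<Delta>" using arrowD(1)[OF h] .
  obtain n where n: "card (NS X) = p ^ n" using sub_S_card[OF NS_subgroup[OF X] NS_sub] by blast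
  have "\<forall>m\<in>NS X. arrow X m X" by (simp add: NS_def)
  then obtain g where "arrow X g Z" "pconj L g ` NS X \<subseteq> NS Z" "NS X \<inter> S \<subseteq> S_of g"
    using sylow_extend[OF fully_norm_sylow[OF Z] h NS_subgroup[OF X] _ n] by blast
  then show ?thesis using NS_sub by blast
qed

end

section \<open>The fusion system of a locality\<close>

lemma (in group) normalizing_set_mult:
  assumes A: "subgroup A G" and B: "subgroup B G" and n: "\<And>a b. a \<in> A \<Longrightarrow> b \<in> B \<Longrightarrow> inv b \<otimes> a \<otimes> b \<in> A"
  shows "subgroup (A <#> B) G" "B <#> A = A <#> B"
proof -
  have AG: "a \<in> carrier G" if "a \<in> A" for a using subgroup.mem_carrier[OF A that] .
  have BG: "b \<in> carrier G" if "b \<in> B" for b using subgroup.mem_carrier[OF B that] .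
  have n': "b \<otimes> a \<otimes> inv b \<in> A" if "a \<in> A" "b \<in> B" for a b
    using n[OF that(1) subgroup.m_inv_closed[OF B that(2)]] BG[OF that(2)] by simp
  show "subgroup (A <#> B) G"
  proof (rule subgroupI)
    show "A <#> B \<subseteq> carrier G" using AG BG by (auto simp: set_mult_def)
    show "A <#> B \<noteq> {}" using subgroup.one_closed[OF A] subgroup.one_closed[OF B] by (auto simp: set_mult_def)
    show "inv x \<in> A <#> B" if x: "x \<in> A <#> B" for x
    proof -
      obtain a b where ab: "a \<in> A" "b \<in> B" "x = a \<otimes> b" using x by (auto simp: set_mult_def)
      have "inv x = (inv b \<otimes> inv a \<otimes> b) \<otimes> inv b" using ab AG BG by (simp add: inv_mult_group m_assoc)
      moreover have "inv b \<otimes> inv a \<otimes> b \<in> A" "inv b \<in> B"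
        using n ab subgroup.m_inv_closed[OF A] subgroup.m_inv_closed[OF B] by auto
      ultimately show ?thesis by (auto simp: set_mult_def)
    qed
    show "x \<otimes> y \<in> A <#> B" if x: "x \<in> A <#> B" and y: "y \<in> A <#> B" for x y
    proof -
      obtain a b where ab: "a \<in> A" "b \<in> B" "x = a \<otimes> b" using x by (auto simp: set_mult_def)
      obtain c d where cd: "c \<in> A" "d \<in> B" "y = c \<otimes> d" using y by (auto simp: set_mult_def)
      have "x \<otimes> y = (a \<otimes> (b \<otimes> c \<otimes> inv b)) \<otimes> (b \<otimes> d)"
        using ab cd AG BG by (simp add: m_assoc) (simp add: m_assoc[symmetric])
      moreover have "a \<otimes> (b \<otimes> c \<otimes> inv b) \<in> A" using subgroup.m_closed[OF A ab(1) n'[OF cd(1) ab(2)]] .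
      moreover have "b \<otimes> d \<in> B" using subgroup.m_closed[OF B ab(2) cd(2)] .
      ultimately show ?thesis unfolding set_mult_def by blast
    qed
  qed
  show "B <#> A = A <#> B"
  proof
    show "B <#> A \<subseteq> A <#> B"
    proof
      fix x assume "x \<in> B <#> A"
      then obtain a b where ab: "a \<in> A" "b \<in> B" "x = b \<otimes> a" by (auto simp: set_mult_def)
      have "x = (b \<otimes> a \<otimes> inv b) \<otimes> b" using ab AG BG by (simp add: m_assoc)
      then show "x \<in> A <#> B" using n'[OF ab(1,2)] ab(2) by (auto simp: set_mult_def)
    qed
    show "A <#> B \<subseteq> B <#> A"
    proof
      fix x assume "x \<in> A <#> B"
      then obtain a b where ab: "a \<in> A" "b \<in> B" "x = a \<otimes> b" by (auto simp: set_mult_def)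
      have "x = b \<otimes> (inv b \<otimes> a \<otimes> b)" using ab AG BG by (simp add: m_assoc[symmetric])
      then show "x \<in> B <#> A" using n[OF ab(1,2)] ab(2) by (auto simp: set_mult_def)
    qed
  qed
qed

lemma (in group) set_mult_contains:
  assumes "subgroup A G" "subgroup B G" shows "A \<subseteq> A <#> B" "B \<subseteq> A <#> B"
proof -
  have "a \<in> A <#> B" if "a \<in> A" for a
    using that subgroup.one_closed[OF assms(2)] r_one[OF subgroup.mem_carrier[OF assms(1) that]]
    unfolding set_mult_def by force
  then show "A \<subseteq> A <#> B" by blast
  have "b \<in> A <#> B" if "b \<in> B" for b
    using that subgroup.one_closed[OF assms(1)] l_one[OF subgroup.mem_carrier[OF assms(2) that]]
    unfolding set_mult_def by force
  then show "B \<subseteq> A <#> B" by blast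
qed

context locality_context
begin

abbreviation SG :: "'a monoid" where "SG \<equiv> pg_group L S"

lemma SG_group: "Group.group SG" by (rule pg_group_group[OF S_subgroup])

lemma SG_sub_iff: "subgroup P SG \<longleftrightarrow> pg_subgroup L P \<and> P \<subseteq> S"
  by (rule subgroup_pg_group_iff[OF S_subgroup])

definition realized :: "('a \<Rightarrow> 'a) \<Rightarrow> 'a set \<Rightarrow> bool" where
  "realized \<phi> X \<longleftrightarrow> (\<exists>g. arrow X g (\<phi> ` X) \<and> (\<forall>x\<in>X. \<phi> x = pconj L g x))"

text \<open>A fusion system that contains the generators of the fusion system of \<open>L\<close> and in which every
  morphism is conjugation by one element on objects. The condition is also imposed where only
  the image is an object; this makes it symmetric, as is required for inverses.\<close>

definition realized_fusion :: "'a fusion" where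
  "realized_fusion = \<lparr>fgroup = SG, fhom = (\<lambda>P Q. {\<phi>. subgroup P SG \<and> subgroup Q SG \<and>
     \<phi> \<in> hom (SG\<lparr>carrier := P\<rparr>) (SG\<lparr>carrier := Q\<rparr>) \<and> inj_on \<phi> P \<and> \<phi> \<in> extensional P \<and>
     (\<forall>X \<subseteq> P. X \<in> \<Delta> \<or> \<phi> ` X \<in> \<Delta> \<longrightarrow> realized \<phi> X)})\<rparr>"

lemma realized_Delta: "realized \<phi> X \<Longrightarrow> X \<in> \<Delta> \<and> \<phi> ` X \<in> \<Delta>"
  using arrowD(1,2) unfolding realized_def by blast

lemma realized_cong: "(\<And>x. x \<in> X \<Longrightarrow> \<phi> x = \<psi> x) \<Longrightarrow> realized \<phi> X \<longleftrightarrow> realized \<psi> X"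
  unfolding realized_def by (metis (no_types, lifting) image_cong)

lemma realized_conj:
  assumes g: "g \<in> pcarrier L" and X: "X \<subseteq> S_of g" and D: "X \<in> \<Delta> \<or> pconj L g ` X \<in> \<Delta>"
  shows "realized (pconj L g) X"
proof (cases "X \<in> \<Delta>")
  case True then show ?thesis using arrowI[OF g _ X] unfolding realized_def by blast
next
  case False
  let ?Y = "pconj L g ` X"
  have Y: "?Y \<in> \<Delta>" using D False by blast
  have "?Y \<subseteq> S_of (pinv L g)" unfolding S_of_inv_image[OF g] using X by blast
  then have a: "arrow ?Y (pinv L g) (pconj L (pinv L g) ` ?Y)" using arrowI[OF inv_closed[OF g] Y] by blast
  have "pconj L (pinv L g) (pconj L g x) = x" if "x \<in> X" for x
    using conj_undo(2)[OF _ g] X that by (auto simp: S_of_def)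
  then have "pconj L (pinv L g) ` ?Y = X" by (simp add: image_image)
  then have "X \<in> \<Delta>" using arrowD(2)[OF a] by simp
  then show ?thesis using False by blast
qed

lemma realized_comp:
  assumes "realized \<phi> X" "realized \<psi> (\<phi> ` X)" shows "realized (\<psi> \<circ> \<phi>) X"
proof -
  obtain g where g: "arrow X g (\<phi> ` X)" "\<forall>x\<in>X. \<phi> x = pconj L g x" using assms(1) by (auto simp: realized_def)
  obtain h where h: "arrow (\<phi> ` X) h (\<psi> ` \<phi> ` X)" "\<forall>x\<in>\<phi> ` X. \<psi> x = pconj L h x"
    using assms(2) unfolding realized_def by blast
  have "arrow X (pmul g h) ((\<psi> \<circ> \<phi>) ` X)" using arrow_mul(2)[OF g(1) h(1)] by (simp add: image_comp)
  moreover have "\<forall>x\<in>X. (\<psi> \<circ> \<phi>) x = pconj L (pmul g h) x" using arrow_mul(3)[OF g(1) h(1)] g(2) h(2) by simp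
  ultimately show ?thesis unfolding realized_def by blast
qed

lemma realized_inv:
  assumes X: "X \<subseteq> P" and r: "realized \<phi> X" and i: "inj_on \<phi> P"
  shows "realized (inv_into P \<phi>) (\<phi> ` X)"
proof -
  obtain g where g: "arrow X g (\<phi> ` X)" "\<forall>x\<in>X. \<phi> x = pconj L g x" using r by (auto simp: realized_def)
  have e: "inv_into P \<phi> (\<phi> x) = x" if "x \<in> X" for x using inv_into_f_f[OF i] X that by blast
  then have "inv_into P \<phi> ` \<phi> ` X = X" by (simp add: image_image)
  moreover have "inv_into P \<phi> (\<phi> x) = pconj L (pinv L g) (\<phi> x)" if "x \<in> X" for x
    using e[OF that] g(2) that conj_undo(2)[OF _ arrowD(3)[OF g(1)]] arrowD(4)[OF g(1)] by auto
  ultimately show ?thesis using arrow_inv[OF g(1)] unfolding realized_def by auto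
qed

lemma realized_fusion_system: "fusion_system realized_fusion"
proof (rule fusion_system.intro)
  interpret SG: Group.group SG by (rule SG_group)
  show "Group.group (fgroup realized_fusion)" using SG_group by (simp add: realized_fusion_def)
  show "subgroup P (fgroup realized_fusion) \<and> subgroup Q (fgroup realized_fusion) \<and>
      \<phi> \<in> hom ((fgroup realized_fusion)\<lparr>carrier := P\<rparr>) ((fgroup realized_fusion)\<lparr>carrier := Q\<rparr>) \<and>
      inj_on \<phi> P \<and> \<phi> \<in> extensional P" if "\<phi> \<in> fhom realized_fusion P Q" for \<phi> P Q
    using that by (simp add: realized_fusion_def)
next
  fix \<phi> \<psi> P Q R assume "\<phi> \<in> fhom realized_fusion P Q" "\<psi> \<in> fhom realized_fusion Q R"
  then have s: "subgroup P SG" "subgroup Q SG" "subgroup R SG"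
    and f: "\<phi> \<in> hom (SG\<lparr>carrier := P\<rparr>) (SG\<lparr>carrier := Q\<rparr>)" "inj_on \<phi> P"
       "\<And>X. X \<subseteq> P \<Longrightarrow> X \<in> \<Delta> \<or> \<phi> ` X \<in> \<Delta> \<Longrightarrow> realized \<phi> X"
    and h: "\<psi> \<in> hom (SG\<lparr>carrier := Q\<rparr>) (SG\<lparr>carrier := R\<rparr>)" "inj_on \<psi> Q"
       "\<And>X. X \<subseteq> Q \<Longrightarrow> X \<in> \<Delta> \<or> \<psi> ` X \<in> \<Delta> \<Longrightarrow> realized \<psi> X"
    by (auto simp: realized_fusion_def)
  have PQ: "\<phi> x \<in> Q" if "x \<in> P" for x using f(1) that by (auto simp: hom_def Pi_def)
  have QR: "\<psi> x \<in> R" if "x \<in> Q" for x using h(1) that by (auto simp: hom_def Pi_def)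
  have ho: "compose P \<psi> \<phi> \<in> hom (SG\<lparr>carrier := P\<rparr>) (SG\<lparr>carrier := R\<rparr>)"
    using f(1) h(1) PQ QR subgroup.m_closed[OF s(1)] by (auto simp: hom_def Pi_def compose_def)
  have inj: "inj_on (compose P \<psi> \<phi>) P"
    using f(2) h(2) PQ by (auto simp: inj_on_def compose_def)
  have re: "realized (compose P \<psi> \<phi>) X" if X: "X \<subseteq> P" "X \<in> \<Delta> \<or> compose P \<psi> \<phi> ` X \<in> \<Delta>" for X
  proof -
    have e: "compose P \<psi> \<phi> x = (\<psi> \<circ> \<phi>) x" if "x \<in> X" for x using that X by (auto simp: compose_def)
    have XQ: "\<phi> ` X \<subseteq> Q" using X PQ by blast
    have ie: "compose P \<psi> \<phi> ` X = \<psi> ` \<phi> ` X" using e by (simp add: image_image)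
    have "realized \<phi> X \<and> realized \<psi> (\<phi> ` X)"
      using X(2) f(3)[OF X(1)] h(3)[OF XQ] realized_Delta ie by metis
    then show ?thesis using realized_comp realized_cong[of X "compose P \<psi> \<phi>" "\<psi> \<circ> \<phi>"] e by blast
  qed
  show "compose P \<psi> \<phi> \<in> fhom realized_fusion P R"
    using s ho inj re by (simp add: realized_fusion_def)
next
  interpret SG: Group.group SG by (rule SG_group)
  fix P Q g
  let ?c = "\<lambda>x. inv\<^bsub>fgroup realized_fusion\<^esub> g \<otimes>\<^bsub>fgroup realized_fusion\<^esub> x \<otimes>\<^bsub>fgroup realized_fusion\<^esub> g"
  assume "subgroup P (fgroup realized_fusion)" "subgroup Q (fgroup realized_fusion)"
    "g \<in> carrier (fgroup realized_fusion)" and PQ: "?c ` P \<subseteq> Q"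
  then have s: "subgroup P SG" "subgroup Q SG" and gS: "g \<in> S"
    by (simp_all add: realized_fusion_def pg_group_simps)
  have fg: "fgroup realized_fusion = SG" by (simp add: realized_fusion_def)
  have c: "?c = (\<lambda>x. inv\<^bsub>SG\<^esub> g \<otimes>\<^bsub>SG\<^esub> x \<otimes>\<^bsub>SG\<^esub> g)" by (simp add: realized_fusion_def)
  have PS: "P \<subseteq> S" using s(1) SG_sub_iff by blast
  have ce: "?c x = pconj L g x" if "x \<in> S" for x unfolding fg using subgroup_conj(3)[OF S_subgroup gS that] by simp
  have gL: "g \<in> pcarrier L" using gS S_carrier by blast
  have m: "?c (x \<otimes>\<^bsub>SG\<^esub> y) = ?c x \<otimes>\<^bsub>SG\<^esub> ?c y" if "x \<in> P" "y \<in> P" for x y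
    unfolding fg using SG.conj_mult[of x y g] that PS gS by (simp add: pg_group_simps subset_iff)
  have ho: "restrict ?c P \<in> hom (SG\<lparr>carrier := P\<rparr>) (SG\<lparr>carrier := Q\<rparr>)"
    using PQ m subgroup.m_closed[OF s(1)] by (auto simp: hom_def)
  have ci: "inj_on (pconj L g) S" using conj_inj[OF S_arrow[OF gS S_Delta]] .
  have inj: "inj_on (restrict ?c P) P" using ci ce PS by (simp add: inj_on_def subset_iff)
  have re: "realized (restrict ?c P) X" if X: "X \<subseteq> P" "X \<in> \<Delta> \<or> restrict ?c P ` X \<in> \<Delta>" for X
  proof -
    have e: "restrict ?c P x = pconj L g x" if "x \<in> X" for x using that X PS ce by auto
    then have "restrict ?c P ` X = pconj L g ` X" by (rule image_cong[OF refl])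
    moreover have "X \<subseteq> S_of g" using X(1) PS S_of_S[OF gS] by blast
    ultimately have "realized (pconj L g) X" using realized_conj[OF gL] X(2) by simp
    then show ?thesis using realized_cong[of X "restrict ?c P"] e by blast
  qed
  show "restrict ?c P \<in> fhom realized_fusion P Q"
    using s ho inj re restrict_extensional[of ?c P] unfolding realized_fusion_def by simp
next
  interpret SG: Group.group SG by (rule SG_group)
  fix \<phi> P Q assume "\<phi> \<in> fhom realized_fusion P Q"
  then have s: "subgroup P SG" "subgroup Q SG"
    and f: "\<phi> \<in> hom (SG\<lparr>carrier := P\<rparr>) (SG\<lparr>carrier := Q\<rparr>)" "inj_on \<phi> P" "\<phi> \<in> extensional P"
       "\<And>X. X \<subseteq> P \<Longrightarrow> X \<in> \<Delta> \<or> \<phi> ` X \<in> \<Delta> \<Longrightarrow> realized \<phi> X"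
    by (auto simp: realized_fusion_def)
  have PQ: "\<phi> x \<in> Q" if "x \<in> P" for x using f(1) that by (auto simp: hom_def Pi_def)
  have m: "\<phi> (x \<otimes>\<^bsub>SG\<^esub> y) = \<phi> x \<otimes>\<^bsub>SG\<^esub> \<phi> y" if "x \<in> P" "y \<in> P" for x y
    using f(1) that by (auto simp: hom_def)
  have si: "subgroup (\<phi> ` P) SG"
  proof -
    have "group_hom (SG\<lparr>carrier := P\<rparr>) SG \<phi>"
      using SG.subgroup_imp_group[OF s(1)] SG_group PQ m subgroup.mem_carrier[OF s(2)]
      by (auto simp: group_hom_def group_hom_axioms_def hom_def)
    then show ?thesis using group_hom.img_is_subgroup by fastforce
  qed
  show "\<phi> \<in> fhom realized_fusion P (\<phi> ` P) \<and>
     restrict (inv_into P \<phi>) (\<phi> ` P) \<in> fhom realized_fusion (\<phi> ` P) P"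
  proof
    have "\<phi> \<in> hom (SG\<lparr>carrier := P\<rparr>) (SG\<lparr>carrier := \<phi> ` P\<rparr>)" using m by (auto simp: hom_def)
    then show "\<phi> \<in> fhom realized_fusion P (\<phi> ` P)" using s si f by (simp add: realized_fusion_def)
    let ?i = "restrict (inv_into P \<phi>) (\<phi> ` P)"
    have iv: "inv_into P \<phi> (\<phi> x) = x" if "x \<in> P" for x using inv_into_f_f[OF f(2) that] .
    have "?i \<in> hom (SG\<lparr>carrier := \<phi> ` P\<rparr>) (SG\<lparr>carrier := P\<rparr>)"
    proof (rule homI)
      show "?i x \<in> carrier (SG\<lparr>carrier := P\<rparr>)" if "x \<in> carrier (SG\<lparr>carrier := \<phi> ` P\<rparr>)" for x
        using that iv by auto
      fix x y assume "x \<in> carrier (SG\<lparr>carrier := \<phi> ` P\<rparr>)" "y \<in> carrier (SG\<lparr>carrier := \<phi> ` P\<rparr>)"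
      then obtain a b where ab: "a \<in> P" "b \<in> P" "x = \<phi> a" "y = \<phi> b" by auto
      have "x \<otimes>\<^bsub>SG\<^esub> y = \<phi> (a \<otimes>\<^bsub>SG\<^esub> b)" using m ab by simp
      moreover have "a \<otimes>\<^bsub>SG\<^esub> b \<in> P" using subgroup.m_closed[OF s(1)] ab by blast
      ultimately show "?i (x \<otimes>\<^bsub>SG\<lparr>carrier := \<phi> ` P\<rparr>\<^esub> y) = ?i x \<otimes>\<^bsub>SG\<lparr>carrier := P\<rparr>\<^esub> ?i y"
        using iv ab by simp
    qed
    moreover have "inj_on ?i (\<phi> ` P)" using iv by (auto simp: inj_on_def)
    moreover have "realized ?i X" if X: "X \<subseteq> \<phi> ` P" "X \<in> \<Delta> \<or> ?i ` X \<in> \<Delta>" for X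
    proof -
      have e: "?i x = inv_into P \<phi> x" if "x \<in> X" for x using that X by auto
      let ?Y = "inv_into P \<phi> ` X"
      have Y: "?Y \<subseteq> P" using X(1) iv by auto
      have YX: "\<phi> ` ?Y = X" using X(1) f_inv_into_f[of _ \<phi> P] by (force simp: image_image)
      have "?i ` X = ?Y" using e by (rule image_cong[OF refl])
      then have "realized \<phi> ?Y" using f(4)[OF Y] YX X(2) by metis
      then have "realized (inv_into P \<phi>) X" using realized_inv[OF Y _ f(2)] YX by simp
      then show ?thesis using realized_cong[of X ?i] e by blast
    qed
    ultimately show "?i \<in> fhom realized_fusion (\<phi> ` P) P"
      using s si restrict_extensional[of "inv_into P \<phi>" "\<phi> ` P"] by (simp add: realized_fusion_def)
  qed
qed

lemma realized_generators:
  assumes g: "g \<in> pcarrier L"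
  shows "restrict (pconj L g) (S_of g) \<in> fhom realized_fusion (S_of g) S"
proof -
  have s: "subgroup (S_of g) SG" "subgroup S SG" using SG_sub_iff S_of_subgroup[OF g] S_of_sub S_subgroup by auto
  have "restrict (pconj L g) (S_of g) \<in> hom (SG\<lparr>carrier := S_of g\<rparr>) (SG\<lparr>carrier := S\<rparr>)"
    using S_of_mul[OF g] S_of_sub by (auto simp: hom_def S_of_def pg_group_simps)
  moreover have "inj_on (restrict (pconj L g) (S_of g)) (S_of g)"
    using conj_inj[OF S_of_arrow[OF g]] by (simp add: inj_on_def)
  moreover have "realized (restrict (pconj L g) (S_of g)) X"
    if X: "X \<subseteq> S_of g" "X \<in> \<Delta> \<or> restrict (pconj L g) (S_of g) ` X \<in> \<Delta>" for X
  proof -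
    have e: "restrict (pconj L g) (S_of g) x = pconj L g x" if "x \<in> X" for x using that X by auto
    then have "restrict (pconj L g) (S_of g) ` X = pconj L g ` X" by (rule image_cong[OF refl])
    then have "realized (pconj L g) X" using realized_conj[OF g X(1)] X(2) by simp
    then show ?thesis using realized_cong[of X "restrict (pconj L g) (S_of g)"] e by blast
  qed
  ultimately show ?thesis using s restrict_extensional[of "pconj L g" "S_of g"] by (simp add: realized_fusion_def)
qed

lemma fgroup_locality_fusion: "fgroup (locality_fusion L S) = SG"
  by (simp add: locality_fusion_def generated_fusion_def)

lemma locality_fusion_realized:
  assumes f: "\<phi> \<in> fhom (locality_fusion L S) P Q"
  shows "\<phi> \<in> fhom realized_fusion P Q"
proof -
  have "\<forall>(A, B, \<chi>) \<in> {(word_stab L S [g], S, restrict (pconj L g) (word_stab L S [g])) | g. g \<in> pcarrier L}.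
     \<chi> \<in> fhom realized_fusion A B"
    using realized_generators by (auto simp: S_of_word_stab)
  moreover have "fgroup realized_fusion = SG" by (simp add: realized_fusion_def)
  ultimately show ?thesis using f realized_fusion_system
    by (simp add: locality_fusion_def generated_fusion_def)
qed

text \<open>The maps that are conjugations on objects form a fusion system that contains the generators of
  \<open>\<F>\<close>, and hence \<open>\<F>\<close>.\<close>

lemma fusion_object:
  assumes f: "\<phi> \<in> fhom (locality_fusion L S) P Q" and P: "P \<in> \<Delta>"
  shows "\<exists>g. arrow P g (\<phi> ` P) \<and> \<phi> ` P \<subseteq> Q \<and> \<phi> = restrict (pconj L g) P"
proof -
  have r: "\<phi> \<in> fhom realized_fusion P Q" using locality_fusion_realized[OF f] .
  then have "realized \<phi> P" and e: "\<phi> \<in> extensional P" and h: "\<phi> ` P \<subseteq> Q"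
    using P by (auto simp: realized_fusion_def hom_def)
  then obtain g where "arrow P g (\<phi> ` P)" "\<forall>x\<in>P. \<phi> x = pconj L g x" by (auto simp: realized_def)
  moreover have "\<phi> = restrict (pconj L g) P"
    using e calculation(2) by (intro extensionalityI[of \<phi> P]) auto
  ultimately show ?thesis using h by blast
qed

lemma conj_in_fusion:
  assumes a: "arrow P g P'" and Q: "P' \<subseteq> Q" "pg_subgroup L Q" "Q \<subseteq> S"
  shows "restrict (pconj L g) P \<in> fhom (locality_fusion L S) P Q"
proof -
  note D = arrowD[OF a]
  have "restrict (pconj L g) P \<in> fhom E P Q"
    if E: "fusion_system E" "fgroup E = SG"
      "\<forall>(A, B, \<chi>) \<in> {(word_stab L S [g], S, restrict (pconj L g) (word_stab L S [g])) | g. g \<in> pcarrier L}.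
         \<chi> \<in> fhom E A B" for E
  proof -
    interpret E: fusion_system E by fact
    interpret SG: Group.group SG by (rule SG_group)
    have gen: "restrict (pconj L g) (S_of g) \<in> fhom E (S_of g) S" using E(3) D(3) S_of_word_stab by auto
    have incl: "(\<lambda>x\<in>A. x) \<in> fhom E A B" if AB: "subgroup A SG" "subgroup B SG" "A \<subseteq> B" for A B
    proof -
      have e: "inv\<^bsub>SG\<^esub> \<one>\<^bsub>SG\<^esub> \<otimes>\<^bsub>SG\<^esub> x \<otimes>\<^bsub>SG\<^esub> \<one>\<^bsub>SG\<^esub> = x" if "x \<in> A" for x
        using subgroup.mem_carrier[OF AB(1) that] by simp
      have "(\<lambda>x\<in>A. inv\<^bsub>SG\<^esub> \<one>\<^bsub>SG\<^esub> \<otimes>\<^bsub>SG\<^esub> x \<otimes>\<^bsub>SG\<^esub> \<one>\<^bsub>SG\<^esub>) \<in> fhom E A B"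
        using E.conjugation[of A B "\<one>\<^bsub>SG\<^esub>"] AB e E(2) by (auto simp: subset_iff)
      moreover have "(\<lambda>x\<in>A. inv\<^bsub>SG\<^esub> \<one>\<^bsub>SG\<^esub> \<otimes>\<^bsub>SG\<^esub> x \<otimes>\<^bsub>SG\<^esub> \<one>\<^bsub>SG\<^esub>) = (\<lambda>x\<in>A. x)"
        by (rule restrict_ext) (use e in simp)
      ultimately show ?thesis by simp
    qed
    have s: "subgroup P SG" "subgroup (S_of g) SG" "subgroup P' SG" "subgroup Q SG"
      using SG_sub_iff D S_of_subgroup[OF D(3)] S_of_sub Q by auto
    have "compose P (restrict (pconj L g) (S_of g)) (\<lambda>x\<in>P. x) \<in> fhom E P S"
      using E.composition[OF incl[OF s(1,2) arrow_S_of[OF a]] gen] .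
    moreover have "compose P (restrict (pconj L g) (S_of g)) (\<lambda>x\<in>P. x) = restrict (pconj L g) P"
      using arrow_S_of[OF a] by (auto simp: compose_def fun_eq_iff)
    ultimately have "restrict (pconj L g) P \<in> fhom E P (restrict (pconj L g) P ` P)"
      using E.isomorphism by metis
    then have 1: "restrict (pconj L g) P \<in> fhom E P P'" using D(5) by simp
    have "compose P (\<lambda>x\<in>P'. x) (restrict (pconj L g) P) \<in> fhom E P Q"
      using E.composition[OF 1 incl[OF s(3,4) Q(1)]] .
    moreover have "compose P (\<lambda>x\<in>P'. x) (restrict (pconj L g) P) = restrict (pconj L g) P"
      using D(5) by (auto simp: compose_def fun_eq_iff)
    ultimately show ?thesis by simp
  qed
  then show ?thesis by (simp add: locality_fusion_def generated_fusion_def)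
qed

lemma fconjugates_iff:
  assumes "P \<in> \<Delta>" shows "Q \<in> fconjugates (locality_fusion L S) P \<longleftrightarrow> (\<exists>g. arrow P g Q)"
proof
  assume "Q \<in> fconjugates (locality_fusion L S) P"
  then show "\<exists>g. arrow P g Q" using fusion_object[OF _ assms] by (fastforce simp: fconjugates_def)
next
  assume "\<exists>g. arrow P g Q"
  then obtain g where g: "arrow P g Q" by blast
  have "restrict (pconj L g) P \<in> fhom (locality_fusion L S) P Q"
    using conj_in_fusion[OF g order_refl arrowD(9)[OF g] arrowD(7)[OF g]] .
  moreover have "Q = restrict (pconj L g) P ` P" using arrowD(5)[OF g] by simp
  ultimately show "Q \<in> fconjugates (locality_fusion L S) P" unfolding fconjugates_def by blast
qed

lemma normalizer_SG: assumes P: "P \<in> \<Delta>" shows "normalizer SG P = NS P"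
proof -
  interpret SG: Group.group SG by (rule SG_group)
  have PS: "P \<subseteq> S" using Delta_sub[OF P] .
  have "(g <#\<^bsub>SG\<^esub> P #>\<^bsub>SG\<^esub> inv\<^bsub>SG\<^esub> g = P) \<longleftrightarrow> arrow P g P" if g: "g \<in> S" for g
  proof -
    have gi: "pinv L g \<in> S" using mul_inv_S[OF g] .
    have gL: "g \<in> pcarrier L" using S_carrier[OF g] .
    have "pconj L (pinv L g) x = g \<otimes>\<^bsub>SG\<^esub> x \<otimes>\<^bsub>SG\<^esub> inv\<^bsub>SG\<^esub> g" if "x \<in> P" for x
      using subgroup_conj(3)[OF S_subgroup gi, of x] PS that pg_group_inv[OF S_subgroup] g gi
        SG.inv_inv[of g] by (auto simp: pg_group_simps inv_inv[OF gL])
    then have "g <#\<^bsub>SG\<^esub> P #>\<^bsub>SG\<^esub> inv\<^bsub>SG\<^esub> g = pconj L (pinv L g) ` P"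
      by (auto simp: l_coset_def r_coset_def)
    moreover have "pconj L (pinv L g) ` P = P \<longleftrightarrow> arrow P (pinv L g) P"
      using S_arrow[OF gi P] arrowD(5) by metis
    moreover have "arrow P (pinv L g) P \<longleftrightarrow> arrow P g P" using arrow_inv inv_inv[OF gL] by metis
    ultimately show ?thesis by simp
  qed
  then show ?thesis using PS
    by (auto simp: normalizer_def stabilizer_def NS_def pg_group_simps)
qed

section \<open>Centric radical objects\<close>

abbreviation Fu :: "'a fusion" where "Fu \<equiv> locality_fusion L S"

lemma NS_SG: assumes "P \<in> \<Delta>" shows "subgroup (NS P) SG"
  using SG_sub_iff NS_subgroup[OF assms] NS_sub by blast

lemma sub_NS_iff:
  assumes R: "R \<in> \<Delta>"
  shows "subgroup P (SG\<lparr>carrier := NS R\<rparr>) \<longleftrightarrow> pg_subgroup L P \<and> P \<subseteq> NS R"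
proof -
  interpret SG: Group.group SG by (rule SG_group)
  have "subgroup P (SG\<lparr>carrier := NS R\<rparr>) \<longleftrightarrow> subgroup P SG \<and> P \<subseteq> NS R"
    using SG.subgroup_incl[OF _ NS_SG[OF R], of P] SG.incl_subgroup[OF NS_SG[OF R], of P]
      subgroup.subset[of P "SG\<lparr>carrier := NS R\<rparr>"] by auto
  then show ?thesis using SG_sub_iff NS_sub by blast
qed

lemma normalizing_product:
  assumes R: "R \<in> \<Delta>" and P: "pg_subgroup L P" "P \<subseteq> NS R"
  shows "R <#>\<^bsub>SG\<^esub> P \<in> \<Delta>" "P <#>\<^bsub>SG\<^esub> R = R <#>\<^bsub>SG\<^esub> P" "R \<subseteq> R <#>\<^bsub>SG\<^esub> P" "P \<subseteq> R <#>\<^bsub>SG\<^esub> P"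
    "R <#>\<^bsub>SG\<^esub> P \<subseteq> NS R"
    "\<And>Y. pg_subgroup L Y \<Longrightarrow> R \<subseteq> Y \<Longrightarrow> P \<subseteq> Y \<Longrightarrow> R <#>\<^bsub>SG\<^esub> P \<subseteq> Y"
proof -
  interpret SG: Group.group SG by (rule SG_group)
  have s: "subgroup R SG" "subgroup P SG"
    using SG_sub_iff Delta_subgroup[OF R] Delta_sub[OF R] P subset_trans[OF P(2) NS_sub] by auto
  have n: "inv\<^bsub>SG\<^esub> b \<otimes>\<^bsub>SG\<^esub> a \<otimes>\<^bsub>SG\<^esub> b \<in> R" if "a \<in> R" "b \<in> P" for a b
  proof -
    have b: "b \<in> S" "arrow R b R" using that P by (auto simp: NS_def)
    have "pconj L b a \<in> R" using arrowD(5)[OF b(2)] that by blast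
    then show ?thesis using subgroup_conj(3)[OF S_subgroup b(1), of a] that Delta_sub[OF R] by auto
  qed
  note N = SG.normalizing_set_mult[OF s n]
  show e: "P <#>\<^bsub>SG\<^esub> R = R <#>\<^bsub>SG\<^esub> P" using N(2) .
  show c: "R \<subseteq> R <#>\<^bsub>SG\<^esub> P" "P \<subseteq> R <#>\<^bsub>SG\<^esub> P" using SG.set_mult_contains[OF s] by auto
  show "R <#>\<^bsub>SG\<^esub> P \<in> \<Delta>" using Delta_over[OF R c(1)] N(1) SG_sub_iff by blast
  show min: "R <#>\<^bsub>SG\<^esub> P \<subseteq> Y" if Y: "pg_subgroup L Y" "R \<subseteq> Y" "P \<subseteq> Y" for Y
    using subgroup_mul[OF Y(1)] Y(2,3) s subgroup.subset[OF s(1)] subgroup.subset[OF s(2)]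
    by (auto simp: set_mult_def pg_group_simps subset_iff)
  show "R <#>\<^bsub>SG\<^esub> P \<subseteq> NS R" using min[OF NS_subgroup[OF R] NS_self[OF R] P(2)] .
qed

lemma fnormalizer_mem:
  assumes R: "R \<in> \<Delta>"
  shows "\<psi> \<in> fhom (fnormalizer Fu R) P Q \<longleftrightarrow>
    (\<exists>\<phi>. \<psi> = restrict \<phi> P \<and> subgroup P (SG\<lparr>carrier := NS R\<rparr>) \<and> subgroup Q (SG\<lparr>carrier := NS R\<rparr>) \<and>
      \<phi> \<in> fhom Fu (P <#>\<^bsub>SG\<^esub> R) (Q <#>\<^bsub>SG\<^esub> R) \<and> \<phi> ` R = R \<and> \<phi> ` P \<subseteq> Q)"
  by (simp add: fnormalizer_def Let_def fgroup_locality_fusion normalizer_SG[OF R])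

text \<open>The extension of a morphism of \<open>N\<^sub>\<F>(R)\<close> to \<open>P R\<close> is a morphism on an object, and so comes from an
  element of \<open>N\<^sub>L(R)\<close>.\<close>

lemma fnormalizer_hom:
  assumes R: "R \<in> \<Delta>"
  shows "\<psi> \<in> fhom (fnormalizer Fu R) P Q \<longleftrightarrow>
    pg_subgroup L P \<and> P \<subseteq> NS R \<and> pg_subgroup L Q \<and> Q \<subseteq> NS R \<and>
    (\<exists>y. arrow R y R \<and> P \<subseteq> S_of y \<and> pconj L y ` P \<subseteq> Q \<and> \<psi> = restrict (pconj L y) P)"
    (is "?l \<longleftrightarrow> ?r")
proof
  assume ?l
  then obtain \<phi> where s: "subgroup P (SG\<lparr>carrier := NS R\<rparr>)" "subgroup Q (SG\<lparr>carrier := NS R\<rparr>)"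
    and f: "\<psi> = restrict \<phi> P" "\<phi> \<in> fhom Fu (P <#>\<^bsub>SG\<^esub> R) (Q <#>\<^bsub>SG\<^esub> R)" "\<phi> ` R = R" "\<phi> ` P \<subseteq> Q"
    unfolding fnormalizer_mem[OF R] by blast
  have P: "pg_subgroup L P" "P \<subseteq> NS R" and Q: "pg_subgroup L Q" "Q \<subseteq> NS R"
    using s sub_NS_iff[OF R] by auto
  note NP = normalizing_product[OF R P]
  obtain y where y: "arrow (R <#>\<^bsub>SG\<^esub> P) y (\<phi> ` (R <#>\<^bsub>SG\<^esub> P))" "\<phi> = restrict (pconj L y) (R <#>\<^bsub>SG\<^esub> P)"
    using fusion_object[OF f(2)] NP(1,2) by auto
  have e: "\<phi> x = pconj L y x" if "x \<in> R <#>\<^bsub>SG\<^esub> P" for x using y(2) that by simp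
  have "arrow R y (pconj L y ` R)" using arrow_restrict[OF y(1) R NP(3)] .
  moreover have "pconj L y ` R = \<phi> ` R" using e NP(3) by (intro image_cong) auto
  ultimately have "arrow R y R" using f(3) by simp
  moreover have "P \<subseteq> S_of y" using arrow_S_of[OF y(1)] NP(4) by blast
  moreover have "pconj L y ` P \<subseteq> Q" using f(4) e NP(4) by (auto simp: subset_iff image_iff)
  moreover have "\<psi> = restrict (pconj L y) P" unfolding f(1) using e NP(4) by (intro restrict_ext) auto
  ultimately show ?r using P Q by blast
next
  assume ?r
  then obtain y where P: "pg_subgroup L P" "P \<subseteq> NS R" and Q: "pg_subgroup L Q" "Q \<subseteq> NS R"
    and y: "arrow R y R" "P \<subseteq> S_of y" "pconj L y ` P \<subseteq> Q" "\<psi> = restrict (pconj L y) P" by blast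
  note NP = normalizing_product[OF R P] and NQ = normalizing_product[OF R Q]
  have yL: "y \<in> pcarrier L" using arrowD(3)[OF y(1)] .
  have "R <#>\<^bsub>SG\<^esub> P \<subseteq> S_of y" using NP(6)[OF S_of_subgroup[OF yL] arrow_S_of[OF y(1)] y(2)] .
  then have a: "arrow (R <#>\<^bsub>SG\<^esub> P) y (pconj L y ` (R <#>\<^bsub>SG\<^esub> P))" using arrowI[OF yL NP(1)] by blast
  have im: "pconj L y ` (R <#>\<^bsub>SG\<^esub> P) \<subseteq> R <#>\<^bsub>SG\<^esub> Q"
  proof (rule image_subsetI)
    fix x assume "x \<in> R <#>\<^bsub>SG\<^esub> P"
    then obtain r q where rq: "r \<in> R" "q \<in> P" "x = r \<otimes>\<^bsub>SG\<^esub> q" by (auto simp: set_mult_def)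
    have rs: "r \<in> S" "q \<in> S" "r \<in> S_of y" "q \<in> S_of y"
      using rq Delta_sub[OF R] P(2) NS_sub arrow_S_of[OF y(1)] y(2) by auto
    have "pconj L y x = pmul (pconj L y r) (pconj L y q)"
      using S_of_mul(2)[OF yL rs(3,4)] rq rs by (simp add: pg_group_simps)
    moreover have "pconj L y r \<in> R" "pconj L y q \<in> Q" using arrowD(5)[OF y(1)] y(3) rq by auto
    moreover have "R \<subseteq> S" "Q \<subseteq> S" using Delta_sub[OF R] Q NS_sub by auto
    ultimately show "pconj L y x \<in> R <#>\<^bsub>SG\<^esub> Q"
      unfolding set_mult_def by (force simp: pg_group_simps subset_iff)
  qed
  let ?\<phi> = "restrict (pconj L y) (P <#>\<^bsub>SG\<^esub> R)"
  have "?\<phi> \<in> fhom Fu (P <#>\<^bsub>SG\<^esub> R) (Q <#>\<^bsub>SG\<^esub> R)"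
    using conj_in_fusion[OF a im Delta_subgroup[OF NQ(1)] Delta_sub[OF NQ(1)]] NP(2) NQ(2) by simp
  moreover have "?\<phi> ` R = R" using arrowD(5)[OF y(1)] NP(2,3) by (simp add: subset_iff)
  moreover have "?\<phi> ` P \<subseteq> Q" using y(3) NP(2,4) by auto
  moreover have "\<psi> = restrict ?\<phi> P" unfolding y(4) using NP(2,4) by (intro restrict_ext) auto
  moreover have "subgroup P (SG\<lparr>carrier := NS R\<rparr>)" "subgroup Q (SG\<lparr>carrier := NS R\<rparr>)"
    using sub_NS_iff[OF R] P Q by auto
  ultimately show ?l unfolding fnormalizer_mem[OF R] by (intro exI[of _ ?\<phi>] conjI)
qed

lemma fgroup_fnormalizer: "R \<in> \<Delta> \<Longrightarrow> fgroup (fnormalizer Fu R) = SG\<lparr>carrier := NS R\<rparr>"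
  by (simp add: fnormalizer_def Let_def fgroup_locality_fusion normalizer_SG)

text \<open>The morphisms of \<open>N\<^sub>\<F>(R)\<close> between \<open>P\<close> and \<open>Q\<close> and those between \<open>P R\<close> and \<open>Q R\<close> come from the same
  elements of \<open>N\<^sub>L(R)\<close>.\<close>

lemma fnormalizer_normal:
  assumes R: "R \<in> \<Delta>" shows "fnormal (fnormalizer Fu R) R"
proof -
  let ?F = "fnormalizer Fu R" and ?N = "SG\<lparr>carrier := NS R\<rparr>"
  interpret SG: Group.group SG by (rule SG_group)
  have gN: "fgroup ?F = ?N" by (rule fgroup_fnormalizer[OF R])
  have sR: "subgroup R ?N" using sub_NS_iff[OF R] Delta_subgroup[OF R] NS_self[OF R] by blast
  have nN: "normalizer ?N R = NS R"
  proof -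
    have "(g <#\<^bsub>?N\<^esub> R #>\<^bsub>?N\<^esub> inv\<^bsub>?N\<^esub> g) = (g <#\<^bsub>SG\<^esub> R #>\<^bsub>SG\<^esub> inv\<^bsub>SG\<^esub> g)" if "g \<in> NS R" for g
      using SG.m_inv_consistent[OF NS_SG[OF R] that] by (simp add: l_coset_def r_coset_def)
    moreover have "g <#\<^bsub>SG\<^esub> R #>\<^bsub>SG\<^esub> inv\<^bsub>SG\<^esub> g = R" if "g \<in> NS R" for g
    proof -
      have "g \<in> normalizer SG R" using normalizer_SG[OF R] that by simp
      then show ?thesis using Delta_sub[OF R] by (simp add: normalizer_def stabilizer_def pg_group_simps)
    qed
    ultimately show ?thesis using NS_self[OF R] by (auto simp: normalizer_def stabilizer_def)
  qed
  have "fhom ?F P Q = fhom (fnormalizer ?F R) P Q" for P Q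
  proof (rule Set.set_eqI)
    fix \<psi>
    have "\<psi> \<in> fhom (fnormalizer ?F R) P Q \<longleftrightarrow> (\<exists>\<phi>. \<psi> = restrict \<phi> P \<and> subgroup P ?N \<and> subgroup Q ?N \<and>
       \<phi> \<in> fhom ?F (P <#>\<^bsub>SG\<^esub> R) (Q <#>\<^bsub>SG\<^esub> R) \<and> \<phi> ` R = R \<and> \<phi> ` P \<subseteq> Q)"
      unfolding fnormalizer_def[of ?F] by (simp add: Let_def gN nN)
    also have "\<dots> \<longleftrightarrow> \<psi> \<in> fhom ?F P Q"
    proof
      assume a: "\<psi> \<in> fhom ?F P Q"
      then obtain y where P: "pg_subgroup L P" "P \<subseteq> NS R" and Q: "pg_subgroup L Q" "Q \<subseteq> NS R"
        and y: "arrow R y R" "P \<subseteq> S_of y" "pconj L y ` P \<subseteq> Q" "\<psi> = restrict (pconj L y) P"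
        using a[unfolded fnormalizer_hom[OF R]] by blast
      obtain \<phi> where f: "\<psi> = restrict \<phi> P" "\<phi> \<in> fhom Fu (P <#>\<^bsub>SG\<^esub> R) (Q <#>\<^bsub>SG\<^esub> R)" "\<phi> ` R = R" "\<phi> ` P \<subseteq> Q"
        using a unfolding fnormalizer_mem[OF R] by blast
      note NP = normalizing_product[OF R P] and NQ = normalizing_product[OF R Q]
      obtain z where z: "arrow (R <#>\<^bsub>SG\<^esub> P) z (\<phi> ` (R <#>\<^bsub>SG\<^esub> P))" "\<phi> = restrict (pconj L z) (R <#>\<^bsub>SG\<^esub> P)"
        "\<phi> ` (R <#>\<^bsub>SG\<^esub> P) \<subseteq> R <#>\<^bsub>SG\<^esub> Q"
        using fusion_object[OF f(2)] NP(1,2) NQ(2) by auto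
      have zi: "pconj L z ` (R <#>\<^bsub>SG\<^esub> P) \<subseteq> R <#>\<^bsub>SG\<^esub> Q" using z(2,3) by simp
      have "pconj L z ` R = \<phi> ` R" using NP(3) unfolding z(2) by (intro image_cong) auto
      then have "pconj L z ` R = R" using f(3) by simp
      then have zR: "arrow R z R" using arrow_restrict[OF z(1) R NP(3)] by simp
      have "\<phi> \<in> fhom ?F (R <#>\<^bsub>SG\<^esub> P) (R <#>\<^bsub>SG\<^esub> Q)"
        unfolding fnormalizer_hom[OF R] using Delta_subgroup[OF NP(1)] NP(5) Delta_subgroup[OF NQ(1)] NQ(5)
          zR arrow_S_of[OF z(1)] zi z(2) by blast
      then show "(\<exists>\<phi>. \<psi> = restrict \<phi> P \<and> subgroup P ?N \<and> subgroup Q ?N \<and>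
       \<phi> \<in> fhom ?F (P <#>\<^bsub>SG\<^esub> R) (Q <#>\<^bsub>SG\<^esub> R) \<and> \<phi> ` R = R \<and> \<phi> ` P \<subseteq> Q)"
        using f NP(2) NQ(2) P Q sub_NS_iff[OF R] by auto
    next
      assume "(\<exists>\<phi>. \<psi> = restrict \<phi> P \<and> subgroup P ?N \<and> subgroup Q ?N \<and>
       \<phi> \<in> fhom ?F (P <#>\<^bsub>SG\<^esub> R) (Q <#>\<^bsub>SG\<^esub> R) \<and> \<phi> ` R = R \<and> \<phi> ` P \<subseteq> Q)"
      then obtain \<phi> where P: "pg_subgroup L P" "P \<subseteq> NS R" and Q: "pg_subgroup L Q" "Q \<subseteq> NS R"
        and f: "\<psi> = restrict \<phi> P" "\<phi> \<in> fhom ?F (P <#>\<^bsub>SG\<^esub> R) (Q <#>\<^bsub>SG\<^esub> R)" "\<phi> ` R = R" "\<phi> ` P \<subseteq> Q"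
        unfolding sub_NS_iff[OF R] by blast
      note NP = normalizing_product[OF R P]
      obtain y where y: "arrow R y R" "R <#>\<^bsub>SG\<^esub> P \<subseteq> S_of y" "\<phi> = restrict (pconj L y) (R <#>\<^bsub>SG\<^esub> P)"
        using f(2)[unfolded fnormalizer_hom[OF R]] NP(2) by auto
      have "P \<subseteq> S_of y" using y(2) NP(4) by blast
      moreover have "pconj L y ` P \<subseteq> Q" using f(4) y(3) NP(4) by (auto simp: subset_iff image_iff)
      moreover have "\<psi> = restrict (pconj L y) P" unfolding f(1) y(3) using NP(4) by (intro restrict_ext) auto
      ultimately show "\<psi> \<in> fhom ?F P Q" unfolding fnormalizer_hom[OF R] using P Q y(1) by blast
    qed
    finally show "\<psi> \<in> fhom ?F P Q \<longleftrightarrow> \<psi> \<in> fhom (fnormalizer ?F R) P Q" by blast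
  qed
  then have "fhom ?F = fhom (fnormalizer ?F R)" by (intro ext)
  moreover have "fgroup (fnormalizer ?F R) = fgroup ?F"
    unfolding fnormalizer_def[of ?F] by (simp add: Let_def gN nN)
  ultimately have "?F = fnormalizer ?F R" by simp
  then show ?thesis using sR gN by (simp add: fnormal_def)
qed

lemma loop_restrict:
  assumes "arrow R y R" "X \<in> \<Delta>" "X \<subseteq> S_of y" "pconj L y ` X \<subseteq> X" shows "arrow X y X"
proof -
  have a: "arrow X y (pconj L y ` X)" using arrowI[OF arrowD(3)[OF assms(1)] assms(2,3)] .
  have "pconj L y ` X = X"
    by (rule card_subset_eq[OF finite_subset[OF Delta_sub[OF assms(2)] finite_S] assms(4) arrow_card[OF a]])
  then show ?thesis using a by simp
qed

lemma NG_normalI: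
  assumes R: "R \<in> \<Delta>" and H: "pg_subgroup L H" "\<forall>h\<in>H. arrow R h R"
    and n: "\<And>m h. arrow R m R \<Longrightarrow> h \<in> H \<Longrightarrow> pconj L m h \<in> H"
  shows "H \<lhd> NG R"
proof -
  interpret G: Group.group "NG R" by (rule NG_group[OF R])
  have car: "x \<in> carrier (NG R) \<longleftrightarrow> arrow R x R" for x
    using normalizer_iff[OF R] by (simp add: pg_group_simps)
  have "x \<otimes>\<^bsub>NG R\<^esub> h \<otimes>\<^bsub>NG R\<^esub> inv\<^bsub>NG R\<^esub> x \<in> H" if "x \<in> carrier (NG R)" "h \<in> H" for x h
  proof -
    have xi: "arrow R (inv\<^bsub>NG R\<^esub> x) R" using that(1) car G.inv_closed by blast
    have "pconj L (inv\<^bsub>NG R\<^esub> x) h = x \<otimes>\<^bsub>NG R\<^esub> h \<otimes>\<^bsub>NG R\<^esub> inv\<^bsub>NG R\<^esub> x"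
      using NG_conj[OF R xi, of h] H(2) that G.inv_inv[OF that(1)] by simp
    then show ?thesis using n[OF xi that(2)] by simp
  qed
  then show ?thesis using G.normal_inv_iff NG_subgroup_iff[OF R] H by blast
qed

lemma normal_NG_conj:
  assumes R: "R \<in> \<Delta>" and H: "H \<lhd> NG R" and m: "arrow R m R" "h \<in> H"
  shows "pconj L m h \<in> H"
proof -
  interpret G: Group.group "NG R" by (rule NG_group[OF R])
  have "m \<in> carrier (NG R)" using m(1) normalizer_iff[OF R] by (simp add: pg_group_simps)
  moreover have "arrow R h R" using NG_subgroup_iff[OF R] normal_imp_subgroup[OF H] m(2) by blast
  ultimately show ?thesis using normal.inv_op_closed1[OF H _ m(2)] NG_conj[OF R m(1)] by metis
qed

lemma NG_centralizer:
  assumes R: "R \<in> \<Delta>" and z: "arrow R z R" "\<And>r. r \<in> R \<Longrightarrow> pconj L z r = r"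
  shows "z \<in> centralizer (NG R) R"
proof -
  have zN: "z \<in> pnormalizer L R" using z(1) normalizer_iff[OF R] by blast
  have "z \<otimes>\<^bsub>NG R\<^esub> r = r \<otimes>\<^bsub>NG R\<^esub> z" if r: "r \<in> R" for r
  proof -
    have "r \<in> pnormalizer L R" using arrow_S[OF R r] normalizer_iff[OF R] by blast
    moreover have "pmul z r = pmul r z"
      using conj_undo(5)[OF _ arrowD(3)[OF z(1)], of r] z(2)[OF r] arrowD(4)[OF z(1)] r by auto
    ultimately show ?thesis using zN by (simp add: pg_group_simps)
  qed
  then show ?thesis using zN by (simp add: centralizer_def pg_group_simps)
qed

text \<open>Here \<open>C\<^sub>L(R) \<le> R\<close>, and the same holds for the conjugates of \<open>R\<close>, so that \<open>R\<close> is centric. If \<open>U\<close> is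
  normal in \<open>N\<^sub>\<F>(R)\<close>, then each \<open>x \<in> N\<^sub>L(R)\<close> agrees on \<open>R\<close> with some \<open>y\<close> that normalizes \<open>R U\<close>. As
  \<open>x y\<^sup>-\<^sup>1\<close> centralizes \<open>R\<close>, it lies in \<open>R\<close>, and \<open>x\<close> normalizes \<open>R U\<close> too. So \<open>R U\<close> is a normal
  \<open>p\<close>-subgroup of \<open>N\<^sub>L(R)\<close>, and \<open>U \<le> R\<close>.\<close>

lemma p_core_eq_imp_centric_radical:
  assumes R: "fully_norm R" and core: "p_core p (NG R) = R"
    and char: "centralizer (NG R) (p_core p (NG R)) \<subseteq> p_core p (NG R)"
  shows "R \<in> centrics Fu \<inter> radicals Fu"
proof
  have RD: "R \<in> \<Delta>" using R by (simp add: fully_norm_def)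
  have sR: "subgroup R SG" using SG_sub_iff Delta_subgroup[OF RD] Delta_sub[OF RD] by blast
  have cent: "z \<in> R" if "arrow R z R" "\<And>r. r \<in> R \<Longrightarrow> pconj L z r = r" for z
    using NG_centralizer[OF RD that] char core by auto
  interpret G: Group.group "NG R" by (rule NG_group[OF RD])
  show "R \<in> centrics Fu"
  proof -
    have "centralizer SG Q \<subseteq> Q" if Q: "Q \<in> fconjugates Fu R" for Q
    proof
      fix c assume c: "c \<in> centralizer SG Q"
      obtain g where g: "arrow R g Q" using Q fconjugates_iff[OF RD] by blast
      have cS: "c \<in> S" using c by (simp add: centralizer_def pg_group_simps)
      have cx: "pconj L c x = x" if x: "x \<in> Q" for x
      proof -
        have xS: "x \<in> S" using x arrowD(7)[OF g] by blast
        have "c \<otimes>\<^bsub>SG\<^esub> x = x \<otimes>\<^bsub>SG\<^esub> c" using c x by (simp add: centralizer_def)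
        then have e: "pmul c x = pmul x c" by (simp only: pg_group_simps(3)[OF cS xS] pg_group_simps(3)[OF xS cS])
        have a: "arrow S c S" "arrow S x S" using arrow_S[OF S_Delta] cS xS by auto
        have "pconj L c x = pmul (pinv L c) (pmul x c)" using conj_elt(3)[OF a(2) a(1) a(1)] .
        also have "\<dots> = x" using inv_mul_cancel[OF a] e by simp
        finally show ?thesis .
      qed
      then have cQ: "arrow Q c Q" using S_arrow[OF cS arrowD(2)[OF g]] by simp
      let ?z = "pconj L (pinv L g) c"
      note gi = arrow_inv[OF g]
      have z: "arrow R ?z R" using conj_elt(2)[OF cQ gi gi] .
      have "pconj L ?z r = r" if r: "r \<in> R" for r
      proof -
        have gr: "pconj L g r \<in> Q" using r arrowD(5)[OF g] by blast
        have e: "?z = pmul g (pmul c (pinv L g))"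
          using conj_elt(3)[OF cQ gi gi] inv_inv[OF arrowD(3)[OF g]] by simp
        have "pconj L ?z r = pconj L (pmul c (pinv L g)) (pconj L g r)"
          unfolding e by (rule arrow_mul(3)[OF g arrow_mul(2)[OF cQ gi] r])
        also have "\<dots> = pconj L (pinv L g) (pconj L c (pconj L g r))" by (rule arrow_mul(3)[OF cQ gi gr])
        also have "\<dots> = r" using cx[OF gr] conj_undo(2)[OF _ arrowD(3)[OF g]] arrowD(4)[OF g] r by auto
        finally show ?thesis .
      qed
      then have "?z \<in> R" using cent[OF z] by blast
      then have "pconj L g ?z \<in> Q" using arrowD(5)[OF g] by blast
      moreover have "pconj L g ?z = c"
        using conj_undo(2)[OF conj_elt(1)[OF cQ gi gi] arrowD(3)[OF gi]] inv_inv[OF arrowD(3)[OF g]] by simp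
      ultimately show "c \<in> Q" by simp
    qed
    then show ?thesis using sR by (simp add: centrics_def fgroup_locality_fusion)
  qed
  show "R \<in> radicals Fu"
  proof -
    have "R \<in> fconjugates Fu R" using fconjugates_iff[OF RD] arrow_one[OF RD] by blast
    moreover have "fully_normalized Fu R"
    proof -
      have "card (normalizer SG P') \<le> card (normalizer SG R)" if "P' \<in> fconjugates Fu R" for P'
        using that fconjugates_iff[OF RD] R arrowD(2) normalizer_SG[OF RD] normalizer_SG[of P']
        unfolding fully_norm_def by auto
      then show ?thesis using sR by (simp add: fully_normalized_def fgroup_locality_fusion)
    qed
    moreover have "fusion_core (fnormalizer Fu R) = R"
      unfolding fusion_core_def
    proof (rule Greatest_equality)
      show "fnormal (fnormalizer Fu R) R" by (rule fnormalizer_normal[OF RD])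
      fix U assume U: "fnormal (fnormalizer Fu R) U"
      let ?F = "fnormalizer Fu R"
      have sU: "pg_subgroup L U" "U \<subseteq> NS R"
        using U sub_NS_iff[OF RD] fgroup_fnormalizer[OF RD] by (auto simp: fnormal_def)
      note N = normalizing_product[OF RD sU]
      let ?W = "R <#>\<^bsub>SG\<^esub> U"
      have W: "arrow ?W x ?W" if x: "arrow R x R" for x
      proof -
        have "restrict (pconj L x) R \<in> fhom ?F R R"
          unfolding fnormalizer_hom[OF RD]
          using Delta_subgroup[OF RD] NS_self[OF RD] x arrow_S_of[OF x] arrowD(5)[OF x] by blast
        then have "restrict (pconj L x) R \<in> fhom (fnormalizer ?F U) R R" using U by (simp add: fnormal_def)
        then obtain \<phi> where f: "restrict (pconj L x) R = restrict \<phi> R" "\<phi> \<in> fhom ?F ?W ?W"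
          unfolding fnormalizer_def[of ?F] by (auto simp: Let_def fgroup_fnormalizer[OF RD] set_mult_def)
        then obtain y where y: "arrow R y R" "?W \<subseteq> S_of y" "pconj L y ` ?W \<subseteq> ?W" "\<phi> = restrict (pconj L y) ?W"
          using f(2)[unfolded fnormalizer_hom[OF RD]] by blast
        have yW: "arrow ?W y ?W" using loop_restrict[OF y(1) N(1) y(2,3)] .
        have e: "pconj L x r = pconj L y r" if "r \<in> R" for r
          using fun_cong[OF f(1), of r] that y(4) N(3) by auto
        note yi = arrow_inv[OF y(1)]
        let ?z = "pmul x (pinv L y)"
        have z: "arrow R ?z R" using arrow_mul(2)[OF x yi] .
        have "pconj L ?z r = r" if r: "r \<in> R" for r
          using arrow_mul(3)[OF x yi r] e[OF r] conj_undo(2)[OF _ arrowD(3)[OF y(1)]] arrowD(4)[OF y(1)] r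
          by auto
        then have "?z \<in> R" using cent[OF z] by blast
        then have zW: "arrow ?W ?z ?W" using arrow_S[OF N(1)] N(3) by blast
        have "pmul ?z y = x" using mul_inv_cancel_right[OF x y(1)] .
        then show ?thesis using arrow_mul(2)[OF zW yW] by simp
      qed
      have "?W \<lhd> NG R"
      proof (rule NG_normalI[OF RD Delta_subgroup[OF N(1)]])
        show "\<forall>h\<in>?W. arrow R h R" using N(5) by (auto simp: NS_def)
        show "pconj L m h \<in> ?W" if "arrow R m R" "h \<in> ?W" for m h
          using arrowD(5)[OF W[OF that(1)]] that(2) by blast
      qed
      moreover obtain n where "card ?W = p ^ n" using sub_S_card[OF Delta_subgroup[OF N(1)] Delta_sub[OF N(1)]] by blast
      ultimately have "?W \<subseteq> R"
        using p_core_greatest[OF NG_group[OF RD] prime_p NG_finite[OF RD]] core by auto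
      then show "U \<le> R" using N(4) by blast
    qed
    ultimately show ?thesis using sR by (auto simp: radicals_def fgroup_locality_fusion)
  qed
qed

text \<open>The object obtained is \<open>O\<^sub>p(N\<^sub>L(R))\<close>. This is where properness enters: for a
  maximal missing object \<open>R\<close> it shows that all of \<open>N\<^sub>L(R)\<close> belongs to the smaller locality.\<close>

lemma bigger_core:
  assumes R: "fully_norm R" and char: "centralizer (NG R) (p_core p (NG R)) \<subseteq> p_core p (NG R)"
    and n: "R \<notin> centrics Fu \<inter> radicals Fu"
  shows "\<exists>O'. O' \<in> \<Delta> \<and> R \<subset> O' \<and> (\<forall>m. arrow R m R \<longrightarrow> arrow O' m O')"
proof -
  have RD: "R \<in> \<Delta>" using R by (simp add: fully_norm_def)
  let ?O = "p_core p (NG R)"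
  note C = p_core_greatest[OF NG_group[OF RD] prime_p NG_finite[OF RD]]
  have On: "?O \<lhd> NG R" using C by blast
  obtain k where k: "card ?O = p ^ k" using C by blast
  have sO: "pg_subgroup L ?O" using NG_subgroup_iff[OF RD] normal_imp_subgroup[OF On] by blast
  have "R \<lhd> NG R" using NG_normalI[OF RD Delta_subgroup[OF RD]] arrow_S[OF RD] arrowD(5) by blast
  then have RO: "R \<subseteq> ?O" using C sub_S_card[OF Delta_subgroup[OF RD] Delta_sub[OF RD]] by blast
  have OS: "?O \<subseteq> NS R"
    using group.normal_p_subgroup_in_sylow[OF NG_group[OF RD] prime_p NG_finite[OF RD] fully_norm_sylow[OF R] On k] .
  have OD: "?O \<in> \<Delta>" using Delta_over[OF RD RO _ sO] OS NS_sub by blast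
  have "?O \<noteq> R" using p_core_eq_imp_centric_radical[OF R _ char] n by blast
  moreover have "arrow ?O m ?O" if m: "arrow R m R" for m
  proof -
    have c: "pconj L m ` ?O \<subseteq> ?O" using normal_NG_conj[OF RD On m] by blast
    have "h \<in> conj_dom L m" if "h \<in> ?O" for h
      using conj_elt(1)[OF _ m m] OS that by (auto simp: NS_def)
    then have "?O \<subseteq> S_of m" using c subset_trans[OF OS NS_sub] by (auto simp: S_of_def)
    then show ?thesis using loop_restrict[OF m OD _ c] by blast
  qed
  ultimately show ?thesis using RO OD by blast
qed

section \<open>Representatives modulo a partial normal subgroup\<close>

text \<open>For sets of objects this is closure with respect to the fusion system, since fusion on objects is
  conjugation in \<open>L\<close>.\<close>

definition closed :: "'a set set \<Rightarrow> bool" where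
  "closed \<Gamma> \<longleftrightarrow> \<Gamma> \<subseteq> \<Delta> \<and> S \<in> \<Gamma> \<and> (\<forall>P g Q. P \<in> \<Gamma> \<longrightarrow> arrow P g Q \<longrightarrow> Q \<in> \<Gamma>) \<and>
     (\<forall>P Q. P \<in> \<Gamma> \<longrightarrow> P \<subseteq> Q \<longrightarrow> Q \<in> \<Delta> \<longrightarrow> Q \<in> \<Gamma>)"

text \<open>The carrier of the restriction of \<open>L\<close> to \<open>\<Gamma>\<close>.\<close>

definition elements_over :: "'a set set \<Rightarrow> 'a set" where "elements_over \<Gamma> = {g \<in> pcarrier L. S_of g \<in> \<Gamma>}"

text \<open>Partial normality in the restriction to \<open>\<Gamma>\<close>, see \<open>partial_normal_restriction\<close> below. Products and
  conjugates are taken along arrows of \<open>L\<close>, so that different \<open>\<Gamma>\<close> can be compared within one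
  locality, and words are replaced by binary products.\<close>

definition normal_in :: "'a set set \<Rightarrow> 'a set \<Rightarrow> bool" where
  "normal_in \<Gamma> N \<longleftrightarrow> N \<subseteq> elements_over \<Gamma> \<and> pone \<in> N \<and> (\<forall>x\<in>N. pinv L x \<in> N) \<and>
     (\<forall>x\<in>N. \<forall>y\<in>N. \<forall>P Q R. P \<in> \<Gamma> \<longrightarrow> arrow P x Q \<longrightarrow> arrow Q y R \<longrightarrow> pmul x y \<in> N) \<and>
     (\<forall>x\<in>N. \<forall>g P Q P' Q'. P \<in> \<Gamma> \<longrightarrow> arrow P x Q \<longrightarrow> arrow P g P' \<longrightarrow> arrow Q g Q' \<longrightarrow> pconj L g x \<in> N)"

end

locale locality_with_normal = locality_context +
  fixes \<Gamma> :: "'a set set" and N :: "'a set"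
  assumes closed_G: "closed \<Gamma>" and normal_N: "normal_in \<Gamma> N"
begin

lemma G_Delta: "P \<in> \<Gamma> \<Longrightarrow> P \<in> \<Delta>" using closed_G unfolding closed_def by blast
lemma G_S: "S \<in> \<Gamma>" using closed_G unfolding closed_def by blast
lemma G_arrow: "arrow P g Q \<Longrightarrow> P \<in> \<Gamma> \<Longrightarrow> Q \<in> \<Gamma>" using closed_G unfolding closed_def by blast
lemma G_over: "P \<in> \<Gamma> \<Longrightarrow> P \<subseteq> Q \<Longrightarrow> Q \<in> \<Delta> \<Longrightarrow> Q \<in> \<Gamma>" using closed_G unfolding closed_def by blast

lemma elements_overI: assumes "arrow P g Q" "P \<in> \<Gamma>" shows "g \<in> elements_over \<Gamma>"
  using G_over[OF assms(2) arrow_S_of[OF assms(1)] S_of_Delta[OF arrowD(3)[OF assms(1)]]] arrowD(3)[OF assms(1)]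
  by (simp add: elements_over_def)

lemma elements_overD: assumes "g \<in> elements_over \<Gamma>" shows "g \<in> pcarrier L" "S_of g \<in> \<Gamma>" "arrow (S_of g) g (pconj L g ` S_of g)"
  using assms S_of_arrow by (auto simp: elements_over_def)

lemma N_elements_over: "x \<in> N \<Longrightarrow> x \<in> elements_over \<Gamma>" using normal_N unfolding normal_in_def by blast
lemma N_one: "pone \<in> N" using normal_N unfolding normal_in_def by blast
lemma N_inv: "x \<in> N \<Longrightarrow> pinv L x \<in> N" using normal_N unfolding normal_in_def by blast
lemma N_mul: "x \<in> N \<Longrightarrow> y \<in> N \<Longrightarrow> P \<in> \<Gamma> \<Longrightarrow> arrow P x Q \<Longrightarrow> arrow Q y R \<Longrightarrow> pmul x y \<in> N"
  using normal_N unfolding normal_in_def by blast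
lemma N_conj: "x \<in> N \<Longrightarrow> P \<in> \<Gamma> \<Longrightarrow> arrow P x Q \<Longrightarrow> arrow P g P' \<Longrightarrow> arrow Q g Q' \<Longrightarrow> pconj L g x \<in> N"
  using normal_N unfolding normal_in_def by blast

definition T :: "'a set" where "T = S \<inter> N"

lemma T_sub: "T \<subseteq> S" by (auto simp: T_def)

lemma T_conj: assumes g: "g \<in> elements_over \<Gamma>" and t: "t \<in> T" "t \<in> S_of g" shows "pconj L g t \<in> T"
proof -
  note a = elements_overD(3)[OF g]
  have "arrow (S_of g) t (S_of g)" using arrow_S[OF G_Delta[OF elements_overD(2)[OF g]] t(2)] .
  then have "pconj L g t \<in> N" using N_conj[OF _ elements_overD(2)[OF g] _ a a] t(1) by (simp add: T_def)
  then show ?thesis using t by (auto simp: S_of_def T_def)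
qed

lemma T_image: assumes g: "g \<in> elements_over \<Gamma>" and T: "T \<subseteq> S_of g" shows "pconj L g ` T = T" "T \<subseteq> S_of (pinv L g)"
proof -
  have "inj_on (pconj L g) T" using inj_on_subset[OF conj_inj[OF elements_overD(3)[OF g]] T] .
  then have "card (pconj L g ` T) = card T" by (rule card_image)
  moreover have "pconj L g ` T \<subseteq> T" using T_conj[OF g] T by blast
  ultimately show 1: "pconj L g ` T = T" using card_subset_eq[OF finite_subset[OF T_sub finite_S]] by blast
  show "T \<subseteq> S_of (pinv L g)" unfolding S_of_inv_image[OF elements_overD(1)[OF g]] using 1 T by blast
qed

lemma T_subgroup: "pg_subgroup L T"
proof -
  have "pmul x y \<in> T" if "x \<in> T" "y \<in> T" for x y
  proof -
    have xy: "x \<in> S" "y \<in> S" "x \<in> N" "y \<in> N" using that by (auto simp: T_def)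
    then have "pmul x y \<in> N" using N_mul[OF _ _ G_S arrow_S arrow_S] G_Delta[OF G_S] by blast
    then show ?thesis using subgroup_mul[OF S_subgroup] xy by (simp add: T_def)
  qed
  then show ?thesis unfolding sub_S_iff[OF T_sub] using N_one S_one N_inv mul_inv_S by (auto simp: T_def)
qed

lemma T_product:
  assumes P: "pg_subgroup L P" "P \<subseteq> S"
  shows "pg_subgroup L (T <#>\<^bsub>SG\<^esub> P)" "T <#>\<^bsub>SG\<^esub> P \<subseteq> S" "T \<subseteq> T <#>\<^bsub>SG\<^esub> P" "P \<subseteq> T <#>\<^bsub>SG\<^esub> P"
    "\<And>Y. pg_subgroup L Y \<Longrightarrow> T \<subseteq> Y \<Longrightarrow> P \<subseteq> Y \<Longrightarrow> T <#>\<^bsub>SG\<^esub> P \<subseteq> Y"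
proof -
  interpret SG: Group.group SG by (rule SG_group)
  have s: "subgroup T SG" "subgroup P SG" using SG_sub_iff T_subgroup T_sub P by auto
  have n: "inv\<^bsub>SG\<^esub> b \<otimes>\<^bsub>SG\<^esub> a \<otimes>\<^bsub>SG\<^esub> b \<in> T" if "a \<in> T" "b \<in> P" for a b
  proof -
    have ab: "b \<in> S" "a \<in> S" using that P T_sub by auto
    have "b \<in> elements_over \<Gamma>" using S_of_S[OF ab(1)] G_S S_carrier[OF ab(1)] by (simp add: elements_over_def)
    then have "pconj L b a \<in> T" using T_conj that S_of_S[OF ab(1)] ab by simp
    then show ?thesis using subgroup_conj(3)[OF S_subgroup ab] by simp
  qed
  note M = SG.normalizing_set_mult[OF s n]
  show "pg_subgroup L (T <#>\<^bsub>SG\<^esub> P)" "T <#>\<^bsub>SG\<^esub> P \<subseteq> S" using M(1) SG_sub_iff by auto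
  show "T \<subseteq> T <#>\<^bsub>SG\<^esub> P" "P \<subseteq> T <#>\<^bsub>SG\<^esub> P" using SG.set_mult_contains[OF s] by auto
  show "T <#>\<^bsub>SG\<^esub> P \<subseteq> Y" if Y: "pg_subgroup L Y" "T \<subseteq> Y" "P \<subseteq> Y" for Y
  proof
    fix x assume "x \<in> T <#>\<^bsub>SG\<^esub> P"
    then obtain t q where "t \<in> T" "q \<in> P" "x = t \<otimes>\<^bsub>SG\<^esub> q" by (auto simp: set_mult_def)
    then show "x \<in> Y" using subgroup_mul[OF Y(1)] Y(2,3) pg_group_simps(3)[of t S q] T_sub P(2)
      by (metis subsetD)
  qed
qed

text \<open>The commutator \<open>x\<^sup>-\<^sup>1 x\<^sup>n = (n\<^sup>-\<^sup>1)\<^sup>x n\<close> lies in \<open>S\<close> by the left hand side and in \<open>N\<close> by the right hand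
  side.\<close>

lemma N_moves: assumes n: "n \<in> N" and x: "x \<in> S_of n" shows "pmul (pinv L x) (pconj L n x) \<in> T"
proof -
  let ?A = "S_of n" and ?B = "pconj L n ` S_of n"
  have nG: "n \<in> elements_over \<Gamma>" using N_elements_over[OF n] .
  note AG = elements_overD(2)[OF nG] and na = elements_overD(3)[OF nG]
  have xS: "x \<in> S" "pconj L n x \<in> S" using x by (auto simp: S_of_def)
  have xA: "arrow ?A x ?A" using arrow_S[OF G_Delta[OF AG] x] .
  have xB: "arrow ?B x (pconj L x ` ?B)" using S_arrow[OF xS(1) arrowD(2)[OF na]] .
  note ni = arrow_inv[OF na] and xAi = arrow_inv[OF xA] and xBi = arrow_inv[OF xB]
  have BG: "?B \<in> \<Gamma>" using G_arrow[OF na AG] .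
  have c: "pconj L x (pinv L n) \<in> N" "arrow (pconj L x ` ?B) (pconj L x (pinv L n)) ?A"
    "pconj L x (pinv L n) = pmul (pinv L x) (pmul (pinv L n) x)"
    using N_conj[OF N_inv[OF n] BG ni xB xA] conj_elt[OF ni xB xA] by auto
  have "pmul (pconj L x (pinv L n)) n \<in> N"
    using N_mul[OF c(1) n G_arrow[OF xB BG] c(2) na] .
  moreover have "pmul (pconj L x (pinv L n)) n = pmul (pinv L x) (pconj L n x)"
  proof -
    have "pmul (pmul (pinv L x) (pmul (pinv L n) x)) n = pmul (pinv L x) (pmul (pmul (pinv L n) x) n)"
      by (rule mul_assoc(1)[OF xBi arrow_mul(2)[OF ni xA] na])
    also have "pmul (pmul (pinv L n) x) n = pmul (pinv L n) (pmul x n)" by (rule mul_assoc(1)[OF ni xA na])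
    finally show ?thesis using c(3) conj_elt(3)[OF xA na na] by simp
  qed
  moreover have "pmul (pinv L x) (pconj L n x) \<in> S"
    using subgroup_mul[OF S_subgroup mul_inv_S[OF xS(1)] xS(2)] .
  ultimately show ?thesis by (simp add: T_def)
qed

lemma N_moves_in:
  assumes n: "n \<in> N" and K: "pg_subgroup L K" "T \<subseteq> K" and X: "X \<subseteq> S_of n" "X \<subseteq> K"
  shows "pconj L n ` X \<subseteq> K"
proof
  fix y assume "y \<in> pconj L n ` X"
  then obtain x where x: "x \<in> X" "y = pconj L n x" by blast
  have xs: "x \<in> S_of n" using x X by blast
  have S: "x \<in> S" "y \<in> S" using xs x(2) by (auto simp: S_of_def)
  have "pmul x (pmul (pinv L x) y) = y"
    using mul_inv_cancel[OF arrow_S arrow_S, of S x y] S S_Delta by blast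
  moreover have "pmul x (pmul (pinv L x) y) \<in> K"
    using subgroup_mul[OF K(1), of x "pmul (pinv L x) y"] N_moves[OF n xs] x X K(2) by auto
  ultimately show "y \<in> K" by simp
qed

lemma N_moves_arrow:
  assumes n: "n \<in> N" "arrow X n Y" and f: "f \<in> pcarrier L" "T \<subseteq> S_of f" and X: "X \<subseteq> S_of f" shows "Y \<subseteq> S_of f"
  using N_moves_in[OF n(1) S_of_subgroup[OF f(1)] f(2) arrow_S_of[OF n(2)] X] arrowD(5)[OF n(2)] by simp

text \<open>The element \<open>f\<close>, which normalizes \<open>T\<close>, stands for the class of \<open>g\<close> modulo \<open>N\<close>. Such representatives
  take the place of the elements of the quotient locality \<open>L/N\<close>. Their advantage is that \<open>f\<close> is
  defined on \<open>X\<close> as well as on \<open>X\<^sup>n\<close>, since \<open>X\<^sup>n \<le> X T\<close>.\<close>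

definition rep :: "'a set \<Rightarrow> 'a \<Rightarrow> 'a \<Rightarrow> bool" where
  "rep X g f \<longleftrightarrow> X \<in> \<Gamma> \<and> T \<subseteq> S_of f \<and> (\<exists>n\<in>N. \<exists>A Y. arrow X n A \<and> arrow A f Y \<and> g = pmul n f)"

lemma repE:
  assumes "rep X g f"
  obtains n A Y where "n \<in> N" "arrow X n A" "arrow A f Y" "g = pmul n f" "arrow X g Y"
    "X \<in> \<Gamma>" "A \<in> \<Gamma>" "Y \<in> \<Gamma>" "T \<subseteq> S_of f" "f \<in> elements_over \<Gamma>" "X \<subseteq> S_of f"
proof -
  obtain n A Y where n: "n \<in> N" "arrow X n A" "arrow A f Y" "g = pmul n f" "X \<in> \<Gamma>" "T \<subseteq> S_of f"
    using assms unfolding rep_def by blast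
  have A: "A \<in> \<Gamma>" using G_arrow[OF n(2,5)] .
  have "X \<subseteq> S_of f"
    by (rule N_moves_arrow[OF N_inv[OF n(1)] arrow_inv[OF n(2)] arrowD(3)[OF n(3)] n(6) arrow_S_of[OF n(3)]])
  then show ?thesis using that[OF n(1-4) _ n(5) A G_arrow[OF n(3) A] n(6) elements_overI[OF n(3) A]]
      arrow_mul(2)[OF n(2,3)] n(4) by simp
qed

lemma rep_arrow: assumes "rep X g f" shows "X \<in> \<Gamma>" "arrow X g (pconj L g ` X)" "f \<in> elements_over \<Gamma>" "T \<subseteq> S_of f"
    "X \<subseteq> S_of f" "arrow X f (pconj L f ` X)"
proof -
  from assms obtain n A Y where *: "arrow X g Y" "X \<in> \<Gamma>" "T \<subseteq> S_of f" "f \<in> elements_over \<Gamma>" "X \<subseteq> S_of f" by (rule repE)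
  then show "X \<in> \<Gamma>" "arrow X g (pconj L g ` X)" "f \<in> elements_over \<Gamma>" "T \<subseteq> S_of f" "X \<subseteq> S_of f" using arrowD(5)[OF *(1)] by auto
  show "arrow X f (pconj L f ` X)" using arrowI[OF elements_overD(1)[OF *(4)] G_Delta[OF *(2)] *(5)] .
qed

lemma rep_N: assumes n: "n \<in> N" "arrow X n Y" "X \<in> \<Gamma>" shows "rep X n pone"
proof -
  have "arrow Y pone Y" using arrow_one arrowD(2)[OF n(2)] by blast
  moreover have "n = pmul n pone" using one_mul(4)[OF arrowD(3)[OF n(2)]] by simp
  moreover have "T \<subseteq> S_of pone" using S_of_S[OF S_one] T_sub by simp
  ultimately show ?thesis using n unfolding rep_def by blast
qed

lemma rep_T: assumes f: "T \<subseteq> S_of f" "arrow X f Y" "X \<in> \<Gamma>" shows "rep X f f"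
proof -
  have "arrow X pone X" using arrow_one arrowD(1)[OF f(2)] by blast
  moreover have "f = pmul pone f" using one_mul(2)[OF arrowD(3)[OF f(2)]] by simp
  ultimately show ?thesis using f N_one unfolding rep_def by blast
qed

text \<open>As \<open>T\<close> may fail to be an object, the product is formed over the overgroup \<open>S\<^bsub>f\<^sup>-\<^sup>1\<^esub> \<inter> S\<^sub>k\<close> of \<open>T\<close> and \<open>B\<close>.\<close>

lemma T_mul:
  assumes f: "T \<subseteq> S_of f" "arrow A f B" "A \<in> \<Gamma>" and k: "T \<subseteq> S_of k" "arrow B k C"
  shows "T \<subseteq> S_of (pmul f k)"
proof -
  have fG: "f \<in> elements_over \<Gamma>" using elements_overI[OF f(2,3)] .
  let ?U = "S_of (pinv L f) \<inter> S_of k"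
  have fc: "f \<in> pcarrier L" "k \<in> pcarrier L" using arrowD(3)[OF f(2)] arrowD(3)[OF k(2)] .
  have TU: "T \<subseteq> ?U" using T_image(2)[OF fG f(1)] k(1) by blast
  have "B \<subseteq> ?U" using arrow_S_of[OF arrow_inv[OF f(2)]] arrow_S_of[OF k(2)] by blast
  moreover have "pg_subgroup L ?U" using inter_subgroup S_of_subgroup fc inv_closed by blast
  moreover have "?U \<subseteq> S" using S_of_sub by blast
  ultimately have U: "?U \<in> \<Delta>" using Delta_over[OF arrowD(2)[OF f(2)]] by blast
  have a: "arrow ?U (pinv L f) (pconj L (pinv L f) ` ?U)" using arrowI[OF inv_closed[OF fc(1)] U] by blast
  have b: "arrow (pconj L (pinv L f) ` ?U) f ?U" using arrow_inv[OF a] inv_inv[OF fc(1)] by simp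
  have c: "arrow ?U k (pconj L k ` ?U)" using arrowI[OF fc(2) U] by blast
  have "T = pconj L (pinv L f) ` T"
  proof -
    have "pinv L f \<in> elements_over \<Gamma>" using elements_overI[OF arrow_inv[OF f(2)] G_arrow[OF f(2,3)]] .
    then show ?thesis using T_image(1) T_image(2)[OF fG f(1)] by simp
  qed
  then have "T \<subseteq> pconj L (pinv L f) ` ?U" using TU by blast
  then show ?thesis using arrow_S_of[OF arrow_mul(2)[OF b c]] by blast
qed

text \<open>One has \<open>n f n' k = n (f n' f\<^sup>-\<^sup>1) f k\<close>, where the bracket is defined because \<open>f\<^sup>-\<^sup>1\<close> is defined on the
  image of \<open>Y\<close> under \<open>n'\<close>.\<close>

lemma rep_mul:
  assumes g: "rep X g f" and gY: "arrow X g Y" and h: "rep Y h k"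
  shows "rep X (pmul g h) (pmul f k)"
proof -
  from g obtain n A Y1 where n: "n \<in> N" "arrow X n A" "arrow A f Y1" "g = pmul n f" "arrow X g Y1"
    "X \<in> \<Gamma>" "A \<in> \<Gamma>" "Y1 \<in> \<Gamma>" "T \<subseteq> S_of f" "f \<in> elements_over \<Gamma>" "X \<subseteq> S_of f" by (rule repE)
  have "Y1 = Y" using arrowD(5)[OF n(5)] arrowD(5)[OF gY] by simp
  then have fY: "arrow A f Y" and YG: "Y \<in> \<Gamma>" using n by auto
  from h obtain n' B C where n': "n' \<in> N" "arrow Y n' B" "arrow B k C" "h = pmul n' k" "arrow Y h C"
    "Y \<in> \<Gamma>" "B \<in> \<Gamma>" "C \<in> \<Gamma>" "T \<subseteq> S_of k" "k \<in> elements_over \<Gamma>" "Y \<subseteq> S_of k" by (rule repE)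
  note fi = arrow_inv[OF fY]
  have fic: "pinv L f \<in> pcarrier L" using arrowD(3)[OF fi] .
  have "B \<subseteq> S_of (pinv L f)"
    by (rule N_moves_arrow[OF n'(1,2) fic T_image(2)[OF n(10,9)] arrow_S_of[OF fi]])
  then obtain A' where fi': "arrow B (pinv L f) A'" using arrowI[OF fic arrowD(2)[OF n'(2)]] by blast
  have f': "arrow A' f B" using arrow_inv[OF fi'] inv_inv[OF arrowD(3)[OF fY]] by simp
  let ?m = "pconj L (pinv L f) n'"
  have m: "?m \<in> N" "arrow A ?m A'" "?m = pmul f (pmul n' (pinv L f))"
    using N_conj[OF n'(1,6,2) fi fi'] conj_elt(2,3)[OF n'(2) fi fi'] inv_inv[OF arrowD(3)[OF fY]] by auto
  have mf: "pmul ?m f = pmul f n'"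
  proof -
    have "pmul (pmul f (pmul n' (pinv L f))) f = pmul f (pmul (pmul n' (pinv L f)) f)"
      by (rule mul_assoc(1)[OF fY arrow_mul(2)[OF n'(2) fi'] f'])
    then show ?thesis using m(3) mul_inv_cancel_right[OF n'(2) f'] by simp
  qed
  have fk: "arrow A' (pmul f k) C" using arrow_mul(2)[OF f' n'(3)] .
  have "pmul g h = pmul n (pmul f (pmul n' k))"
    unfolding n(4) n'(4) by (rule mul_assoc(1)[OF n(2) fY arrow_mul(2)[OF n'(2,3)]])
  also have "pmul f (pmul n' k) = pmul (pmul f n') k" using mul_assoc(1)[OF fY n'(2,3)] by simp
  also have "\<dots> = pmul ?m (pmul f k)" unfolding mf[symmetric] by (rule mul_assoc(1)[OF m(2) f' n'(3)])
  also have "pmul n (pmul ?m (pmul f k)) = pmul (pmul n ?m) (pmul f k)" using mul_assoc(1)[OF n(2) m(2) fk] by simp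
  finally have "pmul g h = pmul (pmul n ?m) (pmul f k)" .
  moreover have "pmul n ?m \<in> N" using N_mul[OF n(1) m(1) n(6,2) m(2)] .
  moreover have "T \<subseteq> S_of (pmul f k)" using T_mul[OF n(9) f' G_arrow[OF m(2) n(7)] n'(9,3)] .
  ultimately show ?thesis using n(6) arrow_mul(2)[OF n(2) m(2)] fk unfolding rep_def by blast
qed

lemma rep_inv:
  assumes g: "rep X g f" and gY: "arrow X g Y" shows "rep Y (pinv L g) (pinv L f)"
proof -
  from g obtain n A Y1 where n: "n \<in> N" "arrow X n A" "arrow A f Y1" "g = pmul n f" "arrow X g Y1"
    "X \<in> \<Gamma>" "A \<in> \<Gamma>" "Y1 \<in> \<Gamma>" "T \<subseteq> S_of f" "f \<in> elements_over \<Gamma>" "X \<subseteq> S_of f" by (rule repE)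
  have "Y1 = Y" using arrowD(5)[OF n(5)] arrowD(5)[OF gY] by simp
  then have fY: "arrow A f Y" and YG: "Y \<in> \<Gamma>" using n by auto
  obtain Z where fZ: "arrow X f Z" using arrowI[OF arrowD(3)[OF fY] arrowD(1)[OF n(2)] n(11)] by blast
  note ni = arrow_inv[OF n(2)] and fi = arrow_inv[OF fY] and fZi = arrow_inv[OF fZ]
  let ?m = "pconj L f (pinv L n)"
  have m: "?m \<in> N" "arrow Y ?m Z" "?m = pmul (pinv L f) (pmul (pinv L n) f)"
    using N_conj[OF N_inv[OF n(1)] n(7) ni fY fZ] conj_elt(2,3)[OF ni fY fZ] by auto
  have "pmul ?m (pinv L f) = pmul (pinv L f) (pmul (pmul (pinv L n) f) (pinv L f))"
    unfolding m(3) by (rule mul_assoc(1)[OF fi arrow_mul(2)[OF ni fZ] fZi])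
  also have "pmul (pmul (pinv L n) f) (pinv L f) = pinv L n" by (rule mul_cancel_right[OF ni fZ])
  finally have "pinv L g = pmul ?m (pinv L f)" unfolding n(4) using inv_mul_arrow[OF n(2) fY] by simp
  then show ?thesis using YG m fZi T_image(2)[OF n(10,9)] unfolding rep_def by blast
qed

lemma rep_restrict:
  assumes g: "rep X g f" and X: "X' \<in> \<Gamma>" "X' \<subseteq> X" shows "rep X' g f"
proof -
  from g obtain n A Y where n: "n \<in> N" "arrow X n A" "arrow A f Y" "g = pmul n f"
    "T \<subseteq> S_of f" by (rule repE)
  have a: "arrow X' n (pconj L n ` X')" using arrow_restrict[OF n(2) G_Delta[OF X(1)] X(2)] .
  have "pconj L n ` X' \<subseteq> A" using arrowD(5)[OF n(2)] X(2) by blast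
  then have "arrow (pconj L n ` X') f (pconj L f ` pconj L n ` X')"
    using arrow_restrict[OF n(3) arrowD(2)[OF a]] by blast
  then show ?thesis using X(1) a n unfolding rep_def by blast
qed

lemma rep_unique:
  assumes g: "rep X g f" "rep X g k"
  shows "pmul k (pinv L f) \<in> N"
proof -
  from g(1) obtain n A Y where n: "n \<in> N" "arrow X n A" "arrow A f Y" "g = pmul n f" "arrow X g Y"
    "X \<in> \<Gamma>" by (rule repE)
  from g(2) obtain n' A' Y' where n': "n' \<in> N" "arrow X n' A'" "arrow A' k Y'" "g = pmul n' k" "arrow X g Y'"
    "A' \<in> \<Gamma>" by (rule repE)
  have "Y' = Y" using arrowD(5)[OF n(5)] arrowD(5)[OF n'(5)] by simp
  then have k: "arrow A' k Y" using n' by simp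
  note ni = arrow_inv[OF n'(2)]
  have m: "arrow A' (pmul (pinv L n') n) A" using arrow_mul(2)[OF ni n(2)] .
  have "pmul (pmul (pinv L n') n) f = pmul (pinv L n') (pmul n f)" by (rule mul_assoc(1)[OF ni n(2,3)])
  also have "\<dots> = k" using n(4) n'(4) inv_mul_cancel[OF n'(2) k] by simp
  finally have "pmul k (pinv L f) = pmul (pinv L n') n" using mul_cancel_right[OF m n(3)] by simp
  then show ?thesis using N_mul[OF N_inv[OF n'(1)] n(1) n'(6) ni n(2)] by simp
qed

lemma rep_kernel: assumes g: "rep X g f" shows "g \<in> N \<longleftrightarrow> f \<in> N"
proof -
  from g obtain n A Y where n: "n \<in> N" "arrow X n A" "arrow A f Y" "g = pmul n f" "arrow X g Y"
    "X \<in> \<Gamma>" "A \<in> \<Gamma>" by (rule repE)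
  have "f = pmul (pinv L n) g" using inv_mul_cancel[OF n(2,3)] n(4) by simp
  then show ?thesis using N_mul[OF n(1) _ n(6,2,3)] N_mul[OF N_inv[OF n(1)] _ n(7) arrow_inv[OF n(2)] n(5)] n(4) by auto
qed

lemma N_NG_normal:
  assumes Z: "Z \<in> \<Gamma>" shows "{x \<in> N. arrow Z x Z} \<lhd> NG Z"
proof -
  have ZD: "Z \<in> \<Delta>" using G_Delta[OF Z] .
  let ?K = "{x \<in> N. arrow Z x Z}"
  have sub: "?K \<subseteq> pnormalizer L Z" using normalizer_iff[OF ZD] by blast
  have "pg_subgroup L ?K" unfolding pg_subgroup_in[OF normalizer_subgroup[OF ZD] sub]
    using N_one arrow_one[OF ZD] N_inv arrow_inv N_mul[OF _ _ Z] arrow_mul(2) by blast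
  moreover have "pconj L m h \<in> ?K" if m: "arrow Z m Z" and h: "h \<in> ?K" for m h
  proof -
    have "h \<in> N" "arrow Z h Z" using h by auto
    then show ?thesis using N_conj[OF _ Z _ m m] conj_elt(2)[OF _ m m] by simp
  qed
  ultimately show ?thesis using NG_normalI[OF ZD] by blast
qed

text \<open>Normalizers grow in the \<open>p\<close>-group \<open>T Z\<close>, and an element \<open>t z\<close> normalizes \<open>Z\<close> iff \<open>t\<close> does.\<close>

lemma T_normalizer_outside:
  assumes Z: "Z \<in> \<Delta>" and T: "\<not> T \<subseteq> Z" shows "\<exists>t\<in>T. arrow Z t Z \<and> t \<notin> Z"
proof -
  interpret SG: Group.group SG by (rule SG_group)
  note P = T_product[OF Delta_subgroup[OF Z] Delta_sub[OF Z]]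
  have "Z \<subset> T <#>\<^bsub>SG\<^esub> Z" using P(3,4) T by blast
  then obtain y where y: "y \<in> T <#>\<^bsub>SG\<^esub> Z" "y \<notin> Z" "arrow Z y Z"
    using S_normalizer_grows[OF Z P(1,2)] by blast
  then obtain t z where tz: "t \<in> T" "z \<in> Z" "y = t \<otimes>\<^bsub>SG\<^esub> z" by (auto simp: set_mult_def)
  have S: "t \<in> S" "z \<in> S" using tz T_sub Delta_sub[OF Z] by auto
  have e: "y = pmul t z" using tz(3) pg_group_simps(3)[OF S] by simp
  have zZ: "arrow Z z Z" using arrow_S[OF Z tz(2)] .
  have "pmul y (pinv L z) = t" unfolding e
    using mul_cancel_right[OF arrow_S[OF S_Delta S(1)] arrow_S[OF S_Delta S(2)]] .
  then have "arrow Z t Z" using arrow_mul(2)[OF y(3) arrow_inv[OF zZ]] by simp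
  moreover have "t \<notin> Z" using subgroup_mul[OF Delta_subgroup[OF Z] _ tz(2)] e y(2) by blast
  ultimately show ?thesis using tz(1) by blast
qed

text \<open>Induction on the index of \<open>X\<close> in \<open>S\<close>. If \<open>T \<le> X\<close>, then \<open>g\<close> normalizes \<open>T\<close> itself. Otherwise let \<open>h\<close>
  and \<open>k\<close> move \<open>X\<close> and \<open>Y = X\<^sup>g\<close> to a fully normalized conjugate \<open>Z\<close>, and be defined on \<open>N\<^sub>S(X)\<close> and
  \<open>N\<^sub>S(Y)\<close>. These are larger objects, so \<open>h\<close> and \<open>k\<close> have representatives by induction. The loop
  \<open>h\<^sup>-\<^sup>1 g k\<close> lies in \<open>N\<^sub>L(Z)\<close>. By the Frattini argument it is the product of an element of \<open>N\<close> and an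
  element that normalizes \<open>N\<^sub>T(Z)\<close>, and hence the object \<open>Z N\<^sub>T(Z)\<close>, which is again larger than \<open>Z\<close>.\<close>

lemma rep_exists:
  assumes "X \<in> \<Gamma>" "arrow X g Y" shows "\<exists>f. rep X g f"
  using assms
proof (induction "card S - card X" arbitrary: X g Y rule: less_induct)
  case less
  note XG = less.prems(1) and g = less.prems(2)
  have XD: "X \<in> \<Delta>" using G_Delta[OF XG] .
  have IH: "\<exists>f. rep W k f" if "W \<in> \<Delta>" "Z \<subset> W" "card Z = card X" "Z \<in> \<Gamma>" "arrow W k V" for W Z k V
  proof -
    have fW: "finite W" using finite_subset[OF Delta_sub[OF that(1)] finite_S] .
    have "card X < card W" using psubset_card_mono[OF fW that(2)] that(3) by simp
    moreover have "card W \<le> card S" using card_mono[OF finite_S Delta_sub[OF that(1)]] .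
    ultimately show ?thesis using less.hyps[OF _ _ that(5)] G_over[OF that(4) _ that(1)] that(2) by auto
  qed
  show ?case
  proof (cases "T \<subseteq> X")
    case True
    then have "T \<subseteq> S_of g" using arrow_S_of[OF g] by blast
    then show ?thesis using rep_T[OF _ g XG] by blast
  next
    case False
    have XS: "card X < card S" using False T_sub psubset_card_mono[OF finite_S] Delta_sub[OF XD] by blast
    have grow: "\<exists>f. rep W h f" if w: "W \<in> \<Gamma>" "card W = card X" "arrow W h Z" "NS W \<subseteq> S_of h" for W h Z
    proof -
      have WD: "W \<in> \<Delta>" using G_Delta[OF w(1)] .
      have "W \<noteq> S" using XS w(2) by auto
      then have W: "W \<subset> NS W" using NS_grows[OF WD] by blast
      obtain f where "rep (NS W) h f"
        using IH[OF NS_Delta[OF WD] W w(2,1) arrowI[OF arrowD(3)[OF w(3)] NS_Delta[OF WD] w(4)]] by blast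
      then show ?thesis using rep_restrict[OF _ w(1)] W by blast
    qed
    obtain h0 Z where h0: "arrow X h0 Z" "fully_norm Z" using fully_norm_ex[OF XD] by blast
    have ZG: "Z \<in> \<Gamma>" using G_arrow[OF h0(1) XG] .
    have ZD: "Z \<in> \<Delta>" using G_Delta[OF ZG] .
    have YG: "Y \<in> \<Gamma>" using G_arrow[OF g XG] .
    have cZ: "card Z = card X" "card Y = card X" using arrow_card[OF h0(1)] arrow_card[OF g] by auto
    obtain h where h: "arrow X h Z" "NS X \<subseteq> S_of h" using fully_norm_extend[OF h0(2,1)] by blast
    obtain k where k: "arrow Y k Z" "NS Y \<subseteq> S_of k"
      using fully_norm_extend[OF h0(2) arrow_mul(2)[OF arrow_inv[OF g] h0(1)]] by blast
    obtain f1 where f1: "rep X h f1" using grow[OF XG refl h] by blast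
    obtain f3 where f3: "rep Y k f3" using grow[OF YG cZ(2) k] by blast
    let ?m = "pmul (pinv L h) (pmul g k)"
    have gk: "arrow X (pmul g k) Z" using arrow_mul(2)[OF g k(1)] .
    have m: "arrow Z ?m Z" using arrow_mul(2)[OF arrow_inv[OF h(1)] gk] .
    have "\<exists>f. rep Z ?m f"
    proof (cases "T \<subseteq> Z")
      case True
      then have "T \<subseteq> S_of ?m" using arrow_S_of[OF m] by blast
      then show ?thesis using rep_T[OF _ m ZG] by blast
    next
      case TZ: False
      let ?K = "{x \<in> N. arrow Z x Z}"
      have mN: "?m \<in> carrier (NG Z)" using m normalizer_iff[OF ZD] by (simp add: pg_group_simps)
      have T0: "NS Z \<inter> ?K = {t \<in> T. arrow Z t Z}" by (auto simp: NS_def T_def)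
      obtain \<kappa> f where kf: "\<kappa> \<in> ?K" "f \<in> carrier (NG Z)" "?m = \<kappa> \<otimes>\<^bsub>NG Z\<^esub> f"
        "\<forall>t \<in> NS Z \<inter> ?K. inv\<^bsub>NG Z\<^esub> f \<otimes>\<^bsub>NG Z\<^esub> t \<otimes>\<^bsub>NG Z\<^esub> f \<in> NS Z \<inter> ?K"
        using group.frattini_argument[OF NG_group[OF ZD] prime_p NG_finite[OF ZD]
            fully_norm_sylow[OF h0(2)] N_NG_normal[OF ZG] mN] by blast
      have fZ: "arrow Z f Z" using kf(2) normalizer_iff[OF ZD] by (simp add: pg_group_simps)
      have \<kappa>: "\<kappa> \<in> N" "arrow Z \<kappa> Z" using kf(1) by auto
      have me: "?m = pmul \<kappa> f" using kf(3) pg_group_simps(3)[of \<kappa> "pnormalizer L Z" f]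
          \<kappa>(2) fZ normalizer_iff[OF ZD] by simp
      let ?T0 = "{t \<in> T. arrow Z t Z}"
      have T0s: "pg_subgroup L ?T0" "?T0 \<subseteq> NS Z"
      proof -
        have "?T0 = T \<inter> pnormalizer L Z" using normalizer_iff[OF ZD] by blast
        then show "pg_subgroup L ?T0" using inter_subgroup[OF T_subgroup normalizer_subgroup[OF ZD]] by simp
        show "?T0 \<subseteq> NS Z" using T_sub by (auto simp: NS_def)
      qed
      note W = normalizing_product[OF ZD T0s]
      let ?W = "Z <#>\<^bsub>SG\<^esub> ?T0"
      have "?T0 \<subseteq> S_of f"
      proof
        fix t assume t: "t \<in> ?T0"
        then have tZ: "arrow Z t Z" by blast
        have "t \<in> NS Z \<inter> ?K" using t T0 by simp
          then have "pconj L f t \<in> NS Z" using kf(4)[rule_format, of t] NG_conj[OF ZD fZ tZ] by simp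
        then show "t \<in> S_of f" using conj_elt(1)[OF tZ fZ fZ] t T_sub NS_sub by (auto simp: S_of_def)
      qed
      then have "?W \<subseteq> S_of f" using W(6)[OF S_of_subgroup[OF arrowD(3)[OF fZ]] arrow_S_of[OF fZ]] by blast
      then have fW: "arrow ?W f (pconj L f ` ?W)" using arrowI[OF arrowD(3)[OF fZ] W(1)] by blast
      have ZW: "Z \<subset> ?W" using T_normalizer_outside[OF ZD TZ] W(3,4) by blast
      obtain f2 where "rep ?W f f2" using IH[OF W(1) ZW cZ(1) ZG fW] by blast
      then have "rep Z f f2" using rep_restrict[OF _ ZG W(3)] by blast
      then have "rep Z ?m (pmul pone f2)" unfolding me using rep_mul[OF rep_N[OF \<kappa> ZG] \<kappa>(2)] by blast
      then show ?thesis by blast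
    qed
    then obtain f2 where f2: "rep Z ?m f2" by blast
    have "rep X (pmul h ?m) (pmul f1 f2)" using rep_mul[OF f1 h(1) f2] .
    then have "rep X (pmul g k) (pmul f1 f2)" using mul_inv_cancel[OF h(1) gk] by simp
    then have "rep X (pmul (pmul g k) (pinv L k)) (pmul (pmul f1 f2) (pinv L f3))"
      using rep_mul[OF _ gk rep_inv[OF f3 k(1)]] by blast
    then show ?thesis using mul_cancel_right[OF g k(1)] by auto
  qed
qed

end

section \<open>Adding one conjugacy class of objects\<close>

context locality_with_normal
begin

text \<open>Equality of images in the quotient by \<open>N\<close>, for arrows with common source and target.\<close>

definition cong_N :: "'a set \<Rightarrow> 'a set \<Rightarrow> 'a \<Rightarrow> 'a \<Rightarrow> bool" where
  "cong_N A B f k \<longleftrightarrow> A \<in> \<Gamma> \<and> arrow A f B \<and> arrow A k B \<and> pmul f (pinv L k) \<in> N"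

lemma cong_ND: assumes "cong_N A B f k" shows "A \<in> \<Gamma>" "arrow A f B" "arrow A k B" "pmul f (pinv L k) \<in> N" "B \<in> \<Gamma>"
  using assms G_arrow by (auto simp: cong_N_def)

lemma cong_N_refl: assumes "A \<in> \<Gamma>" "arrow A f B" shows "cong_N A B f f"
  using assms inv_mul(4)[OF arrowD(3)[OF assms(2)]] N_one by (simp add: cong_N_def)

lemma cong_N_sym: assumes "cong_N A B f k" shows "cong_N A B k f"
proof -
  note e = cong_ND[OF assms]
  have "pinv L (pmul f (pinv L k)) = pmul k (pinv L f)"
    using inv_mul_arrow[OF e(2) arrow_inv[OF e(3)]] inv_inv[OF arrowD(3)[OF e(3)]] by simp
  then show ?thesis using e N_inv[OF e(4)] by (simp add: cong_N_def)
qed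

lemma cong_N_trans: assumes "cong_N A B f k" "cong_N A B k h" shows "cong_N A B f h"
proof -
  note e = cong_ND[OF assms(1)] and e' = cong_ND[OF assms(2)]
  note fk = arrow_mul(2)[OF e(2) arrow_inv[OF e(3)]] and kh = arrow_mul(2)[OF e'(2) arrow_inv[OF e'(3)]]
  have "pmul (pmul f (pinv L k)) (pmul k (pinv L h)) = pmul f (pmul (pinv L k) (pmul k (pinv L h)))"
    by (rule mul_assoc(1)[OF e(2) arrow_inv[OF e(3)] kh])
  also have "pmul (pinv L k) (pmul k (pinv L h)) = pinv L h" by (rule inv_mul_cancel[OF e(3) arrow_inv[OF e'(3)]])
  finally have "pmul f (pinv L h) \<in> N" using N_mul[OF e(4) e'(4) e(1) fk kh] by simp
  then show ?thesis using e e' by (simp add: cong_N_def)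
qed

lemma cong_N_mul: assumes "cong_N A B f k" "cong_N B C h l" shows "cong_N A C (pmul f h) (pmul k l)"
proof -
  note e = cong_ND[OF assms(1)] and e' = cong_ND[OF assms(2)]
  note fi = arrow_inv[OF e(2)] and ki = arrow_inv[OF e(3)] and li = arrow_inv[OF e'(3)]
  have hl: "arrow B (pmul h (pinv L l)) B" using arrow_mul(2)[OF e'(2) li] .
  let ?c = "pconj L (pinv L f) (pmul h (pinv L l))"
  have c: "?c \<in> N" "arrow A ?c A" "?c = pmul f (pmul (pmul h (pinv L l)) (pinv L f))"
    using N_conj[OF e'(4) e(5) hl fi fi] conj_elt(2,3)[OF hl fi fi] inv_inv[OF arrowD(3)[OF e(2)]] by auto
  note fk = arrow_mul(2)[OF e(2) ki]
  have "pmul ?c (pmul f (pinv L k)) = pmul f (pmul (pmul (pmul h (pinv L l)) (pinv L f)) (pmul f (pinv L k)))"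
    unfolding c(3) by (rule mul_assoc(1)[OF e(2) arrow_mul(2)[OF hl fi] fk])
  also have "pmul (pmul (pmul h (pinv L l)) (pinv L f)) (pmul f (pinv L k)) =
      pmul (pmul h (pinv L l)) (pmul (pinv L f) (pmul f (pinv L k)))"
    by (rule mul_assoc(1)[OF hl fi fk])
  also have "pmul (pinv L f) (pmul f (pinv L k)) = pinv L k" by (rule inv_mul_cancel[OF e(2) ki])
  also have "pmul (pmul h (pinv L l)) (pinv L k) = pmul h (pmul (pinv L l) (pinv L k))"
    by (rule mul_assoc(1)[OF e'(2) li ki])
  also have "pmul f (pmul h (pmul (pinv L l) (pinv L k))) = pmul (pmul f h) (pmul (pinv L l) (pinv L k))"
    using mul_assoc(1)[OF e(2) e'(2) arrow_mul(2)[OF li ki]] by simp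
  also have "pmul (pinv L l) (pinv L k) = pinv L (pmul k l)" using inv_mul_arrow[OF e(3) e'(3)] by simp
  finally have "pmul (pmul f h) (pinv L (pmul k l)) \<in> N" using N_mul[OF c(1) e(4,1) c(2) fk] by simp
  then show ?thesis using e(1) arrow_mul(2)[OF e(2) e'(2)] arrow_mul(2)[OF e(3) e'(3)] by (simp add: cong_N_def)
qed

lemma cong_N_kernel: assumes "cong_N A B f k" shows "f \<in> N \<longleftrightarrow> k \<in> N"
proof -
  have 1: "f \<in> N" if "cong_N A B f k" "k \<in> N" for f k
  proof -
    note e = cong_ND[OF that(1)]
    have "pmul (pmul f (pinv L k)) k = f" by (rule mul_inv_cancel_right[OF e(2,3)])
    then show ?thesis using N_mul[OF e(4) that(2) e(1) arrow_mul(2)[OF e(2) arrow_inv[OF e(3)]] e(3)] by simp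
  qed
  show ?thesis using 1[OF assms] 1[OF cong_N_sym[OF assms]] by blast
qed

text \<open>In the quotient by \<open>N\<close>, all arrows from \<open>P\<close> become arrows from \<open>P T\<close>.\<close>

definition with_T :: "'a set \<Rightarrow> 'a set" where "with_T P = T <#>\<^bsub>SG\<^esub> P"

lemma with_T:
  assumes "P \<in> \<Delta>"
  shows "pg_subgroup L (with_T P)" "with_T P \<subseteq> S" "T \<subseteq> with_T P" "P \<subseteq> with_T P" "with_T P \<in> \<Delta>"
    "\<And>Y. pg_subgroup L Y \<Longrightarrow> T \<subseteq> Y \<Longrightarrow> P \<subseteq> Y \<Longrightarrow> with_T P \<subseteq> Y"
proof -
  note P = T_product[OF Delta_subgroup[OF assms] Delta_sub[OF assms]]
  show "pg_subgroup L (with_T P)" "with_T P \<subseteq> S" "T \<subseteq> with_T P" "P \<subseteq> with_T P" "with_T P \<in> \<Delta>"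
    using P(1-4) Delta_over[OF assms P(4,2,1)] by (auto simp: with_T_def)
  show "with_T P \<subseteq> Y" if "pg_subgroup L Y" "T \<subseteq> Y" "P \<subseteq> Y" for Y using P(5)[OF that] by (simp add: with_T_def)
qed

lemma with_T_N: assumes n: "n \<in> N" "arrow P n Q" shows "with_T Q = with_T P"
proof -
  have 1: "with_T Q \<subseteq> with_T P" if "n \<in> N" "arrow P n Q" for n P Q
  proof -
    note P = with_T[OF arrowD(1)[OF that(2)]]
    have "Q \<subseteq> with_T P" using N_moves_in[OF that(1) P(1,3) arrow_S_of[OF that(2)] P(4)] arrowD(5)[OF that(2)] by simp
    then show ?thesis using with_T(6)[OF arrowD(2)[OF that(2)] P(1,3)] by blast
  qed
  show ?thesis using 1[OF n] 1[OF N_inv[OF n(1)] arrow_inv[OF n(2)]] by blast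
qed

lemma with_T_T:
  assumes f: "f \<in> elements_over \<Gamma>" "T \<subseteq> S_of f" "arrow P f Q" shows "arrow (with_T P) f (with_T Q)"
proof -
  have 1: "with_T P \<subseteq> S_of f \<and> pconj L f ` with_T P \<subseteq> with_T Q" if f: "f \<in> elements_over \<Gamma>" "T \<subseteq> S_of f" "arrow P f Q" for f P Q
  proof -
    note P = arrowD(1,2)[OF f(3)]
    have fc: "f \<in> pcarrier L" using elements_overD(1)[OF f(1)] .
    have s: "with_T P \<subseteq> S_of f" using with_T(6)[OF P(1) S_of_subgroup[OF fc] f(2) arrow_S_of[OF f(3)]] .
    have "pconj L f x \<in> with_T Q" if "x \<in> with_T P" for x
    proof -
      obtain t q where tq: "t \<in> T" "q \<in> P" "x = t \<otimes>\<^bsub>SG\<^esub> q" using \<open>x \<in> with_T P\<close> by (auto simp: with_T_def set_mult_def)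
      have "t \<in> S" "q \<in> S" using tq T_sub Delta_sub[OF P(1)] by auto
      then have x: "x = pmul t q" using tq(3) pg_group_simps(3) by simp
      have S_of: "t \<in> S_of f" "q \<in> S_of f" using tq f(2) arrow_S_of[OF f(3)] by auto
      have "pconj L f t \<in> with_T Q" using T_image(1)[OF f(1,2)] tq(1) with_T(3)[OF P(2)] by blast
      moreover have "pconj L f q \<in> with_T Q" using arrowD(5)[OF f(3)] tq(2) with_T(4)[OF P(2)] by blast
      ultimately show ?thesis unfolding x S_of_mul(2)[OF fc S_of] by (rule subgroup_mul[OF with_T(1)[OF P(2)]])
    qed
    then show ?thesis using s by blast
  qed
  note F = 1[OF f]
  have fi: "pinv L f \<in> elements_over \<Gamma>" using elements_overI[OF arrow_inv[OF elements_overD(3)[OF f(1)]] G_arrow[OF elements_overD(3,2)[OF f(1)]]] .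
  note I = 1[OF fi T_image(2)[OF f(1,2)] arrow_inv[OF f(3)]]
  have a: "arrow (with_T P) f (pconj L f ` with_T P)"
    using arrowI[OF elements_overD(1)[OF f(1)] with_T(5)[OF arrowD(1)[OF f(3)]]] F by blast
  have "with_T Q \<subseteq> pconj L f ` with_T P"
  proof
    fix y assume y: "y \<in> with_T Q"
    then have "pconj L (pinv L f) y \<in> with_T P" using I by blast
    moreover have "pconj L f (pconj L (pinv L f) y) = y"
      using conj_undo(2)[of y "pinv L f"] I y elements_overD(1)[OF fi] inv_inv[OF elements_overD(1)[OF f(1)]]
      by (auto simp: S_of_def subset_iff)
    ultimately show "y \<in> pconj L f ` with_T P" by (metis imageI)
  qed
  then show ?thesis using a F by (metis subset_antisym)
qed

lemma with_T_rep:
  assumes r: "rep X g f" and P: "arrow P g Q" "P \<subseteq> X" shows "arrow (with_T P) f (with_T Q)"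
proof -
  from r obtain n A Y where n: "n \<in> N" "arrow X n A" "arrow A f Y" "g = pmul n f" "arrow X g Y"
    "X \<in> \<Gamma>" "A \<in> \<Gamma>" "Y \<in> \<Gamma>" "T \<subseteq> S_of f" "f \<in> elements_over \<Gamma>" "X \<subseteq> S_of f" by (rule repE)
  let ?P = "pconj L n ` P"
  have a: "arrow P n ?P" using arrow_restrict[OF n(2) arrowD(1)[OF P(1)] P(2)] .
  have "?P \<subseteq> A" using arrowD(5)[OF n(2)] P(2) by blast
  then have b: "arrow ?P f (pconj L f ` ?P)" using arrow_restrict[OF n(3) arrowD(2)[OF a]] by blast
  have "pconj L f ` ?P = Q" using arrowD(5)[OF arrow_mul(2)[OF a b]] arrowD(5)[OF P(1)] n(4) by simp
  then have "arrow (with_T ?P) f (with_T Q)" using with_T_T[OF n(10,9) b] by simp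
  then show ?thesis using with_T_N[OF n(1) a] by simp
qed

text \<open>Both are compared with a representative over the largest object \<open>S\<^sub>g\<close>.\<close>

lemma rep_cong_N:
  assumes f: "rep X g f" "P \<subseteq> X" and k: "rep Y g k" "P \<subseteq> Y" and P: "arrow P g Q" "with_T P \<in> \<Gamma>"
  shows "cong_N (with_T P) (with_T Q) f k"
proof -
  note fX = rep_arrow(1,2)[OF f(1)] and kY = rep_arrow(1,2)[OF k(1)]
  have gG: "g \<in> elements_over \<Gamma>" using elements_overI[OF fX(2,1)] .
  obtain h where h: "rep (S_of g) g h" using rep_exists[OF elements_overD(2,3)[OF gG]] by blast
  have "rep X g h" "rep Y g h" using rep_restrict[OF h] fX kY arrow_S_of by auto
  then have "pmul h (pinv L f) \<in> N" "pmul h (pinv L k) \<in> N" using rep_unique f(1) k(1) by blast+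
  moreover have "arrow (with_T P) f (with_T Q)" "arrow (with_T P) k (with_T Q)" "arrow (with_T P) h (with_T Q)"
    using with_T_rep[OF f(1) P(1) f(2)] with_T_rep[OF k(1) P(1) k(2)] with_T_rep[OF h P(1) arrow_S_of[OF P(1)]] by auto
  ultimately have "cong_N (with_T P) (with_T Q) h f" "cong_N (with_T P) (with_T Q) h k" using P(2) by (auto simp: cong_N_def)
  then show ?thesis using cong_N_sym cong_N_trans by blast
qed

end

text \<open>The class of \<open>R\<close> is added to \<open>\<Gamma>\<close>. The object \<open>Ob\<close> will be \<open>O\<^sub>p(N\<^sub>L(R))\<close>; its existence says that
  all loops at \<open>R\<close> already belong to the smaller locality.\<close>

locale elementary_step = locality_with_normal +
  fixes R :: "'a set" and Ob :: "'a set"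
  assumes R_fully: "fully_norm R" and R_out: "R \<notin> \<Gamma>"
    and larger: "\<And>P. P \<in> \<Delta> \<Longrightarrow> card R < card P \<Longrightarrow> P \<in> \<Gamma>"
    and Ob_Delta: "Ob \<in> \<Delta>" and R_Ob: "R \<subset> Ob" and Ob_loop: "\<And>m. arrow R m R \<Longrightarrow> arrow Ob m Ob"
begin

definition R_class :: "'a set set" where "R_class = {Q. \<exists>g. arrow R g Q}"

lemma R_Delta: "R \<in> \<Delta>" using R_fully by (simp add: fully_norm_def)

lemma R_classD: assumes "P \<in> R_class" shows "P \<in> \<Delta>" "card P = card R" "P \<notin> \<Gamma>" "P \<subseteq> S" "finite P"
proof -
  obtain g where g: "arrow R g P" using assms by (auto simp: R_class_def)
  show "P \<in> \<Delta>" "card P = card R" "P \<subseteq> S" using arrowD[OF g] arrow_card[OF g] by auto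
  then show "finite P" using finite_subset finite_S by blast
  show "P \<notin> \<Gamma>" using G_arrow[OF arrow_inv[OF g]] R_out by blast
qed

lemma R_class_R: "R \<in> R_class" using arrow_one[OF R_Delta] by (auto simp: R_class_def)

lemma R_class_arrow: "P \<in> R_class \<Longrightarrow> arrow P g Q \<Longrightarrow> Q \<in> R_class" unfolding R_class_def using arrow_mul(2) by blast

lemma R_class_over: assumes "P \<in> R_class" "P \<subset> Q" "Q \<in> \<Delta>" shows "Q \<in> \<Gamma>"
  using larger[OF assms(3)] psubset_card_mono[OF finite_subset[OF Delta_sub[OF assms(3)] finite_S] assms(2)]
    R_classD(2)[OF assms(1)] by simp

definition Gplus :: "'a set set" where "Gplus = \<Gamma> \<union> R_class"

lemma closed_Gplus: "closed Gplus"
  unfolding closed_def Gplus_def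
proof (intro conjI allI impI)
  show "\<Gamma> \<union> R_class \<subseteq> \<Delta>" using G_Delta R_classD(1) by blast
  show "S \<in> \<Gamma> \<union> R_class" using G_S by blast
  show "Q \<in> \<Gamma> \<union> R_class" if "P \<in> \<Gamma> \<union> R_class" "arrow P g Q" for P g Q using that G_arrow R_class_arrow by blast
  show "Q \<in> \<Gamma> \<union> R_class" if "P \<in> \<Gamma> \<union> R_class" "P \<subseteq> Q" "Q \<in> \<Delta>" for P Q
    using that G_over R_class_over[of P Q] by blast
qed

lemma R_class_S_of: assumes "P \<in> R_class" "arrow P g Q" shows "S_of g = P \<or> g \<in> elements_over \<Gamma>"
  using R_class_over[OF assms(1) _ S_of_Delta[OF arrowD(3)[OF assms(2)]]] arrow_S_of[OF assms(2)]
    arrowD(3)[OF assms(2)] by (auto simp: elements_over_def)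

lemma Ob_G: "Ob \<in> \<Gamma>" using R_class_over[OF R_class_R R_Ob Ob_Delta] .

lemma NS_G: assumes "P \<in> R_class" shows "NS P \<in> \<Gamma>"
proof -
  have "P \<noteq> S" using R_classD(3)[OF assms] G_S by blast
  then show ?thesis using R_class_over[OF assms NS_grows[OF R_classD(1)[OF assms]] NS_Delta[OF R_classD(1)[OF assms]]] by blast
qed

text \<open>Being defined on \<open>N\<^sub>S(P)\<close>, which is larger than \<open>P\<close>, this element belongs to the smaller locality.\<close>

definition to_R :: "'a set \<Rightarrow> 'a" where
  "to_R P = (SOME a. arrow P a R \<and> NS P \<subseteq> S_of a \<and> pconj L a ` NS P \<subseteq> NS R)"

lemma to_R: assumes "P \<in> R_class" shows "arrow P (to_R P) R" "arrow (NS P) (to_R P) (pconj L (to_R P) ` NS P)"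
    "pconj L (to_R P) ` NS P \<in> \<Gamma>" "to_R P \<in> elements_over \<Gamma>"
proof -
  obtain g where g: "arrow R g P" using assms by (auto simp: R_class_def)
  have "\<exists>a. arrow P a R \<and> NS P \<subseteq> S_of a \<and> pconj L a ` NS P \<subseteq> NS R"
    using fully_norm_extend[OF R_fully arrow_inv[OF g]] .
  then have a: "arrow P (to_R P) R \<and> NS P \<subseteq> S_of (to_R P) \<and> pconj L (to_R P) ` NS P \<subseteq> NS R"
    unfolding to_R_def by (rule someI_ex)
  then show "arrow P (to_R P) R" by blast
  show b: "arrow (NS P) (to_R P) (pconj L (to_R P) ` NS P)"
    using a arrowI[OF _ NS_Delta[OF R_classD(1)[OF assms]]] arrowD(3) by blast
  show "pconj L (to_R P) ` NS P \<in> \<Gamma>" using G_arrow[OF b NS_G[OF assms]] .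
  show "to_R P \<in> elements_over \<Gamma>" using elements_overI[OF b NS_G[OF assms]] .
qed

text \<open>An arrow \<open>g\<close> of the class is the product of \<open>to_R P\<close>, this loop, and the inverse of \<open>to_R Q\<close>, all
  three in the smaller locality.\<close>

definition loop :: "'a set \<Rightarrow> 'a \<Rightarrow> 'a set \<Rightarrow> 'a" where
  "loop P g Q = pmul (pinv L (to_R P)) (pmul g (to_R Q))"

lemma loop:
  assumes P: "P \<in> R_class" and g: "arrow P g Q"
  shows "arrow R (loop P g Q) R" "arrow Ob (loop P g Q) Ob" "loop P g Q \<in> elements_over \<Gamma>"
    "pmul (to_R P) (loop P g Q) = pmul g (to_R Q)"
    "pmul (pmul (to_R P) (loop P g Q)) (pinv L (to_R Q)) = g"
proof -
  note a = to_R(1)[OF P] and b = to_R(1)[OF R_class_arrow[OF P g]]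
  have gb: "arrow P (pmul g (to_R Q)) R" using arrow_mul(2)[OF g b] .
  show 1: "arrow R (loop P g Q) R" unfolding loop_def using arrow_mul(2)[OF arrow_inv[OF a] gb] .
  then show 2: "arrow Ob (loop P g Q) Ob" by (rule Ob_loop)
  then show "loop P g Q \<in> elements_over \<Gamma>" using elements_overI Ob_G by blast
  show 3: "pmul (to_R P) (loop P g Q) = pmul g (to_R Q)" unfolding loop_def by (rule mul_inv_cancel[OF a gb])
  show "pmul (pmul (to_R P) (loop P g Q)) (pinv L (to_R Q)) = g" unfolding 3 by (rule mul_cancel_right[OF g b])
qed

lemma loop_mul:
  assumes P: "P \<in> R_class" and g: "arrow P g Q" and h: "arrow Q h U"
  shows "loop P (pmul g h) U = pmul (loop P g Q) (loop Q h U)"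
proof -
  have Q: "Q \<in> R_class" using R_class_arrow[OF P g] .
  note a = to_R(1)[OF P] and b = to_R(1)[OF Q] and c = to_R(1)[OF R_class_arrow[OF Q h]]
  have "pmul (loop P g Q) (loop Q h U) =
      pmul (pinv L (to_R P)) (pmul (pmul g (to_R Q)) (loop Q h U))"
    unfolding loop_def[of P g Q] by (rule mul_assoc(1)[OF arrow_inv[OF a] arrow_mul(2)[OF g b] loop(1)[OF Q h]])
  also have "pmul (pmul g (to_R Q)) (loop Q h U) = pmul g (pmul (to_R Q) (loop Q h U))"
    by (rule mul_assoc(1)[OF g b loop(1)[OF Q h]])
  also have "\<dots> = pmul g (pmul h (to_R U))" using loop(4)[OF Q h] by simp
  also have "\<dots> = pmul (pmul g h) (to_R U)" using mul_assoc(1)[OF g h c] by simp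
  finally show ?thesis by (simp add: loop_def)
qed

lemma loop_inv:
  assumes P: "P \<in> R_class" and g: "arrow P g Q" shows "loop Q (pinv L g) P = pinv L (loop P g Q)"
proof -
  note a = to_R(1)[OF P] and b = to_R(1)[OF R_class_arrow[OF P g]]
  have "pinv L (loop P g Q) = pmul (pmul (pinv L (to_R Q)) (pinv L g)) (to_R P)"
    unfolding loop_def using inv_mul_arrow[OF arrow_inv[OF a] arrow_mul(2)[OF g b]] inv_mul_arrow[OF g b]
      inv_inv[OF arrowD(3)[OF a]] by simp
  also have "\<dots> = pmul (pinv L (to_R Q)) (pmul (pinv L g) (to_R P))"
    by (rule mul_assoc(1)[OF arrow_inv[OF b] arrow_inv[OF g] a])
  finally show ?thesis by (simp add: loop_def)
qed

lemma T_R_class: assumes P: "P \<in> R_class" shows "T \<subseteq> P \<longleftrightarrow> T \<subseteq> R"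
proof
  note a = to_R[OF P]
  assume "T \<subseteq> P"
  then have "pconj L (to_R P) ` T = T" using T_image(1)[OF a(4)] arrow_S_of[OF a(1)] by blast
  then show "T \<subseteq> R" using arrowD(5)[OF a(1)] \<open>T \<subseteq> P\<close> by blast
next
  note a = to_R[OF P]
  note ai = arrow_inv[OF a(1)]
  have g: "pinv L (to_R P) \<in> elements_over \<Gamma>" using elements_overI[OF arrow_inv[OF a(2)] a(3)] .
  assume T: "T \<subseteq> R"
  then have "pconj L (pinv L (to_R P)) ` T = T" using T_image(1)[OF g] arrow_S_of[OF ai] by blast
  then show "T \<subseteq> P" using arrowD(5)[OF ai] T by blast
qed

text \<open>The object is the normalizer of \<open>P\<close> in \<open>S\<^sub>g\<close>. It is larger than \<open>P\<close> because \<open>g\<close> belongs to the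
  smaller locality, and all factors of \<open>loop P g Q\<close> are defined along it.\<close>

lemma inner_object:
  assumes P: "P \<in> R_class" and g: "arrow P g Q" "g \<in> elements_over \<Gamma>"
  shows "\<exists>X Y. X \<in> \<Gamma> \<and> P \<subseteq> X \<and> X \<subseteq> NS P \<and> Y \<subseteq> NS Q \<and> Y \<in> \<Gamma> \<and> Q \<subseteq> Y \<and> arrow X g Y"
proof -
  have PD: "P \<in> \<Delta>" using R_classD(1)[OF P] .
  let ?X = "S_of g \<inter> NS P"
  have gc: "g \<in> pcarrier L" using elements_overD(1)[OF g(2)] .
  have sX: "pg_subgroup L ?X" "?X \<subseteq> S" "P \<subseteq> ?X"
    using inter_subgroup[OF S_of_subgroup[OF gc] NS_subgroup[OF PD]] S_of_sub arrow_S_of[OF g(1)] NS_self[OF PD] by auto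
  have XD: "?X \<in> \<Delta>" using Delta_over[OF PD sX(3,2,1)] .
  have "P \<noteq> S_of g" using elements_overD(2)[OF g(2)] R_classD(3)[OF P] by metis
  then have "P \<subset> S_of g" using arrow_S_of[OF g(1)] by blast
  then obtain y where y: "y \<in> S_of g - P" "arrow P y P"
    using S_normalizer_grows[OF PD S_of_subgroup[OF gc] S_of_sub] by blast
  have yX: "y \<in> ?X" using y S_of_sub by (auto simp: NS_def)
  then have XG: "?X \<in> \<Gamma>" using R_class_over[OF P _ XD] sX(3) y by blast
  let ?Y = "pconj L g ` ?X"
  have a: "arrow ?X g ?Y" using arrowI[OF gc XD] by blast
  have "?Y \<subseteq> NS Q"
  proof
    fix z assume "z \<in> ?Y"
    then obtain x where x: "x \<in> ?X" "z = pconj L g x" by blast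
    have "arrow P x P" using x by (simp add: NS_def)
    then have "arrow Q z Q" using conj_elt(2)[OF _ g(1,1)] x by simp
    then show "z \<in> NS Q" using x by (auto simp: NS_def S_of_def)
  qed
  moreover have "Q \<subseteq> ?Y" using arrowD(5)[OF g(1)] sX(3) by blast
  ultimately show ?thesis using XG sX(3) a G_arrow[OF a XG] by blast
qed

definition kernel_set :: "('a set \<Rightarrow> 'a \<Rightarrow> 'a set \<Rightarrow> bool) \<Rightarrow> 'a set" where
  "kernel_set K = N \<union> {g \<in> pcarrier L. S_of g \<in> R_class \<and> K (S_of g) g (pconj L g ` S_of g)}"

text \<open>A new element \<open>g\<close> lives on the single object \<open>S\<^sub>g\<close> of the class, so membership of new elements may be
  prescribed by any normal subgroupoid \<open>K\<close> that agrees with \<open>N\<close> on the old elements.\<close>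

lemma kernel_extension:
  assumes K_N: "\<And>P g Q. P \<in> R_class \<Longrightarrow> arrow P g Q \<Longrightarrow> g \<in> elements_over \<Gamma> \<Longrightarrow> K P g Q \<longleftrightarrow> g \<in> N"
    and K_mul: "\<And>P g Q h U. P \<in> R_class \<Longrightarrow> arrow P g Q \<Longrightarrow> arrow Q h U \<Longrightarrow> K P g Q \<Longrightarrow> K Q h U \<Longrightarrow> K P (pmul g h) U"
    and K_inv: "\<And>P g Q. P \<in> R_class \<Longrightarrow> arrow P g Q \<Longrightarrow> K P g Q \<Longrightarrow> K Q (pinv L g) P"
    and K_conj: "\<And>P x Q g P' Q'. P \<in> R_class \<Longrightarrow> arrow P x Q \<Longrightarrow> arrow P g P' \<Longrightarrow> arrow Q g Q' \<Longrightarrow> K P x Q \<Longrightarrow>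
        K P' (pconj L g x) Q'"
  shows "normal_in Gplus (kernel_set K)" "kernel_set K \<inter> elements_over \<Gamma> = N"
proof -
  let ?M = "kernel_set K"
  have in_G: "g \<in> ?M \<longleftrightarrow> g \<in> N" if "g \<in> elements_over \<Gamma>" for g
    using that R_classD(3)[of "S_of g"] by (auto simp: kernel_set_def elements_over_def)
  have M_cls: "g \<in> ?M \<longleftrightarrow> K P g Q" if P: "P \<in> R_class" and g: "arrow P g Q" for P g Q
  proof (cases "g \<in> elements_over \<Gamma>")
    case True then show ?thesis using in_G K_N[OF P g] by simp
  next
    case False
    then have s: "S_of g = P" using R_class_S_of[OF P g] by blast
    have "g \<notin> N" using False N_elements_over by blast
    then show ?thesis using s arrowD(3,5)[OF g] P by (simp add: kernel_set_def)
  qed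
  have M_G: "g \<in> ?M \<longleftrightarrow> g \<in> N" if "P \<in> \<Gamma>" "arrow P g Q" for P g Q using in_G elements_overI[OF that(2,1)] by blast
  have Mst: "S_of g \<in> \<Gamma> \<and> g \<in> N \<or> S_of g \<in> R_class" "g \<in> pcarrier L" if "g \<in> ?M" for g
    using that N_elements_over elements_overD(1,2) by (auto simp: kernel_set_def)
  show "?M \<inter> elements_over \<Gamma> = N" using in_G N_elements_over by blast
  show "normal_in Gplus ?M"
    unfolding normal_in_def
  proof (intro conjI ballI allI impI)
    show "?M \<subseteq> elements_over Gplus" using Mst by (auto simp: elements_over_def Gplus_def)
    show "pone \<in> ?M" using N_one by (simp add: kernel_set_def)
    show "pinv L x \<in> ?M" if x: "x \<in> ?M" for x
    proof (cases "S_of x \<in> R_class")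
      case True
      note a = S_of_arrow[OF Mst(2)[OF x]]
      show ?thesis using K_inv[OF True a] M_cls[OF True a] x M_cls[OF R_class_arrow[OF True a] arrow_inv[OF a]] by blast
    next
      case False
      then show ?thesis using Mst(1)[OF x] N_inv by (simp add: kernel_set_def)
    qed
    show "pmul x y \<in> ?M" if "x \<in> ?M" "y \<in> ?M" "P \<in> Gplus" "arrow P x Q" "arrow Q y U" for x y P Q U
    proof (cases "P \<in> \<Gamma>")
      case True
      have "x \<in> N" "y \<in> N"
        using M_G[OF True that(4)] M_G[OF G_arrow[OF that(4) True] that(5)] that(1,2) by auto
      then show ?thesis using N_mul[OF _ _ True that(4,5)] by (simp add: kernel_set_def)
    next
      case False
      then have P: "P \<in> R_class" using that(3) by (simp add: Gplus_def)
      show ?thesis using M_cls[OF P that(4)] M_cls[OF R_class_arrow[OF P that(4)] that(5)]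
          M_cls[OF P arrow_mul(2)[OF that(4,5)]] K_mul[OF P that(4,5)] that(1,2) by blast
    qed
    show "pconj L g x \<in> ?M"
      if "x \<in> ?M" "P \<in> Gplus" "arrow P x Q" "arrow P g P'" "arrow Q g Q'" for x g P Q P' Q'
    proof (cases "P \<in> \<Gamma>")
      case True
      have "x \<in> N" using M_G[OF True that(3)] that(1) by auto
      then show ?thesis using N_conj[OF _ True that(3-5)] by (simp add: kernel_set_def)
    next
      case False
      then have P: "P \<in> R_class" using that(2) by (simp add: Gplus_def)
      show ?thesis using M_cls[OF P that(3)] M_cls[OF R_class_arrow[OF P that(4)] conj_elt(2)[OF that(3-5)]]
          K_conj[OF P that(3-5)] that(1) by blast
    qed
  qed
qed

end

section \<open>Kernels on the new objects\<close>

context elementary_step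
begin

lemma loop_conj:
  assumes P: "P \<in> R_class" and x: "arrow P x Q" and g: "arrow P g P'" "arrow Q g Q'" and e: "Q = P" "Q' = P'"
  shows "loop P' (pconj L g x) P' = pconj L (loop P g P') (loop P x P)"
proof -
  have x': "arrow P x P" and g': "arrow P g P'" using x g e by auto
  have P': "P' \<in> R_class" using R_class_arrow[OF P g'] .
  have "loop P' (pmul (pinv L g) (pmul x g)) P' = pmul (loop P' (pinv L g) P) (pmul (loop P x P) (loop P g P'))"
    using loop_mul[OF P' arrow_inv[OF g'] arrow_mul(2)[OF x' g']] loop_mul[OF P x' g'] by simp
  then show ?thesis
    using conj_elt(3)[OF x' g' g'] loop_inv[OF P g'] conj_elt(3)[OF loop(1)[OF P x'] loop(1,1)[OF P g']] by simp
qed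

text \<open>The kernel for \<open>T \<le> R\<close>. Then \<open>T\<close> is contained in all members of the class, and elements of \<open>N\<close> move
  \<open>P\<close> only within \<open>P T = P\<close>.\<close>

definition ker_containing_T :: "'a set \<Rightarrow> 'a \<Rightarrow> 'a set \<Rightarrow> bool" where
  "ker_containing_T P g Q \<longleftrightarrow> Q = P \<and> loop P g P \<in> N"

lemma ker_containing_T_N:
  assumes T: "T \<subseteq> R" and P: "P \<in> R_class" and g: "arrow P g Q" "g \<in> elements_over \<Gamma>"
  shows "ker_containing_T P g Q \<longleftrightarrow> g \<in> N"
proof -
  have TP: "T \<subseteq> P" using T_R_class[OF P] T by blast
  have QP: "Q = P" if "g \<in> N"
  proof -
    have "Q \<subseteq> P" using N_moves_in[OF that Delta_subgroup[OF R_classD(1)[OF P]] TP arrow_S_of[OF g(1)] order_refl]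
        arrowD(5)[OF g(1)] by simp
    then show ?thesis using card_subset_eq[OF R_classD(5)[OF P]] arrow_card[OF g(1)] by blast
  qed
  have "loop P g P \<in> N \<longleftrightarrow> g \<in> N" if "Q = P"
  proof -
    obtain X Y where X: "X \<in> \<Gamma>" "P \<subseteq> X" "X \<subseteq> NS P" "Y \<subseteq> NS Q" "Y \<in> \<Gamma>" "Q \<subseteq> Y" "arrow X g Y"
      using inner_object[OF P g] by blast
    let ?a = "to_R P"
    have aX: "arrow X ?a (pconj L ?a ` X)" "arrow Y ?a (pconj L ?a ` Y)"
      using arrow_restrict[OF to_R(2)[OF P]] X that G_Delta by auto
    have l: "loop P g P = pconj L ?a g" using conj_elt(3)[OF X(7) aX] that by (simp add: loop_def)
    have al: "arrow (pconj L ?a ` X) (loop P g P) (pconj L ?a ` Y)" unfolding l by (rule conj_elt(2)[OF X(7) aX])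
    have "g = pconj L (pinv L ?a) (loop P g P)"
      unfolding l using conj_undo(2)[OF conj_elt(1)[OF X(7) aX] arrowD(3)[OF aX(1)]] by simp
    then show ?thesis
      using N_conj[OF _ X(1,7) aX] N_conj[OF _ G_arrow[OF aX(1) X(1)] al arrow_inv[OF aX(1)] arrow_inv[OF aX(2)]] l
      by metis
  qed
  then show ?thesis using QP by (auto simp: ker_containing_T_def)
qed

lemma ker_containing_T_mul:
  assumes P: "P \<in> R_class" and a: "arrow P g Q" "arrow Q h U" and k: "ker_containing_T P g Q" "ker_containing_T Q h U"
  shows "ker_containing_T P (pmul g h) U"
proof -
  have e: "Q = P" "U = P" and n: "loop P g P \<in> N" "loop P h P \<in> N" using k by (auto simp: ker_containing_T_def)
  have g: "arrow P g P" and h: "arrow P h P" using a e by auto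
  show ?thesis using N_mul[OF n Ob_G loop(2)[OF P g] loop(2)[OF P h]] loop_mul[OF P g h] e by (simp add: ker_containing_T_def)
qed

lemma ker_containing_T_inv:
  assumes P: "P \<in> R_class" and a: "arrow P g Q" and k: "ker_containing_T P g Q" shows "ker_containing_T Q (pinv L g) P"
  using N_inv loop_inv[OF P, of g P] a k by (auto simp: ker_containing_T_def)

lemma ker_containing_T_conj:
  assumes P: "P \<in> R_class" and x: "arrow P x Q" and g: "arrow P g P'" "arrow Q g Q'" and k: "ker_containing_T P x Q"
  shows "ker_containing_T P' (pconj L g x) Q'"
proof -
  have e: "Q = P" "Q' = P'" and n: "loop P x P \<in> N"
    using k arrowD(5)[OF g(1)] arrowD(5)[OF g(2)] by (simp_all add: ker_containing_T_def)
  have x': "arrow P x P" using x e by simp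
  have "pconj L (loop P g P') (loop P x P) \<in> N"
    using N_conj[OF n Ob_G loop(2)[OF P x'] loop(2,2)[OF P g(1)]] .
  then show ?thesis using loop_conj[OF P x g e] e by (simp add: ker_containing_T_def)
qed

definition rep_to_R :: "'a set \<Rightarrow> 'a" where "rep_to_R P = (SOME f. rep (NS P) (to_R P) f)"
definition rep_loop :: "'a \<Rightarrow> 'a" where "rep_loop m = (SOME f. rep Ob m f)"

lemma rep_to_R: "P \<in> R_class \<Longrightarrow> rep (NS P) (to_R P) (rep_to_R P)"
  unfolding rep_to_R_def using rep_exists[OF NS_G to_R(2)] by (rule someI_ex)

lemma rep_loop: "P \<in> R_class \<Longrightarrow> arrow P g Q \<Longrightarrow> rep Ob (loop P g Q) (rep_loop (loop P g Q))"
  unfolding rep_loop_def using rep_exists[OF Ob_G loop(2)] by (rule someI_ex)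

text \<open>For \<open>T\<close> not contained in \<open>R\<close>: the image of \<open>g\<close> modulo \<open>N\<close>, computed factor by factor from
  \<open>g = to_R P \<cdot> loop P g Q \<cdot> (to_R Q)\<^sup>-\<^sup>1\<close>. The three representatives are composable over \<open>P T\<close>, which
  belongs to \<open>\<Gamma>\<close>.\<close>

definition transport :: "'a set \<Rightarrow> 'a \<Rightarrow> 'a set \<Rightarrow> 'a" where
  "transport P g Q = pmul (pmul (rep_to_R P) (rep_loop (loop P g Q))) (pinv L (rep_to_R Q))"

lemma with_T_G: assumes "\<not> T \<subseteq> R" "P \<in> R_class" shows "with_T P \<in> \<Gamma>"
proof -
  note h = with_T[OF R_classD(1)[OF assms(2)]]
  have "P \<subset> with_T P" using h(3,4) T_R_class[OF assms(2)] assms(1) by blast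
  then show ?thesis using R_class_over[OF assms(2) _ h(5)] by blast
qed

lemma rep_to_R_arrow: "P \<in> R_class \<Longrightarrow> arrow (with_T P) (rep_to_R P) (with_T R)"
  using with_T_rep[OF rep_to_R to_R(1) NS_self] R_classD(1) by blast

lemma rep_loop_arrow: "P \<in> R_class \<Longrightarrow> arrow P g Q \<Longrightarrow> arrow (with_T R) (rep_loop (loop P g Q)) (with_T R)"
  using with_T_rep[OF rep_loop loop(1)] R_Ob by blast

lemma transport_arrow:
  assumes "P \<in> R_class" "arrow P g Q" shows "arrow (with_T P) (transport P g Q) (with_T Q)"
  unfolding transport_def
  using arrow_mul(2)[OF arrow_mul(2)[OF rep_to_R_arrow[OF assms(1)] rep_loop_arrow[OF assms]]
      arrow_inv[OF rep_to_R_arrow[OF R_class_arrow[OF assms]]]] .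

lemma transport_mul:
  assumes T: "\<not> T \<subseteq> R" and P: "P \<in> R_class" and g: "arrow P g Q" and h: "arrow Q h U"
  shows "cong_N (with_T P) (with_T U) (transport P (pmul g h) U) (pmul (transport P g Q) (transport Q h U))"
proof -
  have Q: "Q \<in> R_class" and U: "U \<in> R_class" using R_class_arrow P g h by blast+
  let ?s1 = "rep_to_R P" and ?s2 = "rep_to_R Q" and ?s3 = "rep_to_R U"
  let ?l = "loop P g Q" and ?k = "loop Q h U"
  let ?t = "rep_loop ?l" and ?u = "rep_loop ?k"
  note gh = arrow_mul(2)[OF g h]
  note s1 = rep_to_R_arrow[OF P] and s2 = rep_to_R_arrow[OF Q] and s3i = arrow_inv[OF rep_to_R_arrow[OF U]]
  note t = rep_loop_arrow[OF P g] and u = rep_loop_arrow[OF Q h]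
  have RO: "R \<subseteq> Ob" using R_Ob by blast
  have "rep Ob (pmul ?l ?k) (pmul ?t ?u)" using rep_mul[OF rep_loop[OF P g] loop(2)[OF P g] rep_loop[OF Q h]] .
  then have "cong_N (with_T R) (with_T R) (rep_loop (loop P (pmul g h) U)) (pmul ?t ?u)"
    using rep_cong_N[OF rep_loop[OF P gh] RO _ RO loop(1)[OF P gh] with_T_G[OF T R_class_R]] loop_mul[OF P g h] by simp
  then have "cong_N (with_T P) (with_T U) (transport P (pmul g h) U) (pmul (pmul ?s1 (pmul ?t ?u)) (pinv L ?s3))"
    unfolding transport_def
    by (intro cong_N_mul[OF cong_N_mul[OF cong_N_refl[OF with_T_G[OF T P] s1]] cong_N_refl[OF with_T_G[OF T R_class_R] s3i]])
  moreover have "pmul (transport P g Q) (transport Q h U) = pmul (pmul ?s1 (pmul ?t ?u)) (pinv L ?s3)"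
  proof -
    let ?A = "pmul ?s1 ?t"
    have A: "arrow (with_T P) ?A (with_T R)" using arrow_mul(2)[OF s1 t] .
    note us = arrow_mul(2)[OF u s3i]
    have "transport Q h U = pmul ?s2 (pmul ?u (pinv L ?s3))"
      unfolding transport_def by (rule mul_assoc(1)[OF s2 u s3i])
    then have "pmul (transport P g Q) (transport Q h U) = pmul ?A (pmul (pinv L ?s2) (pmul ?s2 (pmul ?u (pinv L ?s3))))"
      unfolding transport_def[of P] using mul_assoc(1)[OF A arrow_inv[OF s2] arrow_mul(2)[OF s2 us]] by simp
    also have "pmul (pinv L ?s2) (pmul ?s2 (pmul ?u (pinv L ?s3))) = pmul ?u (pinv L ?s3)"
      by (rule inv_mul_cancel[OF s2 us])
    also have "pmul ?A (pmul ?u (pinv L ?s3)) = pmul (pmul ?A ?u) (pinv L ?s3)" using mul_assoc(1)[OF A u s3i] by simp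
    also have "pmul ?A ?u = pmul ?s1 (pmul ?t ?u)" by (rule mul_assoc(1)[OF s1 t u])
    finally show ?thesis .
  qed
  ultimately show ?thesis by simp
qed

text \<open>For an element of the smaller locality the three factors are composable over an object of \<open>\<Gamma>\<close>, so
  that the product of their representatives is a representative of \<open>g\<close>.\<close>

lemma transport_rep:
  assumes T: "\<not> T \<subseteq> R" and P: "P \<in> R_class" and g: "arrow P g Q" and r: "rep X g f" "P \<subseteq> X"
  shows "cong_N (with_T P) (with_T Q) (transport P g Q) f"
proof -
  have Q: "Q \<in> R_class" using R_class_arrow[OF P g] .
  have gG: "g \<in> elements_over \<Gamma>" using elements_overI rep_arrow(1,2)[OF r(1)] by blast
  obtain X Y where X: "X \<in> \<Gamma>" "P \<subseteq> X" "X \<subseteq> NS P" "Y \<subseteq> NS Q" "Y \<in> \<Gamma>" "Q \<subseteq> Y" "arrow X g Y"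
    using inner_object[OF P g gG] by blast
  obtain k where k: "rep X g k" using rep_exists[OF X(1,7)] by blast
  let ?a = "to_R P" and ?b = "to_R Q" and ?s = "rep_to_R P" and ?u = "rep_to_R Q"
  let ?X = "pconj L ?a ` X"
  have aX: "arrow X ?a ?X" using arrow_restrict[OF to_R(2)[OF P] G_Delta[OF X(1)] X(3)] .
  have ra: "rep X ?a ?s" using rep_restrict[OF rep_to_R[OF P] X(1,3)] .
  have rb: "rep Y ?b ?u" using rep_restrict[OF rep_to_R[OF Q] X(5,4)] .
  have "rep ?X (loop P g Q) (pmul (pinv L ?s) (pmul k ?u))"
    unfolding loop_def using rep_mul[OF rep_inv[OF ra aX] arrow_inv[OF aX] rep_mul[OF k X(7) rb]] .
  moreover have "R \<subseteq> ?X" using arrowD(5)[OF to_R(1)[OF P]] X(2) by blast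
  moreover have "R \<subseteq> Ob" using R_Ob by blast
  ultimately have e: "cong_N (with_T R) (with_T R) (rep_loop (loop P g Q)) (pmul (pinv L ?s) (pmul k ?u))"
    using rep_cong_N[OF rep_loop[OF P g] _ _ _ loop(1)[OF P g] with_T_G[OF T R_class_R]] by blast
  note s = rep_to_R_arrow[OF P] and u = rep_to_R_arrow[OF Q]
  have ka: "arrow (with_T P) k (with_T Q)" using with_T_rep[OF k g X(2)] .
  have "cong_N (with_T P) (with_T Q) (transport P g Q) (pmul (pmul ?s (pmul (pinv L ?s) (pmul k ?u))) (pinv L ?u))"
    unfolding transport_def
    by (rule cong_N_mul[OF cong_N_mul[OF cong_N_refl[OF with_T_G[OF T P] s] e] cong_N_refl[OF with_T_G[OF T R_class_R] arrow_inv[OF u]]])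
  moreover have "pmul (pmul ?s (pmul (pinv L ?s) (pmul k ?u))) (pinv L ?u) = k"
    using mul_inv_cancel[OF s arrow_mul(2)[OF ka u]] mul_cancel_right[OF ka u] by simp
  ultimately have "cong_N (with_T P) (with_T Q) (transport P g Q) k" by simp
  moreover have "cong_N (with_T P) (with_T Q) k f" using rep_cong_N[OF k X(2) r g with_T_G[OF T P]] .
  ultimately show ?thesis by (rule cong_N_trans)
qed

definition ker_not_containing_T :: "'a set \<Rightarrow> 'a \<Rightarrow> 'a set \<Rightarrow> bool" where
  "ker_not_containing_T P g Q \<longleftrightarrow> transport P g Q \<in> N"

lemma ker_not_containing_T_N:
  assumes T: "\<not> T \<subseteq> R" and P: "P \<in> R_class" and g: "arrow P g Q" "g \<in> elements_over \<Gamma>"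
  shows "ker_not_containing_T P g Q \<longleftrightarrow> g \<in> N"
proof -
  obtain f where f: "rep (S_of g) g f" using rep_exists[OF elements_overD(2,3)[OF g(2)]] by blast
  show ?thesis unfolding ker_not_containing_T_def
    using cong_N_kernel[OF transport_rep[OF T P g(1) f arrow_S_of[OF g(1)]]] rep_kernel[OF f] by simp
qed

lemma ker_not_containing_T_mul:
  assumes T: "\<not> T \<subseteq> R" and P: "P \<in> R_class" and a: "arrow P g Q" "arrow Q h U" and k: "ker_not_containing_T P g Q" "ker_not_containing_T Q h U"
  shows "ker_not_containing_T P (pmul g h) U"
  using cong_N_kernel[OF transport_mul[OF T P a]]
    N_mul[OF _ _ with_T_G[OF T P] transport_arrow[OF P a(1)] transport_arrow[OF R_class_arrow[OF P a(1)] a(2)]] k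
  by (simp add: ker_not_containing_T_def)

lemma ker_not_containing_T_inv:
  assumes T: "\<not> T \<subseteq> R" and P: "P \<in> R_class" and a: "arrow P g Q" and k: "ker_not_containing_T P g Q"
  shows "ker_not_containing_T Q (pinv L g) P"
proof -
  have Q: "Q \<in> R_class" using R_class_arrow[OF P a] .
  note ai = arrow_inv[OF a]
  let ?u = "transport P g Q" and ?v = "transport Q (pinv L g) P"
  note u = transport_arrow[OF P a] and v = transport_arrow[OF Q ai]
  have "pone \<in> elements_over \<Gamma>" using N_elements_over N_one by blast
  then have "transport P pone P \<in> N"
    using ker_not_containing_T_N[OF T P arrow_one[OF R_classD(1)[OF P]]] N_one by (simp add: ker_not_containing_T_def)
  then have "pmul ?u ?v \<in> N"
    using cong_N_kernel[OF transport_mul[OF T P a ai]] inv_mul(4)[OF arrowD(3)[OF a]] by simp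
  then have "pmul (pinv L ?u) (pmul ?u ?v) \<in> N"
    using N_mul[OF N_inv _ with_T_G[OF T Q] arrow_inv[OF u] arrow_mul(2)[OF u v]] k by (simp add: ker_not_containing_T_def)
  then show ?thesis using inv_mul_cancel[OF u v] by (simp add: ker_not_containing_T_def)
qed

text \<open>From \<open>g x\<^sup>g = x g\<close> and multiplicativity one gets the transport of \<open>x\<^sup>g\<close>. The transports of \<open>g\<close> from
  \<open>P\<close> and from \<open>Q\<close> agree modulo \<open>N\<close>: a new \<open>g\<close> has only one source in the class, and for an old
  \<open>g\<close> both are represented by the same element.\<close>

lemma ker_not_containing_T_conj:
  assumes T: "\<not> T \<subseteq> R" and P: "P \<in> R_class" and x: "arrow P x Q" and g: "arrow P g P'" "arrow Q g Q'"
    and k: "ker_not_containing_T P x Q"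
  shows "ker_not_containing_T P' (pconj L g x) Q'"
proof -
  have Q: "Q \<in> R_class" and P': "P' \<in> R_class" using R_class_arrow P x g by blast+
  let ?y = "pconj L g x"
  let ?u = "transport P g P'" and ?v = "transport Q g Q'" and ?w = "transport P x Q" and ?z = "transport P' ?y Q'"
  note y = conj_elt(2)[OF x g]
  note u = transport_arrow[OF P g(1)] and v = transport_arrow[OF Q g(2)] and w = transport_arrow[OF P x]
    and z = transport_arrow[OF P' y]
  have wN: "?w \<in> N" using k by (simp add: ker_not_containing_T_def)
  have PG: "with_T P \<in> \<Gamma>" using with_T_G[OF T P] .
  have QP: "with_T Q = with_T P"
  proof -
    note h = with_T[OF R_classD(1)[OF P]]
    have "with_T Q \<subseteq> with_T P" using N_moves_in[OF wN h(1,3) arrow_S_of[OF w] order_refl] arrowD(5)[OF w] by simp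
    then show ?thesis using card_subset_eq[OF finite_subset[OF h(2) finite_S]] arrow_card[OF w] by blast
  qed
  have "cong_N (with_T P) (with_T Q') (pmul ?u ?z) (pmul ?w ?v)"
    using cong_N_trans[OF cong_N_sym[OF transport_mul[OF T P g(1) y]]] transport_mul[OF T P x g(2)]
      conj_undo(5)[OF conj_elt(1)[OF x g] arrowD(3)[OF g(1)]] by simp
  moreover have vu: "cong_N (with_T Q) (with_T Q') ?v ?u"
  proof (cases "g \<in> elements_over \<Gamma>")
    case True
    obtain f where f: "rep (S_of g) g f" using rep_exists[OF elements_overD(2,3)[OF True]] by blast
    have a: "cong_N (with_T P) (with_T P') ?u f" using transport_rep[OF T P g(1) f arrow_S_of[OF g(1)]] .
    have b: "cong_N (with_T Q) (with_T Q') ?v f" using transport_rep[OF T Q g(2) f arrow_S_of[OF g(2)]] .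
    have "with_T P' = with_T Q'" using arrowD(5)[OF cong_ND(3)[OF a]] arrowD(5)[OF cong_ND(3)[OF b]] QP by simp
    then show ?thesis using cong_N_trans[OF b cong_N_sym] a QP by simp
  next
    case False
    then have "S_of g = P" "S_of g = Q" using R_class_S_of[OF P g(1)] R_class_S_of[OF Q g(2)] by auto
    then have "Q = P" "Q' = P'" using arrowD(5)[OF g(1)] arrowD(5)[OF g(2)] by auto
    then show ?thesis using cong_N_refl[OF PG u] by simp
  qed
  ultimately have uz: "cong_N (with_T P) (with_T Q') (pmul ?u ?z) (pmul ?w ?u)"
    using cong_N_trans[OF _ cong_N_mul[OF cong_N_refl[OF PG w] vu]] by blast
  have "cong_N (with_T P') (with_T Q') (pmul (pinv L ?u) (pmul ?u ?z)) (pmul (pinv L ?u) (pmul ?w ?u))"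
    using cong_N_mul[OF cong_N_refl[OF with_T_G[OF T P'] arrow_inv[OF u]] uz] .
  moreover have "pmul (pinv L ?u) (pmul ?u ?z) = ?z" by (rule inv_mul_cancel[OF u z])
  moreover have "pmul (pinv L ?u) (pmul ?w ?u) \<in> N"
    using N_conj[OF wN PG w u cong_ND(3)[OF vu]] conj_elt(3)[OF w u cong_ND(3)[OF vu]] by simp
  ultimately show ?thesis using cong_N_kernel by (simp add: ker_not_containing_T_def)
qed

definition ker :: "'a set \<Rightarrow> 'a \<Rightarrow> 'a set \<Rightarrow> bool" where
  "ker = (if T \<subseteq> R then ker_containing_T else ker_not_containing_T)"

lemma extension_exists: "normal_in Gplus (kernel_set ker) \<and> kernel_set ker \<inter> elements_over \<Gamma> = N"
proof (cases "T \<subseteq> R")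
  case True
  then have k: "ker = ker_containing_T" by (simp add: ker_def)
  have "normal_in Gplus (kernel_set ker_containing_T)" "kernel_set ker_containing_T \<inter> elements_over \<Gamma> = N"
    by (rule kernel_extension[of ker_containing_T, OF ker_containing_T_N[OF True] ker_containing_T_mul ker_containing_T_inv ker_containing_T_conj]; assumption)+
  then show ?thesis unfolding k by blast
next
  case False
  then have k: "ker = ker_not_containing_T" by (simp add: ker_def)
  have "normal_in Gplus (kernel_set ker_not_containing_T)" "kernel_set ker_not_containing_T \<inter> elements_over \<Gamma> = N"
    by (rule kernel_extension[of ker_not_containing_T, OF ker_not_containing_T_N[OF False] ker_not_containing_T_mul[OF False] ker_not_containing_T_inv[OF False]
          ker_not_containing_T_conj[OF False]]; assumption)+
  then show ?thesis unfolding k by blast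
qed

text \<open>An extension \<open>M\<close> satisfies \<open>S \<inter> M = S \<inter> N\<close>, because \<open>S\<close> is contained in the smaller locality. So
  representatives modulo \<open>N\<close> are representatives modulo \<open>M\<close>, and membership of \<open>g\<close> in \<open>M\<close> is decided
  by an element of the smaller locality.\<close>

lemma extension_kernel:
  assumes M: "normal_in Gplus M" "M \<inter> elements_over \<Gamma> = N" and P: "P \<in> R_class" and g: "arrow P g Q"
  shows "g \<in> M \<longleftrightarrow> ker P g Q"
proof -
  interpret I: locality_with_normal p L \<Delta> S Gplus M
    by unfold_locales (use closed_Gplus M(1) in auto)
  have S_g: "s \<in> elements_over \<Gamma>" if "s \<in> S" for s using S_of_S[OF that] G_S S_carrier[OF that] by (simp add: elements_over_def)
  have NM: "n \<in> N \<Longrightarrow> n \<in> M" for n using M(2) by blast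
  have MN: "n \<in> M \<Longrightarrow> n \<in> elements_over \<Gamma> \<Longrightarrow> n \<in> N" for n using M(2) by blast
  have TT: "I.T = T" using S_g NM MN by (auto simp: I.T_def T_def)
  have Q: "Q \<in> R_class" using R_class_arrow[OF P g] .
  have PG: "P \<in> Gplus" "R \<in> Gplus" "Q \<in> Gplus" using P Q R_class_R by (auto simp: Gplus_def)
  note a = to_R(1)[OF P] and b = to_R(1)[OF Q]
  show ?thesis
  proof (cases "T \<subseteq> R")
    case True
    have TP: "I.T \<subseteq> P" using T_R_class[OF P] True TT by blast
    have QP: "Q = P" if "g \<in> M"
    proof -
      have "Q \<subseteq> P" using I.N_moves_in[OF that Delta_subgroup[OF R_classD(1)[OF P]] TP arrow_S_of[OF g] order_refl]
          arrowD(5)[OF g] by simp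
      then show ?thesis using card_subset_eq[OF R_classD(5)[OF P]] arrow_card[OF g] by blast
    qed
    have "loop P g P \<in> N \<longleftrightarrow> g \<in> M" if "Q = P"
    proof -
      have g': "arrow P g P" using g that by simp
      have l: "loop P g P = pconj L (to_R P) g" using conj_elt(3)[OF g' a a] by (simp add: loop_def)
      have gl: "g = pconj L (pinv L (to_R P)) (loop P g P)"
        unfolding l using conj_undo(2)[OF conj_elt(1)[OF g' a a] arrowD(3)[OF a]] by simp
      have "loop P g P \<in> M \<longleftrightarrow> g \<in> M"
        using I.N_conj[OF _ PG(1) g' a a] I.N_conj[OF _ PG(2) loop(1)[OF P g'] arrow_inv[OF a] arrow_inv[OF a]]
          l gl by metis
      then show ?thesis using loop(3)[OF P g'] NM MN by blast
    qed
    then show ?thesis using QP True by (auto simp: ker_def ker_containing_T_def)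
  next
    case False
    have rI: "I.rep Z k f" if r: "rep X k f" and Z: "Z \<subseteq> X" "Z \<in> Gplus" for X Z k f
    proof -
      have "X \<in> Gplus" using rep_arrow(1)[OF r] by (simp add: Gplus_def)
      then have "I.rep X k f" using r NM unfolding rep_def I.rep_def TT by blast
      then show ?thesis using I.rep_restrict Z by blast
    qed
    have 1: "I.rep P (to_R P) (rep_to_R P)" "I.rep Q (to_R Q) (rep_to_R Q)"
      using rI rep_to_R P Q NS_self R_classD(1) PG by blast+
    have 2: "I.rep R (loop P g Q) (rep_loop (loop P g Q))" using rI[OF rep_loop[OF P g]] R_Ob PG(2) by blast
    have "I.rep P (pmul (pmul (to_R P) (loop P g Q)) (pinv L (to_R Q))) (transport P g Q)"
      unfolding transport_def
      using I.rep_mul[OF I.rep_mul[OF 1(1) a 2] arrow_mul(2)[OF a loop(1)[OF P g]] I.rep_inv[OF 1(2) b]] .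
    then have "g \<in> M \<longleftrightarrow> transport P g Q \<in> M" using I.rep_kernel loop(5)[OF P g] by simp
    moreover have "transport P g Q \<in> elements_over \<Gamma>" using elements_overI[OF transport_arrow[OF P g] with_T_G[OF False P]] .
    ultimately show ?thesis using NM MN False by (auto simp: ker_def ker_not_containing_T_def)
  qed
qed

theorem elementary_extension: "\<exists>!M. normal_in Gplus M \<and> M \<inter> elements_over \<Gamma> = N"
proof (rule ex1I[of _ "kernel_set ker"])
  show "normal_in Gplus (kernel_set ker) \<and> kernel_set ker \<inter> elements_over \<Gamma> = N" by (rule extension_exists)
  have sub: "M \<subseteq> M'" if M: "normal_in Gplus M \<and> M \<inter> elements_over \<Gamma> = N" and M': "normal_in Gplus M' \<and> M' \<inter> elements_over \<Gamma> = N" for M M'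
  proof
    fix g assume g: "g \<in> M"
    then have "g \<in> elements_over Gplus" using M unfolding normal_in_def by blast
    then consider "g \<in> elements_over \<Gamma>" | "S_of g \<in> R_class" "g \<in> pcarrier L" by (auto simp: elements_over_def Gplus_def)
    then show "g \<in> M'"
    proof cases
      case 1 then show ?thesis using g M M' by blast
    next
      case 2
      note a = S_of_arrow[OF 2(2)]
      show ?thesis using extension_kernel[OF _ _ 2(1) a] M M' g by blast
    qed
  qed
  show "M = kernel_set ker" if "normal_in Gplus M \<and> M \<inter> elements_over \<Gamma> = N" for M
    using sub[OF that extension_exists] sub[OF extension_exists that] by blast
qed

end

section \<open>Extension to all objects\<close>

context locality_context
begin

lemma closed_Delta: "closed \<Delta>"
  unfolding closed_def using S_Delta arrowD(2) by blast

lemma elements_over_Delta: "elements_over \<Delta> = pcarrier L"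
  using S_of_Delta by (auto simp: elements_over_def)

lemma normal_in_trace:
  assumes M: "normal_in \<Gamma>' M" and sub: "\<Gamma> \<subseteq> \<Gamma>'" and c: "closed \<Gamma>"
  shows "normal_in \<Gamma> (M \<inter> elements_over \<Gamma>)"
proof -
  have c1: "\<And>P Q. P \<in> \<Gamma> \<Longrightarrow> P \<subseteq> Q \<Longrightarrow> Q \<in> \<Delta> \<Longrightarrow> Q \<in> \<Gamma>"
    and c2: "\<And>P g Q. P \<in> \<Gamma> \<Longrightarrow> arrow P g Q \<Longrightarrow> Q \<in> \<Gamma>" and c3: "S \<in> \<Gamma>"
    using c unfolding closed_def by blast+
  have gI: "g \<in> elements_over \<Gamma>" if "arrow P g Q" "P \<in> \<Gamma>" for P g Q
    using c1[OF that(2) arrow_S_of[OF that(1)] S_of_Delta[OF arrowD(3)[OF that(1)]]] arrowD(3)[OF that(1)]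
    by (simp add: elements_over_def)
  have m1: "pone \<in> M" and m2: "\<And>x. x \<in> M \<Longrightarrow> pinv L x \<in> M"
    and m3: "\<And>x y P Q R. x \<in> M \<Longrightarrow> y \<in> M \<Longrightarrow> P \<in> \<Gamma>' \<Longrightarrow> arrow P x Q \<Longrightarrow> arrow Q y R \<Longrightarrow> pmul x y \<in> M"
    and m4: "\<And>x g P Q P' Q'. x \<in> M \<Longrightarrow> P \<in> \<Gamma>' \<Longrightarrow> arrow P x Q \<Longrightarrow> arrow P g P' \<Longrightarrow> arrow Q g Q' \<Longrightarrow> pconj L g x \<in> M"
    using M unfolding normal_in_def by blast+
  show ?thesis unfolding normal_in_def
  proof (intro conjI ballI allI impI)
    show "M \<inter> elements_over \<Gamma> \<subseteq> elements_over \<Gamma>" by blast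
    show "pone \<in> M \<inter> elements_over \<Gamma>" using m1 gI[OF arrow_one[OF S_Delta] c3] by blast
    show "pinv L x \<in> M \<inter> elements_over \<Gamma>" if "x \<in> M \<inter> elements_over \<Gamma>" for x
    proof -
      have a: "arrow (S_of x) x (pconj L x ` S_of x)" "S_of x \<in> \<Gamma>" using that S_of_arrow by (auto simp: elements_over_def)
      then show ?thesis using gI[OF arrow_inv[OF a(1)] c2[OF a(2,1)]] m2 that by blast
    qed
    show "pmul x y \<in> M \<inter> elements_over \<Gamma>"
      if "x \<in> M \<inter> elements_over \<Gamma>" "y \<in> M \<inter> elements_over \<Gamma>" "P \<in> \<Gamma>" "arrow P x Q" "arrow Q y U" for x y P Q U
      using m3[OF _ _ _ that(4,5)] gI[OF arrow_mul(2)[OF that(4,5)] that(3)] that(1-3) sub by blast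
    show "pconj L g x \<in> M \<inter> elements_over \<Gamma>"
      if "x \<in> M \<inter> elements_over \<Gamma>" "P \<in> \<Gamma>" "arrow P x Q" "arrow P g P'" "arrow Q g Q'" for x g P Q P' Q'
      using m4[OF _ _ that(3-5)] gI[OF conj_elt(2)[OF that(3-5)] c2[OF that(2,4)]] that(1,2) sub by blast
  qed
qed

lemma normal_in_Int:
  assumes M: "normal_in \<Gamma> M" and K: "normal_in \<Gamma> K" shows "normal_in \<Gamma> (M \<inter> K)"
  unfolding normal_in_def
proof (intro conjI ballI allI impI)
  show "M \<inter> K \<subseteq> elements_over \<Gamma>" "pone \<in> M \<inter> K" using M K unfolding normal_in_def by blast+
  show "pinv L x \<in> M \<inter> K" if "x \<in> M \<inter> K" for x using M K that unfolding normal_in_def by simp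
  show "pmul x y \<in> M \<inter> K"
    if x: "x \<in> M \<inter> K" and y: "y \<in> M \<inter> K" and a: "P \<in> \<Gamma>" "arrow P x Q" "arrow Q y U" for x y P Q U
  proof -
    have "pmul x y \<in> H" if "normal_in \<Gamma> H" "x \<in> H" "y \<in> H" for H using that a unfolding normal_in_def by blast
    then show ?thesis using M K x y by blast
  qed
  show "pconj L g x \<in> M \<inter> K"
    if x: "x \<in> M \<inter> K" and a: "P \<in> \<Gamma>" "arrow P x Q" "arrow P g P'" "arrow Q g Q'" for x g P Q P' Q'
  proof -
    have "pconj L g x \<in> H" if "normal_in \<Gamma> H" "x \<in> H" for H using that a unfolding normal_in_def by blast
    then show ?thesis using M K x by blast
  qed
qed

text \<open>Induction on the number of missing objects; the class added is that of a missing object of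
  largest order.\<close>

theorem normal_extension_unique:
  assumes c: "closed \<Gamma>" and cr: "centrics Fu \<inter> radicals Fu \<subseteq> \<Gamma>"
    and char: "\<And>P. P \<in> \<Delta> \<Longrightarrow> centralizer (NG P) (p_core p (NG P)) \<subseteq> p_core p (NG P)"
    and N: "normal_in \<Gamma> N"
  shows "\<exists>!M. normal_in \<Delta> M \<and> M \<inter> elements_over \<Gamma> = N"
  using c cr N
proof (induction "card (\<Delta> - \<Gamma>)" arbitrary: \<Gamma> N rule: less_induct)
  case less
  note c = less.prems(1) and cr = less.prems(2) and N = less.prems(3)
  have GD: "\<Gamma> \<subseteq> \<Delta>" using c unfolding closed_def by blast
  have "\<Delta> \<subseteq> Pow S" using Delta_sub by blast
  then have fD: "finite \<Delta>" using finite_subset finite_S by blast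
  show ?case
  proof (cases "\<Gamma> = \<Delta>")
    case True
    have "N \<inter> elements_over \<Delta> = N" using N True unfolding normal_in_def by blast
    moreover have "M \<inter> elements_over \<Delta> = M" if "normal_in \<Delta> M" for M using that unfolding normal_in_def by blast
    ultimately show ?thesis using N True by (intro ex1I[of _ N]) auto
  next
    case False
    then have ne: "\<exists>P. P \<in> \<Delta> - \<Gamma>" using GD by blast
    then obtain P where "P \<in> \<Delta> - \<Gamma>" by blast
    moreover have "\<forall>Q. Q \<in> \<Delta> - \<Gamma> \<longrightarrow> card Q < Suc (card S)"
      using card_mono[OF finite_S Delta_sub] by (auto simp: less_Suc_eq_le)
    ultimately obtain P0 where P0: "P0 \<in> \<Delta> - \<Gamma>" "\<And>Q. Q \<in> \<Delta> - \<Gamma> \<Longrightarrow> card Q \<le> card P0"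
      using ex_has_greatest_nat[of "\<lambda>Q. Q \<in> \<Delta> - \<Gamma>" P card "Suc (card S)"] by blast
    obtain h R where R: "arrow P0 h R" "fully_norm R" using fully_norm_ex P0(1) by blast
    have RG: "R \<notin> \<Gamma>" using c arrow_inv[OF R(1)] P0(1) unfolding closed_def by blast
    have RD: "R \<in> \<Delta>" using arrowD(2)[OF R(1)] .
    have larger: "Q \<in> \<Gamma>" if "Q \<in> \<Delta>" "card R < card Q" for Q
      using P0(2)[of Q] that arrow_card[OF R(1)] by auto
    have "R \<notin> centrics Fu \<inter> radicals Fu" using cr RG by blast
    then obtain Ob where Ob: "Ob \<in> \<Delta>" "R \<subset> Ob" "\<And>m. arrow R m R \<Longrightarrow> arrow Ob m Ob"
      using bigger_core[OF R(2) char[OF RD]] by blast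
    interpret E: elementary_step p L \<Delta> S \<Gamma> N R Ob
      by unfold_locales (use c N R(2) RG larger Ob in auto)
    let ?G = "E.Gplus"
    have cG: "closed ?G" by (rule E.closed_Gplus)
    have "\<Delta> - ?G \<subset> \<Delta> - \<Gamma>" using RD RG E.R_class_R by (auto simp: E.Gplus_def)
    then have dec: "card (\<Delta> - ?G) < card (\<Delta> - \<Gamma>)" using psubset_card_mono fD by blast
    have GG: "\<Gamma> \<subseteq> ?G" "centrics Fu \<inter> radicals Fu \<subseteq> ?G" using cr by (auto simp: E.Gplus_def)
    have gg: "elements_over \<Gamma> \<subseteq> elements_over ?G" using GG(1) by (auto simp: elements_over_def)
    obtain M where M: "normal_in ?G M" "M \<inter> elements_over \<Gamma> = N"
      and Mu: "\<And>M'. normal_in ?G M' \<Longrightarrow> M' \<inter> elements_over \<Gamma> = N \<Longrightarrow> M' = M"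
      using E.elementary_extension by blast
    obtain K where K: "normal_in \<Delta> K" "K \<inter> elements_over ?G = M"
      and Ku: "\<And>K'. normal_in \<Delta> K' \<Longrightarrow> K' \<inter> elements_over ?G = M \<Longrightarrow> K' = K"
      using less.hyps[OF dec cG GG(2) M(1)] by blast
    show ?thesis
    proof (rule ex1I[of _ K])
      show "normal_in \<Delta> K \<and> K \<inter> elements_over \<Gamma> = N" using K M(2) gg by blast
      show "K' = K" if K': "normal_in \<Delta> K' \<and> K' \<inter> elements_over \<Gamma> = N" for K'
      proof -
        have "?G \<subseteq> \<Delta>" using cG unfolding closed_def by blast
        then have "normal_in ?G (K' \<inter> elements_over ?G)" using normal_in_trace[OF _ _ cG] K' by blast
        moreover have "(K' \<inter> elements_over ?G) \<inter> elements_over \<Gamma> = N" using K' gg by blast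
        ultimately have "K' \<inter> elements_over ?G = M" by (rule Mu)
        then show ?thesis using Ku K' by blast
      qed
    qed
  qed
qed

lemma word_stab_Nil: "word_stab L S [] = S"
proof -
  have "x \<in> word_stab L S []" if "x \<in> S" for x
    unfolding word_stab_def using that by (auto intro!: exI[of _ "[x]"])
  then show ?thesis by (auto simp: word_stab_def)
qed

lemma word_stab_Cons: "word_stab L S (g # w) = {x \<in> S_of g. pconj L g x \<in> word_stab L S w}"
proof (rule Set.set_eqI, rule iffI)
  fix x assume "x \<in> word_stab L S (g # w)"
  then obtain xs where x: "x \<in> S" and xs: "length xs = Suc (length (g # w))" "xs ! 0 = x" "set xs \<subseteq> S"
    and s: "\<forall>i < length (g # w). xs ! i \<in> conj_dom L ((g # w) ! i) \<and> pconj L ((g # w) ! i) (xs ! i) = xs ! Suc i"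
    unfolding word_stab_def by blast
  obtain ys where ys: "xs = x # ys" using xs(1,2) by (cases xs) auto
  have y: "length ys = Suc (length w)" "set ys \<subseteq> S" using xs ys by auto
  have 0: "x \<in> conj_dom L g" "pconj L g x = ys ! 0" using s[rule_format, of 0] ys by auto
  have i: "\<forall>i < length w. ys ! i \<in> conj_dom L (w ! i) \<and> pconj L (w ! i) (ys ! i) = ys ! Suc i"
  proof (intro allI impI)
    fix i assume "i < length w"
    then show "ys ! i \<in> conj_dom L (w ! i) \<and> pconj L (w ! i) (ys ! i) = ys ! Suc i"
      using s[rule_format, of "Suc i"] ys by simp
  qed
  have "ys ! 0 \<in> S" using y nth_mem[of 0 ys] by auto
  moreover from this have "ys ! 0 \<in> word_stab L S w" unfolding word_stab_def using y i by blast
  ultimately show "x \<in> {x \<in> S_of g. pconj L g x \<in> word_stab L S w}" using x 0 by (simp add: S_of_def)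
next
  fix x assume "x \<in> {x \<in> S_of g. pconj L g x \<in> word_stab L S w}"
  then have x: "x \<in> S" "x \<in> conj_dom L g" and w: "pconj L g x \<in> word_stab L S w" by (auto simp: S_of_def)
  obtain ys where y: "length ys = Suc (length w)" "ys ! 0 = pconj L g x" "set ys \<subseteq> S"
    and i: "\<forall>i < length w. ys ! i \<in> conj_dom L (w ! i) \<and> pconj L (w ! i) (ys ! i) = ys ! Suc i"
    using w unfolding word_stab_def by blast
  have "\<forall>i < length (g # w). (x # ys) ! i \<in> conj_dom L ((g # w) ! i) \<and>
      pconj L ((g # w) ! i) ((x # ys) ! i) = (x # ys) ! Suc i"
    using i y(2) x by (auto simp: nth_Cons split: nat.split)
  moreover have "length (x # ys) = Suc (length (g # w))" "(x # ys) ! 0 = x" "set (x # ys) \<subseteq> S" using y x by auto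
  ultimately show "x \<in> word_stab L S (g # w)" using x(1) unfolding word_stab_def by blast
qed

lemma word_stab_subgroup:
  assumes "set w \<subseteq> pcarrier L" shows "pg_subgroup L (word_stab L S w)" "word_stab L S w \<subseteq> S"
proof -
  show s: "word_stab L S w \<subseteq> S" for w by (auto simp: word_stab_def)
  show "pg_subgroup L (word_stab L S w)" using assms
  proof (induction w)
    case Nil then show ?case using word_stab_Nil S_subgroup by simp
  next
    case (Cons g w)
    then have IH: "pg_subgroup L (word_stab L S w)" and g: "g \<in> pcarrier L" by auto
    note sg = S_of_subgroup[OF g]
    have "pone \<in> word_stab L S (g # w)"
      using subgroup_one[OF sg] subgroup_one[OF IH] pconj_one_elt(2)[OF g] by (simp add: word_stab_Cons)
    moreover have "pinv L x \<in> word_stab L S (g # w)" if "x \<in> word_stab L S (g # w)" for x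
      using that S_of_inv[OF g, of x] subgroup_inv[OF IH] by (simp add: word_stab_Cons)
    moreover have "pmul x y \<in> word_stab L S (g # w)" if "x \<in> word_stab L S (g # w)" "y \<in> word_stab L S (g # w)" for x y
      using that S_of_mul[OF g, of x y] subgroup_mul[OF IH] by (simp add: word_stab_Cons)
    ultimately show ?case using sub_S_iff[OF s] by blast
  qed
qed

lemma path_word_stab: "path P w Q \<Longrightarrow> P \<subseteq> word_stab L S w"
proof (induction w arbitrary: P)
  case Nil then show ?case using Delta_sub by (auto simp: word_stab_Nil)
next
  case (Cons g w)
  then obtain U where U: "arrow P g U" "path U w Q" by auto
  show ?case using Cons.IH[OF U(2)] arrow_S_of[OF U(1)] arrowD(5)[OF U(1)] by (auto simp: word_stab_Cons)
qed

lemma word_stab_path: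
  "P \<in> \<Delta> \<Longrightarrow> set w \<subseteq> pcarrier L \<Longrightarrow> P \<subseteq> word_stab L S w \<Longrightarrow> \<exists>Q. path P w Q"
proof (induction w arbitrary: P)
  case (Cons g w)
  have g: "arrow P g (pconj L g ` P)" using arrowI[of g P] Cons.prems by (auto simp: word_stab_Cons)
  have "pconj L g ` P \<subseteq> word_stab L S w" using Cons.prems(3) by (auto simp: word_stab_Cons)
  then obtain Q where "path (pconj L g ` P) w Q" using Cons.IH[OF arrowD(2)[OF g]] Cons.prems(2) by auto
  then show ?case using g by auto
next
  case Nil then show ?case using path_Nil by blast
qed

lemma word_stab_in_iff:
  assumes c: "closed \<Gamma>" and w: "set w \<subseteq> pcarrier L"
  shows "word_stab L S w \<in> \<Gamma> \<longleftrightarrow> (\<exists>P\<in>\<Gamma>. \<exists>Q. path P w Q)"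
proof
  assume "word_stab L S w \<in> \<Gamma>"
  moreover from this have "word_stab L S w \<in> \<Delta>" using c unfolding closed_def by blast
  ultimately show "\<exists>P\<in>\<Gamma>. \<exists>Q. path P w Q" using word_stab_path[OF _ w order_refl] by blast
next
  assume "\<exists>P\<in>\<Gamma>. \<exists>Q. path P w Q"
  then obtain P Q where P: "P \<in> \<Gamma>" "path P w Q" by blast
  note s = word_stab_subgroup[OF w] path_word_stab[OF P(2)]
  have "word_stab L S w \<in> \<Delta>" using Delta_over[OF _ s(3,2,1)] path_Delta[OF P(2)] by blast
  then show "word_stab L S w \<in> \<Gamma>" using P(1) s(3) c unfolding closed_def by blast
qed

lemma restriction_simps:
  "pcarrier (pg_restriction L S \<Gamma>) = elements_over \<Gamma>"
  "pprod (pg_restriction L S \<Gamma>) = pprod L" "pinv (pg_restriction L S \<Gamma>) = pinv L"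
  "pconj (pg_restriction L S \<Gamma>) = pconj L"
  by (auto simp: pg_restriction_def elements_over_def S_of_word_stab pconj_def fun_eq_iff)

lemma restriction_dom:
  assumes "closed \<Gamma>"
  shows "w \<in> pdom (pg_restriction L S \<Gamma>) \<longleftrightarrow> (\<exists>P\<in>\<Gamma>. \<exists>Q. path P w Q)"
proof -
  have "set w \<subseteq> pcarrier L" if "path P w Q" for P Q using dom_carrier[OF path_dom[OF that]] by blast
  moreover have "w \<in> pdom (pg_restriction L S \<Gamma>) \<longleftrightarrow> set w \<subseteq> pcarrier L \<and> word_stab L S w \<in> \<Gamma>"
    by (auto simp: pg_restriction_def in_lists_conv_set)
  ultimately show ?thesis using word_stab_in_iff[OF assms] by blast
qed

lemma partial_normal_restriction:
  assumes c: "closed \<Gamma>" shows "partial_normal (pg_restriction L S \<Gamma>) N \<longleftrightarrow> normal_in \<Gamma> N"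
proof -
  let ?M = "pg_restriction L S \<Gamma>"
  note D = restriction_dom[OF c] and RS = restriction_simps
  have c2: "\<And>P g Q. P \<in> \<Gamma> \<Longrightarrow> arrow P g Q \<Longrightarrow> Q \<in> \<Gamma>" and c3: "S \<in> \<Gamma>"
    using c unfolding closed_def by blast+
  have gI: "g \<in> elements_over \<Gamma>" if "arrow P g Q" "P \<in> \<Gamma>" for P g Q
    using c arrow_S_of[OF that(1)] S_of_Delta[OF arrowD(3)[OF that(1)]] arrowD(3)[OF that(1)] that(2)
    unfolding closed_def elements_over_def by blast
  show ?thesis
  proof
    assume N: "partial_normal ?M N"
    then have sub: "N \<subseteq> elements_over \<Gamma>" and inv: "\<forall>h\<in>N. pinv L h \<in> N"
      and pr: "\<And>w. set w \<subseteq> N \<Longrightarrow> w \<in> pdom ?M \<Longrightarrow> pprod L w \<in> N"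
      and co: "\<And>g x. g \<in> elements_over \<Gamma> \<Longrightarrow> x \<in> N \<Longrightarrow> x \<in> conj_dom ?M g \<Longrightarrow> pconj L g x \<in> N"
      unfolding partial_normal_def partial_subgroup_def RS by (auto simp: in_lists_conv_set)
    show "normal_in \<Gamma> N" unfolding normal_in_def
    proof (intro conjI ballI allI impI)
      show "N \<subseteq> elements_over \<Gamma>" by (rule sub)
      have "[] \<in> pdom ?M" using D c3 path_Nil[OF S_Delta] by blast
      then show "pone \<in> N" using pr[of "[]"] by simp
      show "pinv L x \<in> N" if "x \<in> N" for x using inv that by blast
      show "pmul x y \<in> N" if "x \<in> N" "y \<in> N" "P \<in> \<Gamma>" "arrow P x Q" "arrow Q y U" for x y P Q U
      proof -
        have "[x, y] \<in> pdom ?M" using D that(3) path_Cons[OF that(4) path_Cons[OF that(5) path_Nil[OF arrowD(2)[OF that(5)]]]]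
          by blast
        then show ?thesis using pr[of "[x, y]"] that by simp
      qed
      show "pconj L g x \<in> N"
        if a: "x \<in> N" "P \<in> \<Gamma>" "arrow P x Q" "arrow P g P'" "arrow Q g Q'" for x g P Q P' Q'
      proof -
        have "path P' [pinv L g, x, g] Q'"
          by (rule path_Cons[OF arrow_inv[OF a(4)]] path_Cons[OF a(3)] path_Cons[OF a(5)] path_Nil arrowD(2)[OF a(5)])+
        then have "[pinv L g, x, g] \<in> pdom ?M" using D c2[OF a(2,4)] by blast
        then have "x \<in> conj_dom ?M g" using sub a(1) by (auto simp: conj_dom_def RS)
        then show ?thesis using co[OF gI[OF a(4,2)] a(1)] by blast
      qed
    qed
  next
    assume N: "normal_in \<Gamma> N"
    then have sub: "N \<subseteq> elements_over \<Gamma>" and one: "pone \<in> N" and inv: "\<forall>h\<in>N. pinv L h \<in> N"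
      and mul: "\<And>x y P Q R. x \<in> N \<Longrightarrow> y \<in> N \<Longrightarrow> P \<in> \<Gamma> \<Longrightarrow> arrow P x Q \<Longrightarrow> arrow Q y R \<Longrightarrow> pmul x y \<in> N"
      and co: "\<And>x g P Q P' Q'. x \<in> N \<Longrightarrow> P \<in> \<Gamma> \<Longrightarrow> arrow P x Q \<Longrightarrow> arrow P g P' \<Longrightarrow> arrow Q g Q' \<Longrightarrow> pconj L g x \<in> N"
      unfolding normal_in_def by blast+
    have pr: "pprod L w \<in> N" if "path P w Q" "P \<in> \<Gamma>" "set w \<subseteq> N" for P w Q
      using that
    proof (induction w arbitrary: P)
      case Nil then show ?case using one by simp
    next
      case (Cons g w)
      then obtain U where U: "arrow P g U" "path U w Q" by auto
      have "pprod L w \<in> N" using Cons.IH[OF U(2) c2[OF Cons.prems(2) U(1)]] Cons.prems(3) by simp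
      then show ?case using mul[OF _ _ Cons.prems(2) U(1) path_prod[OF U(2)]] Cons.prems(3)
          prod_Cons(2)[OF path_dom[OF Cons.prems(1)]] by simp
    qed
    have cj: "pconj L g x \<in> N" if "g \<in> elements_over \<Gamma>" "x \<in> N" "x \<in> conj_dom ?M g" for g x
    proof -
      have "[pinv L g, x, g] \<in> pdom ?M" using that(3) by (simp add: conj_dom_def RS)
      then obtain P Q where P: "P \<in> \<Gamma>" "path P [pinv L g, x, g] Q" using D by blast
      then obtain P1 Q1 where a: "arrow P (pinv L g) P1" "arrow P1 x Q1" "arrow Q1 g Q" by auto
      have gc: "g \<in> pcarrier L" using that(1) by (simp add: elements_over_def)
      have "arrow P1 g P" using arrow_inv[OF a(1)] inv_inv[OF gc] by simp
      then show ?thesis using co[OF that(2) c2[OF P(1) a(1)] a(2) _ a(3)] by blast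
    qed
    have "partial_subgroup ?M N"
      unfolding partial_subgroup_def RS
    proof (intro conjI ballI)
      show "N \<noteq> {}" using one by blast
      show "N \<subseteq> elements_over \<Gamma>" by (rule sub)
      show "pinv L h \<in> N" if "h \<in> N" for h using inv that by blast
      show "pprod L w \<in> N" if "w \<in> lists N \<inter> pdom ?M" for w
      proof -
        have "set w \<subseteq> N" "w \<in> pdom ?M" using that by (auto simp: in_lists_conv_set)
        then show ?thesis using pr D by blast
      qed
    qed
    then show "partial_normal ?M N" unfolding partial_normal_def RS using cj by blast
  qed
qed

lemma restriction_Delta: "pgroup_eq (pg_restriction L S \<Delta>) L"
proof -
  have "w \<in> pdom (pg_restriction L S \<Delta>) \<longleftrightarrow> w \<in> pdom L" for w
    unfolding restriction_dom[OF closed_Delta] dom_iff using path_Delta by blast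
  then show ?thesis by (auto simp: pgroup_eq_def restriction_simps elements_over_Delta)
qed

end

lemma partial_normal_cong:
  assumes e: "pgroup_eq A B" and N: "partial_normal A N" shows "partial_normal B N"
proof -
  have c: "pcarrier A = pcarrier B" "pdom A = pdom B" and p: "\<And>w. w \<in> pdom B \<Longrightarrow> pprod A w = pprod B w"
    and i: "\<And>g. g \<in> pcarrier B \<Longrightarrow> pinv A g = pinv B g"
    using e by (auto simp: pgroup_eq_def)
  have d: "conj_dom A g = conj_dom B g" if "g \<in> pcarrier B" for g using i[OF that] by (simp add: conj_dom_def c)
  have k: "pconj A g x = pconj B g x" if "g \<in> pcarrier B" "x \<in> conj_dom B g" for g x
    using i[OF that(1)] that(2) p by (simp add: conj_dom_def pconj_def)
  have "partial_subgroup A N" using N by (simp add: partial_normal_def)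
  then have "partial_subgroup B N" using i p c by (auto simp: partial_subgroup_def subset_iff)
  moreover have "pconj B g x \<in> N" if "g \<in> pcarrier B" "x \<in> N \<inter> conj_dom B g" for g x
    using N that d[OF that(1)] k[OF that(1)] c by (auto simp: partial_normal_def)
  ultimately show ?thesis by (simp add: partial_normal_def)
qed

lemma pgroup_eq_sym: "pgroup_eq A B \<Longrightarrow> pgroup_eq B A"
  by (auto simp: pgroup_eq_def)

text \<open>Conjugation in \<open>Lp\<close> belongs to the common fusion system, so on an object from \<open>\<Delta>\<close> it is also
  conjugation by an element of \<open>L\<close>, and the latter preserves \<open>\<Delta>\<close>.\<close>

lemma restriction_objects_closed:
  assumes L: "locality_context p L \<Delta> S" and Lp: "locality_context p Lp \<Delta>p S" and sub: "\<Delta> \<subseteq> \<Delta>p"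
    and F: "locality_fusion L S = locality_fusion Lp S"
  shows "locality_context.closed Lp \<Delta>p S \<Delta>"
proof -
  interpret L: locality_context p L \<Delta> S by (rule L)
  interpret Lp: locality_context p Lp \<Delta>p S by (rule Lp)
  have G: "pg_group L S = pg_group Lp S"
    using F L.fgroup_locality_fusion Lp.fgroup_locality_fusion by metis
  have "Q \<in> \<Delta>" if a: "P \<in> \<Delta>" "Lp.arrow P g Q" for P g Q
  proof -
    have "restrict (pconj Lp g) P \<in> fhom (locality_fusion L S) P Q"
      unfolding F using Lp.conj_in_fusion[OF a(2) order_refl Lp.arrowD(9,7)[OF a(2)]] .
    then obtain h where "L.arrow P h (restrict (pconj Lp g) P ` P)" using L.fusion_object[OF _ a(1)] by blast
    moreover have "restrict (pconj Lp g) P ` P = Q" using Lp.arrowD(5)[OF a(2)] by simp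
    ultimately show ?thesis using L.arrowD(2) by blast
  qed
  moreover have "Q \<in> \<Delta>" if "P \<in> \<Delta>" "P \<subseteq> Q" "Q \<in> \<Delta>p" for P Q
  proof -
    have "subgroup Q (pg_group Lp S)" using Lp.SG_sub_iff Lp.Delta_subgroup Lp.Delta_sub that(3) by blast
    then have "pg_subgroup L Q" "Q \<subseteq> S" using L.SG_sub_iff G by auto
    then show ?thesis using L.Delta_over[OF that(1,2)] by blast
  qed
  ultimately show ?thesis unfolding Lp.closed_def using L.S_Delta sub by blast
qed

theorem theoremA2:
  fixes p :: nat and L Lp :: "'a pgroup" and \<Delta> \<Delta>p :: "'a set set" and S :: "'a set"
    and F :: "'a fusion"
  assumes "Factorial_Ring.prime p"
    and "proper_locality p L \<Delta> S" and "F = locality_fusion L S"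
    and "fusion_closed F \<Delta>p" and "\<Delta> \<subseteq> \<Delta>p" and "\<Delta>p \<subseteq> subcentrics F"
    and "proper_locality p Lp \<Delta>p S" and "F = locality_fusion Lp S"
    and "pgroup_eq (pg_restriction Lp S \<Delta>) L"
  shows "(\<forall>N. partial_normal L N \<longrightarrow> (\<exists>!M. partial_normal Lp M \<and> N = M \<inter> pcarrier L)) \<and>
    bij_betw (normal_extension L Lp) {N. partial_normal L N} {M. partial_normal Lp M} \<and>
    mono_on {N. partial_normal L N} (normal_extension L Lp)"
proof -
  have locs: "locality_context p L \<Delta> S" "locality_context p Lp \<Delta>p S"
    using assms(1,2,7) by (auto simp: locality_context_def proper_locality_def)
  interpret Lp: locality_context p Lp \<Delta>p S by (rule locs(2))
  have F: "locality_fusion L S = locality_fusion Lp S" using assms(3,8) by simp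
  have c: "Lp.closed \<Delta>" by (rule restriction_objects_closed[OF locs assms(5) F])
  have car: "pcarrier L = Lp.elements_over \<Delta>"
    using assms(9) Lp.restriction_simps(1) by (auto simp: pgroup_eq_def)
  have nL: "partial_normal L N \<longleftrightarrow> Lp.normal_in \<Delta> N" for N
    using partial_normal_cong[OF assms(9)] partial_normal_cong[OF pgroup_eq_sym[OF assms(9)]]
      Lp.partial_normal_restriction[OF c] by blast
  have nLp: "partial_normal Lp M \<longleftrightarrow> Lp.normal_in \<Delta>p M" for M
    using partial_normal_cong[OF Lp.restriction_Delta] partial_normal_cong[OF pgroup_eq_sym[OF Lp.restriction_Delta]]
      Lp.partial_normal_restriction[OF Lp.closed_Delta] by blast
  have cr: "centrics (locality_fusion Lp S) \<inter> radicals (locality_fusion Lp S) \<subseteq> \<Delta>"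
    using assms(2) F by (simp add: proper_locality_def)
  have char: "centralizer (Lp.NG P) (p_core p (Lp.NG P)) \<subseteq> p_core p (Lp.NG P)" if "P \<in> \<Delta>p" for P
    using assms(7) that by (simp add: proper_locality_def Let_def)
  have ex1: "\<exists>!M. partial_normal Lp M \<and> N = M \<inter> pcarrier L" if "partial_normal L N" for N
  proof -
    have "\<exists>!M. Lp.normal_in \<Delta>p M \<and> M \<inter> Lp.elements_over \<Delta> = N"
      using Lp.normal_extension_unique[OF c cr char] that nL by blast
    then show ?thesis unfolding nLp car by (simp only: eq_commute[of N])
  qed
  have trace: "partial_normal L (M \<inter> pcarrier L)" if "partial_normal Lp M" for M
    using Lp.normal_in_trace[OF _ assms(5) c] that unfolding nL nLp car by blast
  let ?e = "normal_extension L Lp"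
  have e: "partial_normal Lp (?e N)" "N = ?e N \<inter> pcarrier L" if "partial_normal L N" for N
    using theI'[OF ex1[OF that]] unfolding normal_extension_def by auto
  have eu: "M = ?e (M \<inter> pcarrier L)" if "partial_normal Lp M" for M
    using ex1[OF trace[OF that]] e[OF trace[OF that]] that by blast
  have "bij_betw ?e {N. partial_normal L N} {M. partial_normal Lp M}"
    by (rule bij_betw_byWitness[where f' = "\<lambda>M. M \<inter> pcarrier L"]) (use e eu trace in auto)
  moreover have "mono_on {N. partial_normal L N} ?e"
  proof (rule mono_onI)
    fix N K assume "N \<in> {N. partial_normal L N}" "K \<in> {N. partial_normal L N}" and NK: "N \<le> K"
    then have N: "partial_normal L N" and K: "partial_normal L K" by auto
    have "partial_normal Lp (?e N \<inter> ?e K)"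
      using e(1)[OF N] e(1)[OF K] unfolding nLp by (rule Lp.normal_in_Int)
    moreover have "N = (?e N \<inter> ?e K) \<inter> pcarrier L" using e(2)[OF N] e(2)[OF K] NK by blast
    ultimately have "?e N \<inter> ?e K = ?e N" using ex1[OF N] e[OF N] by blast
    then show "?e N \<le> ?e K" by blast
  qed
  ultimately show ?thesis using ex1 by blast
qed

end
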